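(* Let $\Phi=D_4$ and let $K$ be a field with $\operatorname{char}K\ne2$. Put $\lambda=\alpha_3$, $\rho=\alpha_2+\alpha_3+\alpha_4$, $\sigma=\alpha_1+\alpha_3+\alpha_4$, $\tau=\alpha_1+\alpha_2+\alpha_3$. For $k\in K^*$ let $\sim_k$ be the equivalence relation on $K^*$ given by $$a\sim_k b\iff \exists\,x,y\in K:\ x^2-ky^2=ab,$$ and let $K_k=K^*/{\sim_k}$ be the set of its classes. Then the orbits of $G_0$ on $V_1$ (with $G_0$, $V_1$ as in the context) are exactly the following (when a parameter is said to lie in a set of classes, it runs over a fixed set of representatives of these classes; different types and different values of parameters give different orbits): I. The zero orbit, $x=0$. II. One orbit of singular vectors; its elements can be brought to the form $x=e_\lambda$. III. Three series of orbits of brilliant vectors; their elements can be brought to one of the following forms: (a) $x=e_\lambda+x^\rho e_\rho$, $x^\rho\in K^*/(K^* )^2$; (b) $x=e_\lambda+x^\sigma e_\sigma$, $x^\sigma\in K^*/(K^* )^2$; (c) $x=e_\lambda+x^\tau e_\tau$, $x^\tau\in K^*/(K^* )^2$. IV. One series of orbits of luminous vectors; their elements can be brought to the form $x=e_\lambda+x^\rho e_\rho+x^\sigma e_\sigma$, $x^\rho,x^\sigma\in K^*/(K^* )^2$. V. One series of orbits of dark vectors; their elements can be brought to the form $x=e_\lambda+x^\rho e_\rho+x^\sigma e_\sigma+x^\tau e_\tau$, where $k\in K^*$, $x^\rho,x^\sigma\in K_k$, $x^\tau=\dfrac{k}{x^\rho x^\sigma}$.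
   Context: Numbering: the simple roots of $D_4$ are $\Pi=\{\alpha_1,\alpha_2,\alpha_3,\alpha_4\}$, where $\alpha_3$ is the central node of the Dynkin diagram, adjacent to each of $\alpha_1,\alpha_2,\alpha_4$. The maximal root is $\delta=\alpha_1+\alpha_2+2\alpha_3+\alpha_4$. Lie algebra and group: $V=V(\Phi)$ is the Lie algebra of type $\Phi$ over $K$ (the $\mathbb Z$-span of a Chevalley basis tensored with $K$) with Chevalley basis $\{e_\alpha,\alpha\in\Phi;\ h_\alpha,\alpha\in\Pi\}$: $[e_\alpha,e_{-\alpha}]=h_\alpha$, $[h_\alpha,e_\beta]=\frac{2(\alpha,\beta)}{(\alpha,\alpha)}e_\beta$, $[e_\alpha,e_\beta]=N_{\alpha\beta}e_{\alpha+\beta}$ with $N_{\alpha\beta}=\pm1$ if $\alpha+\beta\in\Phi$, and $[e_\alpha,e_\beta]=0$ if $\alpha+\beta\notin\Phi$, $\beta\ne-\alpha$. The Chevalley basis is assumed positive: $N_{\alpha_i\beta}=1$ whenever $\alpha_i\in\Pi$, $\beta,\alpha_i+\beta\in\Phi^+$, and $\alpha_i$ is the simple root with smallest index such that subtracting it from $\alpha_i+\beta$ gives a root. For $x\in V$ write $x=\sum_{\alpha\in\Phi}x^\alpha e_\alpha+x^h$ with $x^h$ in the Cartan subalgebra. $G=G_{\rm sc}(\Phi,K)$ is the simply connected Chevalley group generated by the elementary root elements $x_\alpha(a)$, $\alpha\in\Phi$, $a\in K$, acting on $V$ by the adjoint action ($x_\alpha(a)=\exp(a\,\mathrm{ad}\,e_\alpha)$;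 in particular $x_\alpha(a)e_\beta=e_\beta+N_{\alpha\beta}a e_{\alpha+\beta}$ if $\angle(\alpha,\beta)=2\pi/3$, and $x_\alpha(a)e_{-\alpha}=e_{-\alpha}+ah_\alpha-a^2e_\alpha$). $G_0$ and $V_1$: $\Phi_0=\{\alpha\in\Phi:\alpha\perp\delta\}$, $\Phi_1=\{\alpha\in\Phi:\angle(\alpha,\delta)=\pi/3\}$; $G_0=G_{\rm sc}(\Phi_0,K)$ is the subgroup of $G$ generated by the $x_\alpha(a)$, $\alpha\in\Phi_0$, $a\in K$; $V_1$ is the $K$-span of $e_\alpha$, $\alpha\in\Phi_1$. The group $G_0$ acts on $V_1$ by restriction. Types of vectors: a root element of $V$ is an element of the form $g e_\alpha$ with $g\in G$, $\alpha\in\Phi$. Two root elements $y,z$ have angle $\varphi$ between them if for some $g\in G$ one has $gy\in K^*e_\alpha$, $gz\in K^*e_\beta$ with $\alpha,\beta\in\Phi$, $\angle(\alpha,\beta)=\varphi$. It is known (for $\Phi\ne A_l$, $\operatorname{char}K\neq2$) that for every $x=\sum_{\alpha\in\Phi_1}x^\alpha e_\alpha\in V_1$ there is a unique root element $y=\sum_{\alpha\in\Phi}y^\alpha e_\alpha+y^h$ with $y^\alpha=x^\alpha$ for $\alpha\in\Phi_1$, $y^\delta=1$ and $y^h\in\langle h_\alpha;\alpha\in\Phi_0\cap\Pi\rangle$. The vector $x$ is called dark if the angle between $y$ and $e_\delta$ is $\pi$ (equivalently, $y^{-\delta}\neq0$), luminous if this angle is $2\pi/3$, brilliant if it is $\pi/2$,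 and singular if it is $\pi/3$ (equivalently, $x$ is itself a root element). *)

theory Defs
  imports
    Complex_Main
    "HOL-Library.Product_Plus"
    "HOL-Computational_Algebra.Computational_Algebra"
    "HOL-Algebra.Generated_Groups"
    "HOL-Algebra.Group_Action"
begin

section \<open>The root system of type \<open>D\<^sub>4\<close>\<close>

text \<open>
  The tuple \<open>(a, b, c, d)\<close> stands for
  \<open>a \<alpha>\<^sub>1 + b \<alpha>\<^sub>2 + c \<alpha>\<^sub>3 + d \<alpha>\<^sub>4\<close>, where \<open>\<alpha>\<^sub>3\<close> is the central node of the Dynkin diagram.
  The bilinear form \<open>rinner\<close> is given by the Cartan matrix, so every root has squared length 2 and,
  the diagram being simply laced, the roots are exactly the lattice vectors of squared length 2.
\<close>

type_synonym rt = "int \<times> int \<times> int \<times> int"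

fun rinner :: "rt \<Rightarrow> rt \<Rightarrow> int" where
  "rinner (a, b, c, d) (a', b', c', d') =
     2 * (a * a' + b * b' + c * c' + d * d')
     - (a * c' + c * a') - (b * c' + c * b') - (d * c' + c * d')"

definition Phi :: "rt set" where
  "Phi = {\<alpha>. rinner \<alpha> \<alpha> = 2}"

definition root_angle :: "rt \<Rightarrow> rt \<Rightarrow> real" where
  "root_angle \<alpha> \<beta> =
     arccos (real_of_int (rinner \<alpha> \<beta>)
             / (sqrt (real_of_int (rinner \<alpha> \<alpha>)) * sqrt (real_of_int (rinner \<beta> \<beta>))))"

definition simple_root :: "nat \<Rightarrow> rt" where
  "simple_root i = (of_bool (i = 1), of_bool (i = 2), of_bool (i = 3), of_bool (i = 4))"

fun rcoeff :: "rt \<Rightarrow> nat \<Rightarrow> int" where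
  "rcoeff (a, b, c, d) i =
     (if i = 1 then a else if i = 2 then b else if i = 3 then c else if i = 4 then d else 0)"

definition Phi_pos :: "rt set" where
  "Phi_pos = {\<alpha> \<in> Phi. \<forall>i\<in>{1..4}. 0 \<le> rcoeff \<alpha> i}"

definition \<delta> :: rt where "\<delta> = (1, 1, 2, 1)"

definition Phi0 :: "rt set" where
  "Phi0 = {\<alpha> \<in> Phi. rinner \<alpha> \<delta> = 0}"

definition Phi1 :: "rt set" where
  "Phi1 = {\<alpha> \<in> Phi. root_angle \<alpha> \<delta> = pi / 3}"

definition r_lambda :: rt where "r_lambda = (0, 0, 1, 0)"
definition r_rho    :: rt where "r_rho    = (0, 1, 1, 1)"
definition r_sigma  :: rt where "r_sigma  = (1, 0, 1, 1)"
definition r_tau    :: rt where "r_tau    = (1, 1, 1, 0)"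


section \<open>The Lie algebra of type \<open>D\<^sub>4\<close> over a commutative ring\<close>

text \<open>
  \<open>E \<alpha>\<close> labels the basis vector \<open>e\<^sub>\<alpha>\<close> and \<open>H i\<close> labels \<open>h\<close> of the \<open>i\<close>-th simple root.  An element
  of the Lie algebra is the function of its coordinates, which vanishes off \<open>basis\<close>.
\<close>

datatype label = E rt | H nat

definition basis :: "label set" where
  "basis = E ` Phi \<union> H ` {1..4}"

definition lie_space :: "(label \<Rightarrow> 'a::comm_ring_1) set" where
  "lie_space = {x. \<forall>k. k \<notin> basis \<longrightarrow> x k = 0}"

definition evec :: "rt \<Rightarrow> label \<Rightarrow> 'a::comm_ring_1" where
  "evec \<alpha> = (\<lambda>k. of_bool (k = E \<alpha>))"

definition scale :: "'a::comm_ring_1 \<Rightarrow> (label \<Rightarrow> 'a) \<Rightarrow> label \<Rightarrow> 'a" where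
  "scale c x = (\<lambda>k. c * x k)"

text \<open>
  For a root \<open>\<alpha> = \<Sum> n\<^sub>i \<alpha>\<^sub>i\<close> of a simply laced system the coroot is \<open>h\<^sub>\<alpha> = \<Sum> n\<^sub>i h\<^sub>i\<close>.
\<close>

fun hvec :: "rt \<Rightarrow> label \<Rightarrow> int" where
  "hvec \<alpha> (E \<beta>) = 0"
| "hvec \<alpha> (H i) = rcoeff \<alpha> i"

definition cartan_int :: "rt \<Rightarrow> rt \<Rightarrow> int" where
  "cartan_int \<alpha> \<beta> = 2 * rinner \<alpha> \<beta> div rinner \<alpha> \<alpha>"

text \<open>
  \<open>bracket_basis N i j k\<close> is the coordinate at \<open>k\<close> of the bracket of the basis vectors labelled
  \<open>i\<close> and \<open>j\<close>, for structure constants \<open>N\<close>; \<open>bracket\<close> is its bilinear extension.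
\<close>

fun bracket_basis :: "(rt \<Rightarrow> rt \<Rightarrow> int) \<Rightarrow> label \<Rightarrow> label \<Rightarrow> label \<Rightarrow> int" where
  "bracket_basis N (H i) (H j) k = 0"
| "bracket_basis N (H i) (E \<beta>) k = cartan_int (simple_root i) \<beta> * evec \<beta> k"
| "bracket_basis N (E \<alpha>) (H j) k = - cartan_int (simple_root j) \<alpha> * evec \<alpha> k"
| "bracket_basis N (E \<alpha>) (E \<beta>) k =
     (if \<beta> = - \<alpha> then hvec \<alpha> k
      else if \<alpha> + \<beta> \<in> Phi then N \<alpha> \<beta> * evec (\<alpha> + \<beta>) k
      else 0)"

definition bracket ::
    "(rt \<Rightarrow> rt \<Rightarrow> int) \<Rightarrow> (label \<Rightarrow> 'a::comm_ring_1) \<Rightarrow> (label \<Rightarrow> 'a) \<Rightarrow> label \<Rightarrow> 'a" where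
  "bracket N x y = (\<lambda>k. \<Sum>i\<in>basis. \<Sum>j\<in>basis. of_int (bracket_basis N i j k) * x i * y j)"

definition chevalley_constants :: "(rt \<Rightarrow> rt \<Rightarrow> int) \<Rightarrow> bool" where
  "chevalley_constants N \<longleftrightarrow>
     (\<forall>\<alpha>\<in>Phi. \<forall>\<beta>\<in>Phi. \<alpha> + \<beta> \<in> Phi \<longrightarrow> N \<alpha> \<beta> = 1 \<or> N \<alpha> \<beta> = - 1) \<and>
     (\<forall>x\<in>(lie_space :: (label \<Rightarrow> int) set). \<forall>k. bracket N x x k = 0) \<and>
     (\<forall>x\<in>(lie_space :: (label \<Rightarrow> int) set). \<forall>y\<in>lie_space. \<forall>z\<in>lie_space. \<forall>k.
        bracket N x (bracket N y z) k + bracket N y (bracket N z x) k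
          + bracket N z (bracket N x y) k = 0)"

definition positive_constants :: "(rt \<Rightarrow> rt \<Rightarrow> int) \<Rightarrow> bool" where
  "positive_constants N \<longleftrightarrow>
     (\<forall>i\<in>{1..4}. \<forall>\<beta>\<in>Phi_pos. simple_root i + \<beta> \<in> Phi_pos \<longrightarrow>
        (\<forall>j\<in>{1..4}. j < i \<longrightarrow> simple_root i + \<beta> - simple_root j \<notin> Phi) \<longrightarrow>
        N (simple_root i) \<beta> = 1)"


section \<open>The Chevalley group and the action of \<open>G\<^sub>0\<close> on \<open>V\<^sub>1\<close>\<close>

text \<open>
  In a simply laced Lie algebra \<open>(ad e\<^sub>\<alpha>)\<^sup>3 = 0\<close>, so the exponential series stops at the quadratic
  term; the field is assumed to have characteristic different from 2.
\<close>

definition elem_root_elt :: "(rt \<Rightarrow> rt \<Rightarrow> int) \<Rightarrow> rt \<Rightarrow> 'a::field \<Rightarrow> (label \<Rightarrow> 'a) \<Rightarrow> label \<Rightarrow> 'a" where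
  "elem_root_elt N \<alpha> a =
     (\<lambda>v\<in>lie_space. \<lambda>k. v k + a * bracket N (evec \<alpha>) v k
        + a\<^sup>2 / 2 * bracket N (evec \<alpha>) (bracket N (evec \<alpha>) v) k)"

text \<open>
  The simply connected Chevalley group enters only through its adjoint action, so \<open>chev_group N\<close>
  and \<open>chev_group0 N\<close> are the images of \<open>G\<close> and \<open>G\<^sub>0\<close> in the group of permutations of the Lie
  algebra; an orbit of a group is an orbit of its image.
\<close>

definition chev_group :: "(rt \<Rightarrow> rt \<Rightarrow> int) \<Rightarrow> ((label \<Rightarrow> 'a::field) \<Rightarrow> label \<Rightarrow> 'a) monoid" where
  "chev_group N = subgroup_generated (BijGroup lie_space) {elem_root_elt N \<alpha> a | \<alpha> a. \<alpha> \<in> Phi}"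

definition chev_group0 :: "(rt \<Rightarrow> rt \<Rightarrow> int) \<Rightarrow> ((label \<Rightarrow> 'a::field) \<Rightarrow> label \<Rightarrow> 'a) monoid" where
  "chev_group0 N = subgroup_generated (BijGroup lie_space) {elem_root_elt N \<alpha> a | \<alpha> a. \<alpha> \<in> Phi0}"

definition V1 :: "(label \<Rightarrow> 'a::field) set" where
  "V1 = {x. \<forall>k. k \<notin> E ` Phi1 \<longrightarrow> x k = 0}"

abbreviation G0_orbit :: "(rt \<Rightarrow> rt \<Rightarrow> int) \<Rightarrow> (label \<Rightarrow> 'a::field) \<Rightarrow> (label \<Rightarrow> 'a) set" where
  "G0_orbit N x \<equiv> orbit (chev_group0 N) (\<lambda>g. g) x"

abbreviation V1_orbits :: "(rt \<Rightarrow> rt \<Rightarrow> int) \<Rightarrow> (label \<Rightarrow> 'a::field) set set" where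
  "V1_orbits N \<equiv> orbits (chev_group0 N) V1 (\<lambda>g. g)"


section \<open>Root elements and the types of vectors\<close>

definition root_elements :: "(rt \<Rightarrow> rt \<Rightarrow> int) \<Rightarrow> (label \<Rightarrow> 'a::field) set" where
  "root_elements N = {g (evec \<alpha>) | g \<alpha>. g \<in> carrier (chev_group N) \<and> \<alpha> \<in> Phi}"

definition has_angle ::
    "(rt \<Rightarrow> rt \<Rightarrow> int) \<Rightarrow> (label \<Rightarrow> 'a::field) \<Rightarrow> (label \<Rightarrow> 'a) \<Rightarrow> real \<Rightarrow> bool" where
  "has_angle N y z \<phi> \<longleftrightarrow>
     y \<in> root_elements N \<and> z \<in> root_elements N \<and>
     (\<exists>g\<in>carrier (chev_group N). \<exists>\<alpha>\<in>Phi. \<exists>\<beta>\<in>Phi. \<exists>c d.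
        c \<noteq> 0 \<and> d \<noteq> 0 \<and> g y = scale c (evec \<alpha>) \<and> g z = scale d (evec \<beta>) \<and>
        root_angle \<alpha> \<beta> = \<phi>)"

definition lifts :: "(rt \<Rightarrow> rt \<Rightarrow> int) \<Rightarrow> (label \<Rightarrow> 'a::field) \<Rightarrow> (label \<Rightarrow> 'a) \<Rightarrow> bool" where
  "lifts N x y \<longleftrightarrow>
     y \<in> root_elements N \<and> (\<forall>\<alpha>\<in>Phi1. y (E \<alpha>) = x (E \<alpha>)) \<and> y (E \<delta>) = 1 \<and>
     (\<forall>i\<in>{1..4}. simple_root i \<notin> Phi0 \<longrightarrow> y (H i) = 0)"

text \<open>
  Over a field of characteristic different from 2 every \<open>x \<in> V1\<close> has exactly one lift; being dark,
  luminous, brilliant or singular is a property of the angle between this lift and \<open>e\<^sub>\<delta>\<close>.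
\<close>

definition the_lift :: "(rt \<Rightarrow> rt \<Rightarrow> int) \<Rightarrow> (label \<Rightarrow> 'a::field) \<Rightarrow> label \<Rightarrow> 'a" where
  "the_lift N x = (THE y. lifts N x y)"

definition dark :: "(rt \<Rightarrow> rt \<Rightarrow> int) \<Rightarrow> (label \<Rightarrow> 'a::field) \<Rightarrow> bool" where
  "dark N x \<longleftrightarrow> x \<in> V1 \<and> has_angle N (the_lift N x) (evec \<delta>) pi"

definition luminous :: "(rt \<Rightarrow> rt \<Rightarrow> int) \<Rightarrow> (label \<Rightarrow> 'a::field) \<Rightarrow> bool" where
  "luminous N x \<longleftrightarrow> x \<in> V1 \<and> has_angle N (the_lift N x) (evec \<delta>) (2 * pi / 3)"

definition brilliant :: "(rt \<Rightarrow> rt \<Rightarrow> int) \<Rightarrow> (label \<Rightarrow> 'a::field) \<Rightarrow> bool" where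
  "brilliant N x \<longleftrightarrow> x \<in> V1 \<and> has_angle N (the_lift N x) (evec \<delta>) (pi / 2)"

definition singular :: "(rt \<Rightarrow> rt \<Rightarrow> int) \<Rightarrow> (label \<Rightarrow> 'a::field) \<Rightarrow> bool" where
  "singular N x \<longleftrightarrow> x \<in> V1 \<and> has_angle N (the_lift N x) (evec \<delta>) (pi / 3)"


section \<open>Parameters and normal forms\<close>

abbreviation units :: "'a::field set" where
  "units \<equiv> UNIV - {0}"

definition square_rel :: "('a::field \<times> 'a) set" where
  "square_rel = {(a, b). a \<in> units \<and> b \<in> units \<and> (\<exists>c\<in>units. a = b * c\<^sup>2)}"

definition norm_rel :: "'a::field \<Rightarrow> ('a \<times> 'a) set" where
  "norm_rel k = {(a, b). a \<in> units \<and> b \<in> units \<and> (\<exists>x y. x\<^sup>2 - k * y\<^sup>2 = a * b)}"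

lemma equiv_square_rel: "equiv units (square_rel :: ('a::field \<times> 'a) set)"
proof (rule equivI)
  show "square_rel \<subseteq> (units :: 'a set) \<times> units"
    by (auto simp: square_rel_def)
  show "refl_on units (square_rel :: ('a \<times> 'a) set)"
    by (auto simp: refl_on_def square_rel_def intro!: bexI[of _ 1])
  show "sym (square_rel :: ('a \<times> 'a) set)"
  proof (rule symI)
    fix a b :: 'a assume "(a, b) \<in> square_rel"
    then obtain c where "a \<noteq> 0" "b \<noteq> 0" "c \<noteq> 0" "a = b * c\<^sup>2"
      by (auto simp: square_rel_def)
    then show "(b, a) \<in> square_rel"
      by (auto simp: square_rel_def power_divide intro!: bexI[of _ "1 / c"])
  qed
  show "trans (square_rel :: ('a \<times> 'a) set)"
  proof (rule transI)
    fix a b d :: 'a assume "(a, b) \<in> square_rel" "(b, d) \<in> square_rel"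
    then obtain c c' where "a \<noteq> 0" "d \<noteq> 0" "c \<noteq> 0" "c' \<noteq> 0" "a = b * c\<^sup>2" "b = d * c'\<^sup>2"
      unfolding square_rel_def by blast
    then have "a = d * (c' * c)\<^sup>2"
      by (simp add: power_mult_distrib)
    with \<open>a \<noteq> 0\<close> \<open>d \<noteq> 0\<close> \<open>c \<noteq> 0\<close> \<open>c' \<noteq> 0\<close> show "(a, d) \<in> square_rel"
      by (auto simp: square_rel_def intro!: bexI[of _ "c' * c"])
  qed
qed

lemma equiv_norm_rel: "equiv units (norm_rel (k :: 'a::field))"
proof (rule equivI)
  show "norm_rel k \<subseteq> units \<times> units"
    by (auto simp: norm_rel_def)
  show "refl_on units (norm_rel k)"
  proof (rule refl_onI)
    fix a :: 'a assume "a \<in> units"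
    moreover have "a\<^sup>2 - k * 0\<^sup>2 = a * a"
      by (simp add: power2_eq_square)
    ultimately show "(a, a) \<in> norm_rel k"
      unfolding norm_rel_def by blast
  qed
  show "sym (norm_rel k)"
    by (auto simp: sym_def norm_rel_def mult.commute)
  show "trans (norm_rel k)"
  proof (rule transI)
    fix a b c :: 'a assume "(a, b) \<in> norm_rel k" "(b, c) \<in> norm_rel k"
    then obtain x y u v where nz: "a \<noteq> 0" "b \<noteq> 0" "c \<noteq> 0"
      and xy: "x\<^sup>2 - k * y\<^sup>2 = a * b" and uv: "u\<^sup>2 - k * v\<^sup>2 = b * c"
      by (auto simp: norm_rel_def)
    have "(x * u + k * y * v)\<^sup>2 - k * (x * v + y * u)\<^sup>2
        = (x\<^sup>2 - k * y\<^sup>2) * (u\<^sup>2 - k * v\<^sup>2)"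
      by (simp add: power2_eq_square algebra_simps)
    also have "\<dots> = a * c * b\<^sup>2"
      unfolding xy uv by (simp add: power2_eq_square)
    finally have "((x * u + k * y * v) / b)\<^sup>2 - k * ((x * v + y * u) / b)\<^sup>2 = a * c"
      using nz by (simp add: power_divide field_simps)
    then show "(a, c) \<in> norm_rel k"
      using nz unfolding norm_rel_def by blast
  qed
qed

definition representatives :: "'a::field set \<Rightarrow> ('a \<times> 'a) set \<Rightarrow> bool" where
  "representatives R r \<longleftrightarrow> R \<subseteq> units \<and> (\<forall>C \<in> units // r. \<exists>!a. a \<in> R \<inter> C)"

text \<open>The constructors are the types of orbits together with their parameters.\<close>

datatype 'a orbit_type =
    Zero
  | Singular
  | Brilliant_rho 'a
  | Brilliant_sigma 'a
  | Brilliant_tau 'a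
  | Luminous 'a 'a
  | Dark 'a 'a 'a

definition on_roots :: "'a::field \<Rightarrow> 'a \<Rightarrow> 'a \<Rightarrow> 'a \<Rightarrow> label \<Rightarrow> 'a" where
  "on_roots l r s t =
     (\<lambda>k. l * evec r_lambda k + r * evec r_rho k + s * evec r_sigma k + t * evec r_tau k)"

fun normal_form :: "'a::field orbit_type \<Rightarrow> label \<Rightarrow> 'a" where
  "normal_form Zero = on_roots 0 0 0 0"
| "normal_form Singular = on_roots 1 0 0 0"
| "normal_form (Brilliant_rho r) = on_roots 1 r 0 0"
| "normal_form (Brilliant_sigma s) = on_roots 1 0 s 0"
| "normal_form (Brilliant_tau t) = on_roots 1 0 0 t"
| "normal_form (Luminous r s) = on_roots 1 r s 0"
| "normal_form (Dark k r s) = on_roots 1 r s (k / (r * s))"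

definition brilliant_types :: "'a set \<Rightarrow> 'a::field orbit_type set" where
  "brilliant_types R = Brilliant_rho ` R \<union> Brilliant_sigma ` R \<union> Brilliant_tau ` R"

definition luminous_types :: "'a set \<Rightarrow> 'a::field orbit_type set" where
  "luminous_types R = {Luminous r s | r s. r \<in> R \<and> s \<in> R}"

definition dark_types :: "('a \<Rightarrow> 'a set) \<Rightarrow> 'a::field orbit_type set" where
  "dark_types RK = {Dark k r s | k r s. k \<in> units \<and> r \<in> RK k \<and> s \<in> RK k}"

definition orbit_types :: "'a set \<Rightarrow> ('a \<Rightarrow> 'a set) \<Rightarrow> 'a::field orbit_type set" where
  "orbit_types R RK =
     {Zero, Singular} \<union> brilliant_types R \<union> luminous_types R \<union> dark_types RK"

end

(* V_1 is the space of 2 x 2 x 2 cubes and G_0 acts on it as SL_2 x SL_2 x SL_2, one factor for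
   each index.  The determinants of the three pencils of slices are binary quadratic forms; the sets
   of their values and their common discriminant, Cayley's hyperdeterminant, are invariants, and
   they separate the normal forms.  Conversely, if the first form represents r, the slices can be
   brought to D = diag(1, r) and M D with M of trace 0; what is left of the group acts on M by
   conjugation and makes M antidiagonal, with the coefficient s being any nonzero value of the
   second form.  If the first form vanishes, the cube is brought to a normal form directly.

   The type of a normal form is read off from its lift.  The roots delta - lambda, delta - rho,
   delta - sigma, delta - tau are pairwise orthogonal, so the lift is obtained from e_delta by
   commuting root elements; each nontrivial one of them can be undone by an opposite root element,
   up to replacing e_beta by e_(beta - gamma), while e_delta stays fixed.  Hence the angle with
   e_delta depends only on the number of nonzero coefficients.  Lifts are unique since a root
   element y satisfies [y, [y, z]] in K y for all z, and different angles are told apart by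
   conditions in terms of the bracket only. *)
theory Submission
  imports Defs "HOL-Library.Function_Algebras"
begin

section \<open>The root system\<close>

text \<open>The orbit parameters come from value sets. If a cube has hyperdeterminant 4 k and its
  first form has a nonzero value r, the form is equivalent to r u^2 - (k / r) v^2; so a nonzero r'
  is a value exactly when r r' = (r u)^2 - k v^2 is solvable. This is \<open>norm_rel k\<close>,
  which for k = 0 degenerates to \<open>square_rel\<close>. The second form behaves alike, and the
  hyperdeterminant of a normal form is four times the product of its coefficients; so t is forced to
  be k / (r s), and 0 for luminous vectors.

  The obstacle with the types is that the lift is given by \<open>THE\<close> and an angle by the
  mere existence of a group element: both must be unique before a vector has a type. No structure
  theory of the group is used: its elements are automorphisms of the bracket, so identities for root
  vectors pass to all root elements. In the grading by \<open>rinner _ \<delta>\<close> each nonzero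
  coefficient of a normal form lowers the root reached from \<delta> by one degree, from 2 down to
  -2; hence the angles 0, pi / 3, pi / 2, 2 pi / 3, pi.\<close>

lemma rinner_commute: "rinner x y = rinner y x"
  by (cases x; cases y) (simp add: algebra_simps)

lemma rinner_add: "rinner (x + y) z = rinner x z + rinner y z"
                  "rinner z (x + y) = rinner z x + rinner z y"
  by (cases x; cases y; cases z; simp add: algebra_simps)+

lemma rinner_diff: "rinner (x - y) z = rinner x z - rinner y z"
                   "rinner z (x - y) = rinner z x - rinner z y"
  by (cases x; cases y; cases z; simp add: algebra_simps)+

lemma rinner_minus: "rinner (- x) z = - rinner x z" "rinner z (- x) = - rinner z x"
  by (cases x; cases z; simp add: algebra_simps)+

text \<open>Completing the squares in the outer coordinates around the central one. It gives
  positivity, and for a root it bounds every coordinate, which makes the list of roots a finite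
  check.\<close>

lemma rinner_sum_squares:
  "2 * rinner (a, b, c, d) (a, b, c, d) = (2*a - c)\<^sup>2 + (2*b - c)\<^sup>2 + (2*d - c)\<^sup>2 + c\<^sup>2"
  by (simp add: power2_eq_square algebra_simps)

lemma rinner_self_ge0: "0 \<le> rinner x x"
  using rinner_sum_squares by (cases x) (smt (verit) zero_le_power2)

lemma rinner_self_eq_0: assumes "rinner x x = 0" shows "x = 0"
proof -
  obtain a b c d where x: "x = (a, b, c, d)" by (cases x)
  have s: "(2*a - c)\<^sup>2 + (2*b - c)\<^sup>2 + (2*d - c)\<^sup>2 + c\<^sup>2 = 0"
    using rinner_sum_squares[of a b c d] assms x by simp
  have "c\<^sup>2 = 0 \<and> (2*a - c)\<^sup>2 = 0 \<and> (2*b - c)\<^sup>2 = 0 \<and> (2*d - c)\<^sup>2 = 0"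
    using s zero_le_power2[of c] zero_le_power2[of "2*a-c"] zero_le_power2[of "2*b-c"]
      zero_le_power2[of "2*d-c"] by linarith
  then show ?thesis by (simp add: x zero_prod_def)
qed

lemma Phi_self: "\<alpha> \<in> Phi \<Longrightarrow> rinner \<alpha> \<alpha> = 2"
  by (simp add: Phi_def)

lemma uminus_Phi [simp]: "- \<alpha> \<in> Phi \<longleftrightarrow> \<alpha> \<in> Phi"
  by (simp add: Phi_def rinner_minus)

lemma Phi_nonzero: "0 \<notin> Phi"
  by (simp add: Phi_def zero_prod_def)

lemma Phi_neq_uminus: "\<alpha> \<in> Phi \<Longrightarrow> \<alpha> \<noteq> - \<alpha>"
proof
  assume "\<alpha> \<in> Phi" and *: "\<alpha> = - \<alpha>"
  then have "rinner \<alpha> \<alpha> = 2" by (simp add: Phi_def)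
  moreover have "rinner \<alpha> \<alpha> = - rinner \<alpha> \<alpha>" using * rinner_minus(1)[of \<alpha> \<alpha>] by simp
  ultimately show False by simp
qed

lemma add_Phi_iff:
  assumes "\<alpha> \<in> Phi" "\<beta> \<in> Phi" shows "\<alpha> + \<beta> \<in> Phi \<longleftrightarrow> rinner \<alpha> \<beta> = - 1"
  using assms by (auto simp: Phi_def rinner_add rinner_commute[of \<beta> \<alpha>])

lemma diff_Phi_iff:
  assumes "\<alpha> \<in> Phi" "\<beta> \<in> Phi" shows "\<alpha> - \<beta> \<in> Phi \<longleftrightarrow> rinner \<alpha> \<beta> = 1"
  using assms by (auto simp: Phi_def rinner_diff rinner_commute[of \<beta> \<alpha>])

text \<open>Cauchy-Schwarz for roots: with m the inner product, \<alpha> + \<beta> and \<alpha> -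
  \<beta> have squared lengths 4 + 2 m and 4 - 2 m, both nonnegative.\<close>

lemma rinner_bounds:
  assumes "\<alpha> \<in> Phi" "\<beta> \<in> Phi" shows "\<bar>rinner \<alpha> \<beta>\<bar> \<le> 2"
  using rinner_self_ge0[of "\<alpha> + \<beta>"] rinner_self_ge0[of "\<alpha> - \<beta>"] assms
  by (simp add: rinner_add rinner_diff Phi_def rinner_commute[of \<beta> \<alpha>])

lemma rinner_eq_2_iff:
  assumes "\<alpha> \<in> Phi" "\<beta> \<in> Phi" shows "rinner \<alpha> \<beta> = 2 \<longleftrightarrow> \<alpha> = \<beta>"
proof
  assume "rinner \<alpha> \<beta> = 2"
  then have "rinner (\<alpha> - \<beta>) (\<alpha> - \<beta>) = 0"
    using assms by (simp add: rinner_diff Phi_def rinner_commute[of \<beta> \<alpha>])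
  then show "\<alpha> = \<beta>" using rinner_self_eq_0[of "\<alpha> - \<beta>"] by simp
qed (use assms in \<open>simp add: Phi_def\<close>)

lemma rinner_eq_minus_2_iff:
  assumes "\<alpha> \<in> Phi" "\<beta> \<in> Phi" shows "rinner \<alpha> \<beta> = - 2 \<longleftrightarrow> \<alpha> = - \<beta>"
  using rinner_eq_2_iff[of "- \<alpha>" \<beta>] assms by (auto simp: rinner_minus)

text \<open>The positive roots by height, followed by their negatives; as a list it lets statements
  about all roots be decided by evaluation.\<close>

definition root_list :: "rt list" where
  "root_list = (let p = [(1,0,0,0),(0,1,0,0),(0,0,1,0),(0,0,0,1),(1,0,1,0),(0,1,1,0),(0,0,1,1),
      (1,1,1,0),(1,0,1,1),(0,1,1,1),(1,1,1,1),(1,1,2,1)] in p @ map uminus p)"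

lemma abs_le_two_int: "(x::int)\<^sup>2 \<le> 4 \<Longrightarrow> x \<in> {-2,-1,0,1,2}"
proof -
  assume "x\<^sup>2 \<le> 4"
  then have "\<bar>x\<bar> \<le> 2" using abs_le_square_iff[of x 2] by simp
  then show ?thesis by auto
qed

lemma Phi_eq: "Phi = set root_list"
proof
  show "set root_list \<subseteq> Phi" by (simp add: root_list_def Phi_def)
  show "Phi \<subseteq> set root_list"
  proof
    fix \<alpha> assume \<alpha>: "\<alpha> \<in> Phi"
    obtain a b c d where x: "\<alpha> = (a, b, c, d)" by (cases \<alpha>)
    have s: "(2*a - c)\<^sup>2 + (2*b - c)\<^sup>2 + (2*d - c)\<^sup>2 + c\<^sup>2 = 4"
      using rinner_sum_squares[of a b c d] \<alpha> x by (simp add: Phi_def)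
    have n: "0 \<le> (2*a - c)\<^sup>2" "0 \<le> (2*b - c)\<^sup>2" "0 \<le> (2*d - c)\<^sup>2" "0 \<le> c\<^sup>2" by auto
    have c: "c \<in> {-2,-1,0,1,2}" using s n by (intro abs_le_two_int) linarith
    have a: "2*a - c \<in> {-2,-1,0,1,2}" using s n by (intro abs_le_two_int) linarith
    have b: "2*b - c \<in> {-2,-1,0,1,2}" using s n by (intro abs_le_two_int) linarith
    have d: "2*d - c \<in> {-2,-1,0,1,2}" using s n by (intro abs_le_two_int) linarith
    have "c = -2 \<or> c = -1 \<or> c = 0 \<or> c = 1 \<or> c = 2" using c by simp
    moreover have "a = -2 \<or> a = -1 \<or> a = 0 \<or> a = 1 \<or> a = 2" using a c by auto
    moreover have "b = -2 \<or> b = -1 \<or> b = 0 \<or> b = 1 \<or> b = 2" using b c by auto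
    moreover have "d = -2 \<or> d = -1 \<or> d = 0 \<or> d = 1 \<or> d = 2" using d c by auto
    \<comment> \<open>Four coordinates with five values each: a tuple of the wrong length
      contradicts \<open>s\<close>, the others are in the list.\<close>
    ultimately show "\<alpha> \<in> set root_list"
      unfolding x root_list_def Let_def using s
      by (elim disjE; simp)
  qed
qed

lemma finite_Phi [simp]: "finite Phi"
  by (simp add: Phi_eq)

lemma finite_basis [simp]: "finite basis"
  by (simp add: basis_def)

text \<open>Supplies the test vector that separates orthogonal roots from roots at angle pi / 3.
  Found by evaluation over all pairs of roots.\<close>

lemma common_negative_root:
  assumes "\<alpha> \<in> Phi" "\<beta> \<in> Phi" "rinner \<alpha> \<beta> = 0"
  obtains \<gamma> where "\<gamma> \<in> Phi" "rinner \<alpha> \<gamma> = - 1" "rinner \<beta> \<gamma> = - 1"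
proof -
  have "list_all (\<lambda>\<alpha>. list_all (\<lambda>\<beta>. rinner \<alpha> \<beta> = 0 \<longrightarrow>
     list_ex (\<lambda>\<gamma>. rinner \<alpha> \<gamma> = - 1 \<and> rinner \<beta> \<gamma> = - 1) root_list) root_list) root_list"
    by code_simp
  then show ?thesis
    using assms that unfolding Phi_eq list_all_iff list_ex_iff by blast
qed

section \<open>Brackets\<close>

definition bvec :: "label \<Rightarrow> label \<Rightarrow> 'a::comm_ring_1" where
  "bvec i = (\<lambda>k. of_bool (k = i))"

lemma evec_eq_bvec: "evec \<alpha> = bvec (E \<alpha>)"
  by (simp add: evec_def bvec_def)

lemma bvec_in_lie_space: "i \<in> basis \<Longrightarrow> bvec i \<in> lie_space"
  by (auto simp: lie_space_def bvec_def)

lemma lie_space_add [intro]: "x \<in> lie_space \<Longrightarrow> y \<in> lie_space \<Longrightarrow> x + y \<in> lie_space"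
  and lie_space_diff [intro]: "x \<in> lie_space \<Longrightarrow> y \<in> lie_space \<Longrightarrow> x - y \<in> lie_space"
  and lie_space_scale [intro]: "x \<in> lie_space \<Longrightarrow> scale c x \<in> lie_space"
  by (auto simp: lie_space_def scale_def)

lemma lie_space_evec [simp, intro]: "\<alpha> \<in> Phi \<Longrightarrow> evec \<alpha> \<in> lie_space"
  by (simp add: evec_eq_bvec bvec_in_lie_space basis_def)

lemma lie_space_eqI:
  assumes "x \<in> lie_space" "y \<in> lie_space"
    and "\<And>\<gamma>. \<gamma> \<in> Phi \<Longrightarrow> x (E \<gamma>) = y (E \<gamma>)" and "\<And>i. i \<in> {1..4} \<Longrightarrow> x (H i) = y (H i)"
  shows "x = y"
proof
  fix k show "x k = y k"
  proof (cases "k \<in> basis")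
    case True then show ?thesis using assms(3,4) unfolding basis_def by blast
  next
    case False then show ?thesis using assms(1,2) by (simp add: lie_space_def)
  qed
qed

lemma bracket_add_left: "bracket N (x + y) z = bracket N x z + bracket N y z"
  by (rule ext) (simp add: bracket_def algebra_simps sum.distrib)

lemma bracket_add_right: "bracket N z (x + y) = bracket N z x + bracket N z y"
  by (rule ext) (simp add: bracket_def algebra_simps sum.distrib)

lemma bracket_diff_left: "bracket N (x - y) z = bracket N x z - bracket N y z"
  by (rule ext) (simp add: bracket_def algebra_simps sum_subtractf)

lemma bracket_diff_right: "bracket N z (x - y) = bracket N z x - bracket N z y"
  by (rule ext) (simp add: bracket_def algebra_simps sum_subtractf)

lemma bracket_scale_left: "bracket N (scale c x) z = scale c (bracket N x z)"
  by (rule ext) (simp add: bracket_def scale_def sum_distrib_left mult_ac)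

lemma bracket_scale_right: "bracket N z (scale c x) = scale c (bracket N z x)"
  by (rule ext) (simp add: bracket_def scale_def sum_distrib_left mult_ac)

lemmas bracket_linear = bracket_add_left bracket_add_right bracket_diff_left bracket_diff_right
  bracket_scale_left bracket_scale_right

lemma sum_basis:
  "(\<Sum>i\<in>basis. f i) = (\<Sum>\<alpha>\<in>Phi. f (E \<alpha>)) + (\<Sum>i\<in>{1..4}. f (H i))" for f :: "label \<Rightarrow> 'a::comm_ring_1"
  unfolding basis_def by (subst sum.union_disjoint) (auto simp: sum.reindex inj_on_def)

lemma bracket_bvec_left:
  assumes "i \<in> basis"
  shows "bracket N (bvec i) v k = (\<Sum>j\<in>basis. of_int (bracket_basis N i j k) * v j)"
proof -
  have "bracket N (bvec i) v k
      = (\<Sum>i'\<in>basis. if i' = i then (\<Sum>j\<in>basis. of_int (bracket_basis N i j k) * v j) else 0)"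
    unfolding bracket_def bvec_def by (rule sum.cong) auto
  then show ?thesis using assms by simp
qed

lemma bracket_bvec_bvec:
  assumes "i \<in> basis" "j \<in> basis"
  shows "bracket N (bvec i) (bvec j) k = of_int (bracket_basis N i j k)"
proof -
  have "(\<Sum>j'\<in>basis. of_int (bracket_basis N i j' k) * bvec j j')
     = (\<Sum>j'\<in>basis. if j' = j then of_int (bracket_basis N i j k) else (0::'a))"
    by (rule sum.cong) (auto simp: bvec_def)
  then show ?thesis using assms by (simp add: bracket_bvec_left)
qed

lemma bracket_expand_left:
  "bracket N x v k = (\<Sum>\<alpha>\<in>Phi. x (E \<alpha>) * bracket N (evec \<alpha>) v k)
                   + (\<Sum>i\<in>{1..4}. x (H i) * bracket N (bvec (H i)) v k)"
proof -
  have "bracket N x v k = (\<Sum>i\<in>basis. x i * bracket N (bvec i) v k)"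
    by (simp add: bracket_bvec_left bracket_def[of N x] sum_distrib_left mult_ac cong: sum.cong)
  then show ?thesis by (simp add: sum_basis evec_eq_bvec)
qed

lemma bracket_basis_outside:
  assumes "i \<in> basis" "j \<in> basis" "k \<notin> basis"
  shows "bracket_basis N i j k = 0"
  using assms
  by (cases i; cases j; cases k) (auto simp: basis_def evec_def split_paired_all image_iff)

lemma bracket_in_lie_space [simp, intro]: "bracket N x y \<in> lie_space"
  by (simp add: lie_space_def bracket_def bracket_basis_outside)

text \<open>Coordinates of double brackets of basis vectors. They are integers, so the Jacobi
  identity, assumed over the integers, becomes a family of integer identities that can be mapped
  into any commutative ring.\<close>

definition triple_constant :: "(rt \<Rightarrow> rt \<Rightarrow> int) \<Rightarrow> label \<Rightarrow> label \<Rightarrow> label \<Rightarrow> label \<Rightarrow> int" where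
  "triple_constant N i j k l = (\<Sum>m\<in>basis. bracket_basis N j k m * bracket_basis N i m l)"

lemma bracket_bracket:
  "bracket N x (bracket N y z) l =
     (\<Sum>i\<in>basis. \<Sum>j\<in>basis. \<Sum>k\<in>basis. of_int (triple_constant N i j k l) * (x i * y j * z k))"
proof -
  have "bracket N x (bracket N y z) l = (\<Sum>i\<in>basis. \<Sum>m\<in>basis. \<Sum>j\<in>basis. \<Sum>k\<in>basis.
      of_int (bracket_basis N j k m * bracket_basis N i m l) * (x i * y j * z k))"
    by (simp add: bracket_def sum_distrib_left mult_ac)
  also have "\<dots> = (\<Sum>i\<in>basis. \<Sum>j\<in>basis. \<Sum>k\<in>basis. \<Sum>m\<in>basis.
      of_int (bracket_basis N j k m * bracket_basis N i m l) * (x i * y j * z k))"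
    by (subst sum.swap[of _ basis basis], subst (2) sum.swap[of _ basis basis]) (rule refl)
  also have "\<dots> = (\<Sum>i\<in>basis. \<Sum>j\<in>basis. \<Sum>k\<in>basis. of_int (triple_constant N i j k l) * (x i * y j * z k))"
    by (simp add: triple_constant_def sum_distrib_right)
  finally show ?thesis .
qed

section \<open>Transfer of antisymmetry and the Jacobi identity from the integers to commutative
  rings\<close>

locale chevalley_D4 =
  fixes N :: "rt \<Rightarrow> rt \<Rightarrow> int"
  assumes chevalley: "chevalley_constants N"
begin

lemma N_cases: "\<alpha> \<in> Phi \<Longrightarrow> \<beta> \<in> Phi \<Longrightarrow> \<alpha> + \<beta> \<in> Phi \<Longrightarrow> N \<alpha> \<beta> = 1 \<or> N \<alpha> \<beta> = - 1"
  using chevalley unfolding chevalley_constants_def by blast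

text \<open>Polarising [x, x] = 0, which is assumed over the integers, at a sum of two basis vectors
  gives identities between integers; these then hold over every commutative ring.\<close>

lemma bracket_basis_antisym:
  assumes "i \<in> basis" "j \<in> basis"
  shows "bracket_basis N j i k = - bracket_basis N i j k"
proof -
  have z: "bracket N x x k = 0" if "x \<in> lie_space" for x :: "label \<Rightarrow> int"
    using chevalley that unfolding chevalley_constants_def by blast
  have "bracket N (bvec i + bvec j) (bvec i + bvec j) k = (0::int)"
    using assms by (intro z) (auto intro: bvec_in_lie_space)
  moreover have "bracket N (bvec i) (bvec i) k = (0::int)" "bracket N (bvec j) (bvec j) k = (0::int)"
    using assms by (auto intro!: z bvec_in_lie_space)
  ultimately show ?thesis using assms by (simp add: bracket_linear bracket_bvec_bvec)
qed

lemma bracket_antisym: "bracket N y x = - bracket N x y" for x y :: "label \<Rightarrow> 'a::comm_ring_1"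
proof
  fix k
  have "bracket N y x k = (\<Sum>i\<in>basis. \<Sum>j\<in>basis. of_int (bracket_basis N j i k) * x i * y j)"
    unfolding bracket_def by (subst sum.swap) (simp add: mult_ac)
  also have "\<dots> = (\<Sum>i\<in>basis. \<Sum>j\<in>basis. - (of_int (bracket_basis N i j k) * x i * y j))"
    by (intro sum.cong refl) (subst bracket_basis_antisym, simp_all)
  finally show "bracket N y x k = (- bracket N x y) k"
    by (simp add: bracket_def sum_negf)
qed

lemma bracket_self_evec: "\<alpha> \<in> Phi \<Longrightarrow> bracket N (evec \<alpha>) (evec \<alpha>) = 0"
  by (rule ext) (auto simp: evec_eq_bvec bracket_bvec_bvec basis_def Phi_neq_uminus add_Phi_iff Phi_self)

lemma triple_constant_cyclic:
  assumes "i \<in> basis" "j \<in> basis" "k \<in> basis"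
  shows "triple_constant N i j k l + triple_constant N j k i l + triple_constant N k i j l = 0"
proof -
  have eq: "bracket N (bvec i) (bracket N (bvec j) (bvec k)) l = triple_constant N i j k l"
    if "i \<in> basis" "j \<in> basis" "k \<in> basis" for i j k
    using that by (subst bracket_bvec_left) (simp_all add: bracket_bvec_bvec triple_constant_def mult.commute)
  have "bracket N (bvec i) (bracket N (bvec j) (bvec k)) l
      + bracket N (bvec j) (bracket N (bvec k) (bvec i)) l
      + bracket N (bvec k) (bracket N (bvec i) (bvec j)) l = (0::int)"
    using chevalley assms bvec_in_lie_space unfolding chevalley_constants_def by blast
  then show ?thesis using assms by (simp add: eq)
qed

lemma jacobi:
  "bracket N x (bracket N y z) + bracket N y (bracket N z x) + bracket N z (bracket N x y) = 0"
  for x y z :: "label \<Rightarrow> 'a::comm_ring_1"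
proof
  fix l
  let ?T = "\<lambda>i j k. of_int (triple_constant N i j k l) :: 'a"
  \<comment> \<open>The two rotated double brackets are summed in the order i, j, k, so that all
    three share the monomial \<open>x i * y j * z k\<close> and the cyclic identity applies
    termwise.\<close>
  have 2: "bracket N y (bracket N z x) l = (\<Sum>i\<in>basis. \<Sum>j\<in>basis. \<Sum>k\<in>basis. ?T j k i * (x i * y j * z k))"
  proof -
    have "bracket N y (bracket N z x) l = (\<Sum>j\<in>basis. \<Sum>i\<in>basis. \<Sum>k\<in>basis. ?T j k i * (x i * y j * z k))"
      unfolding bracket_bracket by (subst (2) sum.swap) (simp add: mult_ac)
    then show ?thesis by (subst sum.swap)
  qed
  have 3: "bracket N z (bracket N x y) l = (\<Sum>i\<in>basis. \<Sum>j\<in>basis. \<Sum>k\<in>basis. ?T k i j * (x i * y j * z k))"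
  proof -
    have "bracket N z (bracket N x y) l = (\<Sum>i\<in>basis. \<Sum>k\<in>basis. \<Sum>j\<in>basis. ?T k i j * (x i * y j * z k))"
      unfolding bracket_bracket by (subst sum.swap) (simp add: mult_ac)
    also have "\<dots> = (\<Sum>i\<in>basis. \<Sum>j\<in>basis. \<Sum>k\<in>basis. ?T k i j * (x i * y j * z k))"
      by (rule sum.cong[OF refl]) (rule sum.swap)
    finally show ?thesis .
  qed
  have "?T i j k + ?T j k i + ?T k i j = 0" if "i \<in> basis" "j \<in> basis" "k \<in> basis" for i j k
    using triple_constant_cyclic[OF that, of l] by (metis of_int_0 of_int_add)
  then have "?T i j k * (x i * y j * z k) + ?T j k i * (x i * y j * z k) + ?T k i j * (x i * y j * z k) = 0"
    if "i \<in> basis" "j \<in> basis" "k \<in> basis" for i j k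
    using that by (simp flip: distrib_right)
  then show "(bracket N x (bracket N y z) + bracket N y (bracket N z x) + bracket N z (bracket N x y)) l
      = (0 :: label \<Rightarrow> 'a) l"
    unfolding plus_fun_apply 2 3 unfolding bracket_bracket
    by (simp flip: sum.distrib)
qed

lemma bracket_derivation:
  "bracket N x (bracket N y z) = bracket N (bracket N x y) z + bracket N y (bracket N x z)"
  for x y z :: "label \<Rightarrow> 'a::comm_ring_1"
proof -
  have "bracket N y (bracket N z x) = - bracket N y (bracket N x z)"
    by (subst bracket_antisym[of z x]) (rule ext, simp add: bracket_def sum_negf)
  then show ?thesis
    using jacobi[of x y z] unfolding bracket_antisym[of z "bracket N x y"]
    by (simp add: algebra_simps)
qed

end

section \<open>Coordinates of brackets with basis vectors\<close>

lemma cartan_int_simple: "i \<in> {1..4} \<Longrightarrow> cartan_int (simple_root i) \<alpha> = rinner (simple_root i) \<alpha>"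
  by (auto simp: cartan_int_def simple_root_def)

lemma sum_1_4: "(\<Sum>i\<in>{1..4::nat}. f i) = f 1 + f 2 + f 3 + f 4" for f :: "nat \<Rightarrow> 'a::comm_monoid_add"
proof -
  have "{1..4::nat} = {1,2,3,4}" by auto
  then show ?thesis by (simp add: add.assoc)
qed

text \<open>The coroot of \<alpha> is the combination of the simple coroots with coefficients
  \<open>rcoeff \<alpha> i\<close>, so this is its eigenvalue on e_\<beta>. For \<beta> = \<alpha>
  it yields the 2 in [h_\<alpha>, e_\<alpha>] = 2 e_\<alpha>.\<close>

lemma sum_rcoeff_rinner:
  "(\<Sum>i\<in>{1..4}. rcoeff \<alpha> i * rinner (simple_root i) \<beta>) = rinner \<alpha> \<beta>"
  unfolding sum_1_4 by (cases \<alpha>; cases \<beta>) (simp add: simple_root_def algebra_simps)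

lemma bracket_evec_E:
  assumes "\<alpha> \<in> Phi" "\<gamma> \<in> Phi"
  shows "bracket N (evec \<alpha>) v (E \<gamma>) =
     (if \<gamma> = \<alpha> then - (\<Sum>i\<in>{1..4}. of_int (rinner (simple_root i) \<alpha>) * v (H i))
      else if \<gamma> - \<alpha> \<in> Phi then of_int (N \<alpha> (\<gamma> - \<alpha>)) * v (E (\<gamma> - \<alpha>)) else 0)"
proof -
  have 1: "(\<Sum>\<beta>\<in>Phi. of_int (bracket_basis N (E \<alpha>) (E \<beta>) (E \<gamma>)) * v (E \<beta>))
      = (\<Sum>\<beta>\<in>Phi. if \<beta> = \<gamma> - \<alpha> then of_int (N \<alpha> (\<gamma> - \<alpha>)) * v (E (\<gamma> - \<alpha>)) else 0)"
    using assms Phi_nonzero by (intro sum.cong) (auto simp: evec_def algebra_simps)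
  have 2: "(\<Sum>i\<in>{1..4}. of_int (bracket_basis N (E \<alpha>) (H i) (E \<gamma>)) * v (H i))
      = (if \<gamma> = \<alpha> then - (\<Sum>i\<in>{1..4}. of_int (rinner (simple_root i) \<alpha>) * v (H i)) else 0)"
    by (auto simp: evec_def cartan_int_simple sum_negf)
  have "\<alpha> - \<alpha> \<notin> Phi" using Phi_nonzero by simp
  moreover have "E \<alpha> \<in> basis" using assms by (simp add: basis_def)
  ultimately show ?thesis
    unfolding evec_eq_bvec bracket_bvec_left[OF \<open>E \<alpha> \<in> basis\<close>] sum_basis 1 2 by auto
qed

lemma bracket_evec_H:
  assumes "\<alpha> \<in> Phi" "i \<in> {1..4}"
  shows "bracket N (evec \<alpha>) v (H i) = of_int (rcoeff \<alpha> i) * v (E (- \<alpha>))"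
proof -
  have 1: "(\<Sum>\<beta>\<in>Phi. of_int (bracket_basis N (E \<alpha>) (E \<beta>) (H i)) * v (E \<beta>))
      = (\<Sum>\<beta>\<in>Phi. if \<beta> = - \<alpha> then of_int (rcoeff \<alpha> i) * v (E (- \<alpha>)) else 0)"
    by (intro sum.cong) (auto simp: evec_def)
  have 2: "(\<Sum>j\<in>{1..4}. of_int (bracket_basis N (E \<alpha>) (H j) (H i)) * v (H j)) = 0"
    by (simp add: evec_def)
  have "E \<alpha> \<in> basis" using assms by (simp add: basis_def)
  then show ?thesis
    unfolding evec_eq_bvec bracket_bvec_left[OF \<open>E \<alpha> \<in> basis\<close>] sum_basis 1 2 using assms by simp
qed

lemma bracket_bvec_H_E:
  assumes "i \<in> {1..4}" "\<gamma> \<in> Phi"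
  shows "bracket N (bvec (H i)) v (E \<gamma>) = of_int (rinner (simple_root i) \<gamma>) * v (E \<gamma>)"
proof -
  have 1: "(\<Sum>\<beta>\<in>Phi. of_int (bracket_basis N (H i) (E \<beta>) (E \<gamma>)) * v (E \<beta>))
      = (\<Sum>\<beta>\<in>Phi. if \<beta> = \<gamma> then of_int (rinner (simple_root i) \<gamma>) * v (E \<gamma>) else 0)"
    using assms by (intro sum.cong) (auto simp: evec_def cartan_int_simple)
  have "H i \<in> basis" using assms by (simp add: basis_def)
  then show ?thesis
    unfolding bracket_bvec_left[OF \<open>H i \<in> basis\<close>] sum_basis 1 using assms by simp
qed

lemma bracket_bvec_H_H:
  assumes "i \<in> {1..4}"
  shows "bracket N (bvec (H i)) v (H j) = 0"
proof -
  have "H i \<in> basis" using assms by (simp add: basis_def)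
  then show ?thesis
    unfolding bracket_bvec_left[OF \<open>H i \<in> basis\<close>] sum_basis by (simp add: evec_def)
qed

section \<open>Elementary root elements and the group they generate\<close>

declare split_paired_All [simp del] split_paired_Ex [simp del]

lemma evec_apply [simp]: "evec \<alpha> (E \<beta>) = of_bool (\<beta> = \<alpha>)" "evec \<alpha> (H i) = 0"
  by (auto simp: evec_def)

text \<open>In a simply laced system the only way to add \<alpha> twice within the roots and zero is
  -\<alpha>, 0, \<alpha>. So the square of ad e_\<alpha> sees only the coordinate at -\<alpha>, and
  the -2 is that of [e_\<alpha>, h_\<alpha>].\<close>

lemma bracket_evec_twice:
  assumes \<alpha>: "\<alpha> \<in> Phi"
  shows "bracket N (evec \<alpha>) (bracket N (evec \<alpha>) v) = scale (- 2 * v (E (- \<alpha>))) (evec \<alpha>)"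
proof (rule lie_space_eqI)
  show "scale (- 2 * v (E (- \<alpha>))) (evec \<alpha>) \<in> lie_space" using \<alpha> by auto
next
  fix \<gamma> assume \<gamma>: "\<gamma> \<in> Phi"
  consider "\<gamma> = \<alpha>" | "\<gamma> \<noteq> \<alpha>" "\<gamma> - \<alpha> \<notin> Phi" | "\<gamma> \<noteq> \<alpha>" "\<gamma> - \<alpha> \<in> Phi" by blast
  then show "bracket N (evec \<alpha>) (bracket N (evec \<alpha>) v) (E \<gamma>) = scale (- 2 * v (E (- \<alpha>))) (evec \<alpha>) (E \<gamma>)"
  proof cases
    case 1
    have "(\<Sum>i\<in>{1..4}. of_int (rinner (simple_root i) \<alpha>) * bracket N (evec \<alpha>) v (H i))
        = of_int (\<Sum>i\<in>{1..4}. rcoeff \<alpha> i * rinner (simple_root i) \<alpha>) * v (E (- \<alpha>))"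
      unfolding of_int_sum sum_distrib_right by (intro sum.cong refl) (simp only: bracket_evec_H[OF \<alpha>], simp)
    also have "\<dots> = 2 * v (E (- \<alpha>))" using \<alpha> by (simp only: sum_rcoeff_rinner Phi_self) simp
    finally show ?thesis using 1 \<alpha> by (simp add: bracket_evec_E scale_def)
  next
    case 2
    then show ?thesis using \<alpha> \<gamma> by (simp add: bracket_evec_E scale_def)
  next
    case 3
    have "rinner \<gamma> \<alpha> = 1" using 3 \<alpha> \<gamma> by (simp add: diff_Phi_iff)
    then have "\<gamma> - \<alpha> - \<alpha> \<notin> Phi" using 3 \<alpha> by (simp add: diff_Phi_iff rinner_diff Phi_self)
    moreover have "\<gamma> - \<alpha> \<noteq> \<alpha>"
    proof
      assume "\<gamma> - \<alpha> = \<alpha>"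
      then have "rinner \<gamma> \<alpha> - rinner \<alpha> \<alpha> = rinner \<alpha> \<alpha>" using rinner_diff(1)[of \<gamma> \<alpha> \<alpha>] by simp
      then show False using \<open>rinner \<gamma> \<alpha> = 1\<close> \<alpha> by (simp add: Phi_self)
    qed
    ultimately show ?thesis using 3 \<alpha> \<gamma> by (simp add: bracket_evec_E scale_def)
  qed
next
  fix i :: nat assume i: "i \<in> {1..4}"
  have "- \<alpha> - \<alpha> \<notin> Phi" "- \<alpha> \<noteq> \<alpha>"
    using \<alpha> Phi_neq_uminus[of \<alpha>] by (auto simp: diff_Phi_iff rinner_minus Phi_self)
  then show "bracket N (evec \<alpha>) (bracket N (evec \<alpha>) v) (H i) = scale (- 2 * v (E (- \<alpha>))) (evec \<alpha>) (H i)"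
    using \<alpha> by (simp only: bracket_evec_H[OF \<alpha> i]) (simp add: bracket_evec_E scale_def)
qed simp

locale chevalley_D4_field = chevalley_D4 N for N :: "rt \<Rightarrow> rt \<Rightarrow> int" +
  fixes K :: "'a::field itself"
  assumes two_nonzero: "(2::'a) \<noteq> 0"
begin

abbreviation L :: "(label \<Rightarrow> 'a) set" where "L \<equiv> lie_space"
abbreviation X :: "rt \<Rightarrow> 'a \<Rightarrow> (label \<Rightarrow> 'a) \<Rightarrow> label \<Rightarrow> 'a" where "X \<equiv> elem_root_elt N"
abbreviation br :: "(label \<Rightarrow> 'a) \<Rightarrow> (label \<Rightarrow> 'a) \<Rightarrow> label \<Rightarrow> 'a" where "br \<equiv> bracket N"

text \<open>The 2 of \<open>bracket_evec_twice\<close> cancels the division by 2 in the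
  exponential.\<close>

lemma X_eq:
  assumes "\<alpha> \<in> Phi" "v \<in> L"
  shows "X \<alpha> a v = v + scale a (br (evec \<alpha>) v) + scale (- a\<^sup>2 * v (E (- \<alpha>))) (evec \<alpha>)"
  using assms two_nonzero
  by (intro ext) (simp add: elem_root_elt_def bracket_evec_twice scale_def)

lemma X_in [simp, intro]: "\<alpha> \<in> Phi \<Longrightarrow> v \<in> L \<Longrightarrow> X \<alpha> a v \<in> L"
  by (auto simp: X_eq)

lemma X_0: "\<alpha> \<in> Phi \<Longrightarrow> v \<in> L \<Longrightarrow> X \<alpha> 0 v = v"
  by (simp add: X_eq scale_def fun_eq_iff)

lemma X_add: "\<alpha> \<in> Phi \<Longrightarrow> v \<in> L \<Longrightarrow> w \<in> L \<Longrightarrow> X \<alpha> a (v + w) = X \<alpha> a v + X \<alpha> a w"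
  by (subst (1 2 3) X_eq) (auto simp: bracket_linear scale_def fun_eq_iff algebra_simps)

lemma X_scale: "\<alpha> \<in> Phi \<Longrightarrow> v \<in> L \<Longrightarrow> X \<alpha> a (scale c v) = scale c (X \<alpha> a v)"
  by (subst (1 2) X_eq) (auto simp: bracket_linear, auto simp: scale_def fun_eq_iff algebra_simps)

lemma bracket_evec_opposite:
  assumes "\<alpha> \<in> Phi" shows "br (evec \<alpha>) v (E (- \<alpha>)) = 0"
  using assms Phi_neq_uminus[of \<alpha>] by (auto simp: bracket_evec_E diff_Phi_iff rinner_minus Phi_self)

lemma X_uminus:
  assumes "\<alpha> \<in> Phi" "v \<in> L" shows "X \<alpha> (- a) (X \<alpha> a v) = v"
proof -
  have f: "X \<alpha> a v (E (- \<alpha>)) = v (E (- \<alpha>))"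
    using assms by (simp add: X_eq bracket_evec_opposite scale_def not_sym[OF Phi_neq_uminus])
  have d: "br (evec \<alpha>) (X \<alpha> a v) = br (evec \<alpha>) v + scale (- 2 * a * v (E (- \<alpha>))) (evec \<alpha>)"
    using assms by (simp add: X_eq bracket_linear bracket_evec_twice bracket_self_evec)
      (simp add: scale_def fun_eq_iff)
  show ?thesis
    by (subst X_eq) (use assms f d in \<open>auto simp: scale_def\<close>,
      auto simp: X_eq scale_def fun_eq_iff algebra_simps power2_eq_square)
qed

text \<open>The exponential of a nilpotent derivation D is an automorphism. Since D^2 u is -2 f(u)
  e, the Leibniz rule for D^2 expresses 2 [D v, D w] through f; dividing by 2 gives
  \<open>key\<close>, which settles the terms in a^2.\<close>

lemma X_bracket:
  assumes \<alpha>: "\<alpha> \<in> Phi" and v: "v \<in> L" and w: "w \<in> L"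
  shows "X \<alpha> a (br v w) = br (X \<alpha> a v) (X \<alpha> a w)"
proof -
  define e where "e = (evec \<alpha> :: label \<Rightarrow> 'a)"
  define D where "D = br e"
  define f where "f u = u (E (- \<alpha>))" for u :: "label \<Rightarrow> 'a"
  have Xu: "X \<alpha> a u = u + scale a (D u) + scale (- a\<^sup>2 * f u) e" if "u \<in> L" for u
    using that \<alpha> by (simp add: X_eq D_def e_def f_def)
  have DD: "D (D u) = scale (- 2 * f u) e" for u
    using bracket_evec_twice[OF \<alpha>] by (simp add: D_def e_def f_def)
  have D: "D (br x y) = br (D x) y + br x (D y)" for x y
    unfolding D_def by (rule bracket_derivation)
  have De: "br x e = - D x" for x unfolding D_def by (rule bracket_antisym)
  have ee: "D e = 0" unfolding D_def e_def by (rule bracket_self_evec[OF \<alpha>])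
  have eD: "br e x = D x" for x by (simp add: D_def)
  have Dadd: "D (x + y) = D x + D y" for x y by (simp add: D_def bracket_linear)
  have sc0: "scale c (- x) = - scale c x" "scale c (x + y) = scale c x + scale c y"
     "scale c (scale d x) = scale (c * d) x" for c d and x y :: "label \<Rightarrow> 'a"
    by (auto simp: scale_def fun_eq_iff algebra_simps)
  have "D (D (br v w)) = br (D (D v)) w + scale 2 (br (D v) (D w)) + br v (D (D w))"
    by (simp add: D Dadd scale_def fun_eq_iff)
  then have "scale (- 2 * f (br v w)) e = scale (- 2 * f v) (D w) + scale 2 (br (D v) (D w)) + scale (2 * f w) (D v)"
    unfolding DD by (simp add: bracket_linear De eD) (simp add: scale_def fun_eq_iff)
  then have "2 * (- f (br v w) * e k) = 2 * (- f v * D w k + br (D v) (D w) k + f w * D v k)" for k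
    by (auto simp: scale_def fun_eq_iff algebra_simps)
  then have "- f (br v w) * e k = - f v * D w k + br (D v) (D w) k + f w * D v k" for k
    using two_nonzero mult_left_cancel by blast
  then have key: "br (D v) (D w) k = - f (br v w) * e k + f v * D w k - f w * D v k" for k
    by simp
  \<comment> \<open>The two terms in a^3 are opposite multiples of e, and the term in a^4 is a
    multiple of [e, e] = 0.\<close>
  have "br (X \<alpha> a v) (X \<alpha> a w)
      = br v w + scale a (D (br v w)) + scale (a\<^sup>2) (br (D v) (D w))
        + scale (a\<^sup>2 * f w) (D v) - scale (a\<^sup>2 * f v) (D w)"
    unfolding Xu[OF v] Xu[OF w] bracket_linear De eD DD ee D
    by (simp add: scale_def fun_eq_iff algebra_simps power2_eq_square)
  also have "\<dots> = br v w + scale a (D (br v w)) + scale (- a\<^sup>2 * f (br v w)) e"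
    by (simp add: fun_eq_iff key scale_def algebra_simps)
  also have "\<dots> = X \<alpha> a (br v w)" by (simp add: Xu)
  finally show ?thesis by simp
qed

section \<open>Groups generated by elementary root elements\<close>

lemma X_Bij:
  assumes "\<alpha> \<in> Phi" shows "X \<alpha> a \<in> carrier (BijGroup L)"
proof -
  have "bij_betw (X \<alpha> a) L L"
    by (rule bij_betwI[of _ _ _ "X \<alpha> (- a)"])
      (use assms X_uminus[of \<alpha> _ "- a"] in \<open>auto simp: X_uminus\<close>)
  then show ?thesis
    by (simp add: BijGroup_def Bij_def elem_root_elt_def)
qed

lemma X_inv:
  assumes "\<alpha> \<in> Phi" shows "inv\<^bsub>BijGroup L\<^esub> (X \<alpha> a) = X \<alpha> (- a)"
proof (rule group.inv_equality[OF group_BijGroup])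
  show "X \<alpha> (- a) \<otimes>\<^bsub>BijGroup L\<^esub> X \<alpha> a = \<one>\<^bsub>BijGroup L\<^esub>"
    using X_Bij[OF assms, of a] X_Bij[OF assms, of "- a"] assms
    by (auto simp: BijGroup_def compose_def X_uminus fun_eq_iff restrict_def)
qed (use assms X_Bij in auto)

text \<open>Parametrised by the set of roots, so that G and its subgroup G_0 share one
  theory.\<close>

definition grp :: "rt set \<Rightarrow> ((label \<Rightarrow> 'a) \<Rightarrow> label \<Rightarrow> 'a) monoid" where
  "grp S = subgroup_generated (BijGroup L) {X \<alpha> a | \<alpha> a. \<alpha> \<in> S}"

lemma chev_group_eq: "chev_group N = grp Phi" and chev_group0_eq: "chev_group0 N = grp Phi0"
  by (simp_all add: grp_def chev_group_def chev_group0_def)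

lemma Phi0_subset: "Phi0 \<subseteq> Phi" by (auto simp: Phi0_def)

lemma carrier_grp:
  assumes "S \<subseteq> Phi" shows "carrier (grp S) = generate (BijGroup L) {X \<alpha> a | \<alpha> a. \<alpha> \<in> S}"
proof -
  have "carrier (BijGroup L) \<inter> {X \<alpha> a | \<alpha> a. \<alpha> \<in> S} = {X \<alpha> a | \<alpha> a. \<alpha> \<in> S}"
    using assms X_Bij by blast
  then show ?thesis by (simp add: grp_def carrier_subgroup_generated)
qed

lemma grp_in_Bij: "S \<subseteq> Phi \<Longrightarrow> g \<in> carrier (grp S) \<Longrightarrow> g \<in> Bij L"
  unfolding grp_def
  using group.carrier_subgroup_generated_subset[OF group_BijGroup[of L]] by (auto simp: BijGroup_def)

lemma mult_BijGroup: "g \<in> Bij L \<Longrightarrow> h \<in> Bij L \<Longrightarrow> g \<otimes>\<^bsub>BijGroup L\<^esub> h = compose L g h"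
  by (simp add: BijGroup_def)

text \<open>There is no case for inverses: the inverse of \<open>X \<alpha> a\<close> is the
  generator \<open>X \<alpha> (- a)\<close>.\<close>

lemma grp_induct [consumes 2, case_names one gen mult]:
  assumes S: "S \<subseteq> Phi" and g: "g \<in> carrier (grp S)"
    and one: "P (\<lambda>v\<in>L. v)" and gen: "\<And>\<alpha> a. \<alpha> \<in> S \<Longrightarrow> P (X \<alpha> a)"
    and mult: "\<And>g h. g \<in> carrier (grp S) \<Longrightarrow> h \<in> carrier (grp S) \<Longrightarrow> P g \<Longrightarrow> P h \<Longrightarrow> P (compose L g h)"
  shows "P g"
  using g unfolding carrier_grp[OF S]
proof (induction rule: generate.induct)
  case one then show ?case using assms(3) by (simp add: BijGroup_def restrict_def)
next
  case (incl h) then show ?case using gen by blast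
next
  case (inv h)
  then obtain \<alpha> a where "\<alpha> \<in> S" "h = X \<alpha> a" by blast
  then show ?case using gen subsetD[OF S, of \<alpha>] X_inv[of \<alpha> a] by simp
next
  case (eng h1 h2)
  then show ?case using mult[of h1 h2] S grp_in_Bij[OF S]
    by (simp add: carrier_grp mult_BijGroup)
qed

lemma grp_X: "S \<subseteq> Phi \<Longrightarrow> \<alpha> \<in> S \<Longrightarrow> X \<alpha> a \<in> carrier (grp S)"
  unfolding carrier_grp by (rule generate.incl) blast

lemma grp_one: "S \<subseteq> Phi \<Longrightarrow> (\<lambda>v\<in>L. v) \<in> carrier (grp S)"
  using generate.one[of "BijGroup L"] by (simp add: carrier_grp BijGroup_def restrict_def)

lemma grp_mult:
  assumes "S \<subseteq> Phi" "g \<in> carrier (grp S)" "h \<in> carrier (grp S)"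
  shows "compose L g h \<in> carrier (grp S)"
  using generate.eng[of g "BijGroup L" _ h] assms grp_in_Bij by (simp add: carrier_grp mult_BijGroup)

lemma grp_subset:
  assumes "S \<subseteq> T" "T \<subseteq> Phi" "g \<in> carrier (grp S)" shows "g \<in> carrier (grp T)"
proof -
  have "S \<subseteq> Phi" using assms by auto
  then show ?thesis using assms(3)
  proof (induction rule: grp_induct)
    case one show ?case by (rule grp_one[OF assms(2)])
  next
    case (gen \<alpha> a) show ?case by (rule grp_X[OF assms(2) subsetD[OF assms(1) gen]])
  next
    case (mult g h) show ?case by (rule grp_mult[OF assms(2) mult(3,4)])
  qed
qed

lemma grp_inverse:
  assumes S: "S \<subseteq> Phi" and g: "g \<in> carrier (grp S)"
  obtains h where "h \<in> carrier (grp S)" "\<And>v. v \<in> L \<Longrightarrow> h (g v) = v" "\<And>v. v \<in> L \<Longrightarrow> g (h v) = v"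
proof -
  have "\<exists>h\<in>carrier (grp S). \<forall>v\<in>L. h (g v) = v \<and> g (h v) = v" using S g
  proof (induction rule: grp_induct)
    case one show ?case by (rule bexI[OF _ grp_one[OF S]]) simp
  next
    case (gen \<alpha> a)
    then show ?case using S X_uminus[of \<alpha> _ a] X_uminus[of \<alpha> _ "- a"]
      by (intro bexI[OF _ grp_X[OF S gen, of "- a"]]) auto
  next
    case (mult g1 g2)
    then obtain h1 h2 where h: "h1 \<in> carrier (grp S)" "h2 \<in> carrier (grp S)"
      "\<forall>v\<in>L. h1 (g1 v) = v \<and> g1 (h1 v) = v" "\<forall>v\<in>L. h2 (g2 v) = v \<and> g2 (h2 v) = v" by blast
    have "g v \<in> L" if "v \<in> L" "g \<in> carrier (grp S)" for g v
      using that grp_in_Bij[OF S] Bij_imp_funcset by blast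
    then show ?case using h mult
      by (intro bexI[OF _ grp_mult[OF S h(2,1)]]) (auto simp: compose_def)
  qed
  then show ?thesis using that by blast
qed

lemma grp_closed: "S \<subseteq> Phi \<Longrightarrow> g \<in> carrier (grp S) \<Longrightarrow> v \<in> L \<Longrightarrow> g v \<in> L"
  using grp_in_Bij Bij_imp_funcset by blast

lemma grp_automorphism:
  assumes S: "S \<subseteq> Phi" and g: "g \<in> carrier (grp S)" and v: "v \<in> L" and w: "w \<in> L"
  shows "g (v + w) = g v + g w" "g (scale c v) = scale c (g v)" "g (br v w) = br (g v) (g w)"
proof -
  have "(\<forall>v\<in>L. \<forall>w\<in>L. g v \<in> L \<and> g (v + w) = g v + g w \<and> g (br v w) = br (g v) (g w) \<and> (\<forall>c. g (scale c v) = scale c (g v)))"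
    using S g
  proof (induction rule: grp_induct)
    case one
    have id: "(\<lambda>v\<in>L. v) x = x" if "x \<in> L" for x using that by simp
    show ?case by (intro ballI conjI allI) (simp_all only: id lie_space_add lie_space_scale bracket_in_lie_space)
  next
    case (gen \<alpha> a)
    then have "\<alpha> \<in> Phi" using S by blast
    then show ?case by (intro ballI conjI allI) (simp_all only: X_in X_add X_scale X_bracket)
  next
    case (mult g h)
    have comp: "compose L g h x = g (h x)" if "x \<in> L" for x using that by (simp add: compose_def)
    from mult show ?case
      by (intro ballI conjI allI) (simp_all only: comp lie_space_add lie_space_scale bracket_in_lie_space)
  qed
  then show "g (v + w) = g v + g w" "g (scale c v) = scale c (g v)" "g (br v w) = br (g v) (g w)"
    using v w by auto
qed

definition reach :: "rt set \<Rightarrow> (label \<Rightarrow> 'a) \<Rightarrow> (label \<Rightarrow> 'a) \<Rightarrow> bool" where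
  "reach S x y \<longleftrightarrow> (\<exists>g\<in>carrier (grp S). g x = y)"

lemma reach_refl: "S \<subseteq> Phi \<Longrightarrow> x \<in> L \<Longrightarrow> reach S x x"
  unfolding reach_def by (rule bexI[OF _ grp_one]) auto

lemma reach_X: "S \<subseteq> Phi \<Longrightarrow> \<alpha> \<in> S \<Longrightarrow> reach S x (X \<alpha> a x)"
  unfolding reach_def by (rule bexI[OF _ grp_X]) auto

lemma reach_trans:
  assumes "S \<subseteq> Phi" "x \<in> L" "reach S x y" "reach S y z" shows "reach S x z"
proof -
  obtain g h where "g \<in> carrier (grp S)" "h \<in> carrier (grp S)" "g x = y" "h y = z"
    using assms unfolding reach_def by blast
  then show ?thesis unfolding reach_def using assms
    by (intro bexI[OF _ grp_mult[OF assms(1), of h g]]) (auto simp: compose_def)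
qed

lemma reach_sym:
  assumes "S \<subseteq> Phi" "x \<in> L" "reach S x y" shows "reach S y x"
  using assms grp_inverse unfolding reach_def by metis

end

section \<open>Root vectors\<close>

lemma root_angle_eq:
  "\<alpha> \<in> Phi \<Longrightarrow> \<beta> \<in> Phi \<Longrightarrow> root_angle \<alpha> \<beta> = arccos (real_of_int (rinner \<alpha> \<beta>) / 2)"
  by (simp add: root_angle_def Phi_self)

lemma delta_Phi [simp]: "\<delta> \<in> Phi"
  by (simp add: Phi_def \<delta>_def)

lemma arccos_half_cases:
  "arccos (1 / 2) = pi / 3" "arccos 0 = pi / 2" "arccos (- (1 / 2)) = 2 * pi / 3" "arccos (- 1) = pi"
proof -
  show 1: "arccos (1 / 2) = pi / 3" using arccos_cos[of "pi / 3"] by (simp add: cos_60)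
  show "arccos (- (1 / 2)) = 2 * pi / 3" using arccos_minus[of "1 / 2"] 1 by simp
qed simp_all

lemma Phi1_iff: "\<alpha> \<in> Phi1 \<longleftrightarrow> \<alpha> \<in> Phi \<and> rinner \<alpha> \<delta> = 1"
proof -
  have "root_angle \<alpha> \<delta> = pi / 3 \<longleftrightarrow> rinner \<alpha> \<delta> = 1" if "\<alpha> \<in> Phi"
  proof -
    have "\<bar>real_of_int (rinner \<alpha> \<delta>) / 2\<bar> \<le> 1" using rinner_bounds[OF that delta_Phi] by simp
    then have "arccos (real_of_int (rinner \<alpha> \<delta>) / 2) = arccos (1 / 2) \<longleftrightarrow> real_of_int (rinner \<alpha> \<delta>) / 2 = 1 / 2"
      by (intro arccos_eq_iff) auto
    then show ?thesis using that by (simp add: root_angle_eq arccos_half_cases)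
  qed
  then show ?thesis by (auto simp: Phi1_def)
qed

lemma Phi1_eq: "Phi1 = {(0,0,1,0),(1,0,1,0),(0,1,1,0),(0,0,1,1),(1,1,1,0),(1,0,1,1),(0,1,1,1),(1,1,1,1)}"
proof -
  have "Phi1 = {\<alpha> \<in> set root_list. rinner \<alpha> \<delta> = 1}" by (auto simp: Phi1_iff Phi_eq)
  also have "\<dots> = set (filter (\<lambda>\<alpha>. rinner \<alpha> \<delta> = 1) root_list)" by simp
  also have "\<dots> = {(0,0,1,0),(1,0,1,0),(0,1,1,0),(0,0,1,1),(1,1,1,0),(1,0,1,1),(0,1,1,1),(1,1,1,1)}"
    by (simp add: root_list_def \<delta>_def)
  finally show ?thesis .
qed

lemma Phi0_eq: "Phi0 = {(1,0,0,0),(0,1,0,0),(0,0,0,1),(-1,0,0,0),(0,-1,0,0),(0,0,0,-1)}"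
proof -
  have "Phi0 = set (filter (\<lambda>\<alpha>. rinner \<alpha> \<delta> = 0) root_list)" by (auto simp: Phi0_def Phi_eq)
  also have "\<dots> = {(1,0,0,0),(0,1,0,0),(0,0,0,1),(-1,0,0,0),(0,-1,0,0),(0,0,0,-1)}"
    by (simp add: root_list_def \<delta>_def)
  finally show ?thesis .
qed

lemma rinner_simple_delta: "i \<in> {1..4} \<Longrightarrow> rinner (simple_root i) \<delta> = of_bool (i = 3)"
  by (auto simp: simple_root_def \<delta>_def)

lemma bracket_evec_evec:
  assumes "\<alpha> \<in> Phi" "\<beta> \<in> Phi" "rinner \<alpha> \<beta> = - 1"
  shows "bracket N (evec \<alpha>) (evec \<beta>) = scale (of_int (N \<alpha> \<beta>)) (evec (\<alpha> + \<beta>))"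
proof (rule lie_space_eqI)
  have "\<alpha> + \<beta> \<in> Phi" using assms by (simp add: add_Phi_iff)
  then show "scale (of_int (N \<alpha> \<beta>)) (evec (\<alpha> + \<beta>)) \<in> lie_space" by auto
next
  fix \<gamma> assume "\<gamma> \<in> Phi"
  then show "bracket N (evec \<alpha>) (evec \<beta>) (E \<gamma>) = scale (of_int (N \<alpha> \<beta>)) (evec (\<alpha> + \<beta>)) (E \<gamma>)"
    using assms Phi_nonzero by (auto simp: bracket_evec_E scale_def algebra_simps)
next
  fix i :: nat assume "i \<in> {1..4}"
  moreover have "- \<alpha> \<noteq> \<beta>" using assms by (auto simp: rinner_minus Phi_self)
  ultimately show "bracket N (evec \<alpha>) (evec \<beta>) (H i) = scale (of_int (N \<alpha> \<beta>)) (evec (\<alpha> + \<beta>)) (H i)"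
    using assms by (simp only: bracket_evec_H) (simp add: scale_def)
qed simp

lemma bracket_evec_evec_0:
  assumes "\<alpha> \<in> Phi" "\<beta> \<in> Phi" "0 \<le> rinner \<alpha> \<beta>"
  shows "bracket N (evec \<alpha>) (evec \<beta>) = 0"
proof (rule lie_space_eqI)
  show "0 \<in> lie_space" by (simp add: lie_space_def)
next
  fix \<gamma> assume "\<gamma> \<in> Phi"
  moreover have "\<alpha> + \<beta> \<notin> Phi" using assms by (simp add: add_Phi_iff)
  ultimately show "bracket N (evec \<alpha>) (evec \<beta>) (E \<gamma>) = 0 (E \<gamma>)"
    using assms by (auto simp: bracket_evec_E algebra_simps)
next
  fix i :: nat assume "i \<in> {1..4}"
  moreover have "- \<alpha> \<noteq> \<beta>" using assms by (auto simp: rinner_minus Phi_self)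
  ultimately show "bracket N (evec \<alpha>) (evec \<beta>) (H i) = 0 (H i)"
    using assms by (simp only: bracket_evec_H) simp
qed simp

lemma bracket_evec_minus:
  assumes "\<alpha> \<in> Phi"
  shows "\<gamma> \<in> Phi \<Longrightarrow> bracket N (evec \<alpha>) (evec (- \<alpha>)) (E \<gamma>) = 0"
    and "i \<in> {1..4} \<Longrightarrow> bracket N (evec \<alpha>) (evec (- \<alpha>)) (H i) = of_int (rcoeff \<alpha> i)"
proof -
  show "bracket N (evec \<alpha>) (evec (- \<alpha>)) (E \<gamma>) = 0" if "\<gamma> \<in> Phi"
    using assms that Phi_nonzero by (auto simp: bracket_evec_E algebra_simps)
  show "bracket N (evec \<alpha>) (evec (- \<alpha>)) (H i) = of_int (rcoeff \<alpha> i)" if "i \<in> {1..4}"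
    using assms that by (simp only: bracket_evec_H) simp
qed

text \<open>Isolates the weight action of a coroot. It serves for [e_\<alpha>, e_{-\<alpha>}], where
  the sum vanishes, and for a perturbation of h_\<delta> by root vectors in the uniqueness of
  lifts.\<close>

lemma bracket_coroot_E:
  assumes "\<gamma> \<in> Phi" and h: "\<And>i. i \<in> {1..4} \<Longrightarrow> w (H i) = of_int (rcoeff \<alpha> i)"
  shows "bracket N w v (E \<gamma>) = of_int (rinner \<alpha> \<gamma>) * v (E \<gamma>)
     + (\<Sum>\<beta>\<in>Phi. w (E \<beta>) * bracket N (evec \<beta>) v (E \<gamma>))"
proof -
  have "(\<Sum>i\<in>{1..4}. w (H i) * bracket N (bvec (H i)) v (E \<gamma>))
      = (\<Sum>i\<in>{1..4}. of_int (rcoeff \<alpha> i * rinner (simple_root i) \<gamma>) * v (E \<gamma>))"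
    by (intro sum.cong refl) (simp only: h bracket_bvec_H_E[OF _ assms(1)], simp)
  also have "\<dots> = of_int (\<Sum>i\<in>{1..4}. rcoeff \<alpha> i * rinner (simple_root i) \<gamma>) * v (E \<gamma>)"
    by (simp only: of_int_sum sum_distrib_right)
  also have "\<dots> = of_int (rinner \<alpha> \<gamma>) * v (E \<gamma>)"
    by (simp only: sum_rcoeff_rinner)
  finally show ?thesis by (simp only: bracket_expand_left[of N w]) simp
qed

lemma bracket_H:
  assumes "i \<in> {1..4}"
  shows "bracket N w v (H i) = (\<Sum>\<beta>\<in>Phi. w (E \<beta>) * (of_int (rcoeff \<beta> i) * v (E (- \<beta>))))"
proof -
  have "(\<Sum>j\<in>{1..4}. w (H j) * bracket N (bvec (H j)) v (H i)) = 0"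
    by (intro sum.neutral ballI) (simp only: bracket_bvec_H_H mult_zero_right)
  then show ?thesis
    unfolding bracket_expand_left[of N w] by (simp add: bracket_evec_H[OF _ assms] del: One_nat_def cong: sum.cong)
qed

section \<open>Identities between structure constants\<close>

context chevalley_D4
begin

text \<open>With \<gamma> = \<alpha> + \<beta> one has [e_\<alpha>, e_\<gamma>] = 0, so ad
  e_\<alpha> after ad e_{-\<alpha>} acts on e_\<gamma> as h_\<alpha>, that is by 1.\<close>

lemma N_opposite:
  assumes "\<alpha> \<in> Phi" "\<beta> \<in> Phi" "rinner \<alpha> \<beta> = - 1"
  shows "N (- \<alpha>) (\<alpha> + \<beta>) * N \<alpha> \<beta> = 1"
proof -
  define \<gamma> where "\<gamma> = \<alpha> + \<beta>"
  have \<gamma>: "\<gamma> \<in> Phi" using assms by (simp add: add_Phi_iff \<gamma>_def)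
  have r: "rinner \<alpha> \<gamma> = 1" using assms by (simp add: \<gamma>_def rinner_add Phi_self)
  have eqs: "\<gamma> - \<alpha> = \<beta>" "\<beta> + \<alpha> = \<gamma>" by (simp_all add: \<gamma>_def)
  have ne: "\<gamma> \<noteq> \<alpha>" "\<beta> \<noteq> - \<alpha>" using assms r by (auto simp: Phi_self rinner_minus)
  let ?e = "evec :: rt \<Rightarrow> label \<Rightarrow> int"
  have "bracket N (?e \<alpha>) (bracket N (?e (- \<alpha>)) (?e \<gamma>)) (E \<gamma>)
      = bracket N (bracket N (?e \<alpha>) (?e (- \<alpha>))) (?e \<gamma>) (E \<gamma>)
        + bracket N (?e (- \<alpha>)) (bracket N (?e \<alpha>) (?e \<gamma>)) (E \<gamma>)"
    by (subst bracket_derivation) simp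
  moreover have "bracket N (?e \<alpha>) (?e \<gamma>) = 0" using assms \<gamma> r by (simp add: bracket_evec_evec_0)
  moreover have "bracket N (?e (- \<alpha>)) 0 (E \<gamma>) = 0" by (simp add: bracket_def)
  moreover have "bracket N (bracket N (?e \<alpha>) (?e (- \<alpha>))) (?e \<gamma>) (E \<gamma>) = 1"
    using assms(1) \<gamma> r by (subst bracket_coroot_E[where \<alpha> = \<alpha>]) (simp_all add: bracket_evec_minus del: One_nat_def)
  moreover have "bracket N (?e \<alpha>) (bracket N (?e (- \<alpha>)) (?e \<gamma>)) (E \<gamma>) = N \<alpha> \<beta> * N (- \<alpha>) \<gamma>"
    using assms \<gamma> ne by (simp add: bracket_evec_E eqs)
  ultimately show ?thesis by (simp add: \<gamma>_def mult.commute)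
qed

text \<open>ad e_\<alpha> and ad e_\<beta> commute for orthogonal roots; both orders of applying
  them to e_\<gamma> are compared. This carries signs normalised by positivity over to other pairs
  of roots.\<close>

lemma N_exchange:
  assumes "\<alpha> \<in> Phi" "\<beta> \<in> Phi" "\<gamma> \<in> Phi" "rinner \<alpha> \<beta> = 0" "rinner \<alpha> \<gamma> = - 1" "rinner \<beta> \<gamma> = - 1"
  shows "N \<beta> \<gamma> * N \<alpha> (\<beta> + \<gamma>) = N \<alpha> \<gamma> * N \<beta> (\<alpha> + \<gamma>)"
proof -
  let ?e = "evec :: rt \<Rightarrow> label \<Rightarrow> int"
  have in_Phi: "\<alpha> + \<gamma> \<in> Phi" "\<beta> + \<gamma> \<in> Phi" using assms by (simp_all add: add_Phi_iff)
  have r: "rinner \<alpha> (\<beta> + \<gamma>) = - 1" "rinner \<beta> (\<alpha> + \<gamma>) = - 1"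
    using assms by (simp_all add: rinner_add rinner_commute[of \<beta> \<alpha>])
  have "bracket N (?e \<alpha>) (bracket N (?e \<beta>) (?e \<gamma>))
      = bracket N (bracket N (?e \<alpha>) (?e \<beta>)) (?e \<gamma>) + bracket N (?e \<beta>) (bracket N (?e \<alpha>) (?e \<gamma>))"
    by (rule bracket_derivation)
  moreover have "bracket N (?e \<alpha>) (?e \<beta>) = 0" using assms by (simp add: bracket_evec_evec_0)
  moreover have "bracket N 0 (?e \<gamma>) = 0" by (simp add: bracket_def fun_eq_iff)
  ultimately have "scale (N \<beta> \<gamma> * N \<alpha> (\<beta> + \<gamma>)) (?e (\<alpha> + (\<beta> + \<gamma>)))
      = scale (N \<alpha> \<gamma> * N \<beta> (\<alpha> + \<gamma>)) (?e (\<beta> + (\<alpha> + \<gamma>)))"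
    using assms in_Phi r by (simp add: bracket_evec_evec bracket_linear) (simp add: scale_def fun_eq_iff mult.assoc)
  moreover have "\<beta> + (\<alpha> + \<gamma>) = \<alpha> + (\<beta> + \<gamma>)" by (simp add: algebra_simps)
  ultimately show ?thesis
    by (auto simp: scale_def dest!: fun_cong[where x = "E (\<alpha> + (\<beta> + \<gamma>))"])
qed

end

section \<open>Root elements acting on root vectors\<close>

context chevalley_D4_field
begin

lemma two_mult_cancel: "2 * x = 2 * y \<longleftrightarrow> x = (y::'a)"
  using two_nonzero by simp

lemma bracket_0 [simp]: "br 0 x = 0" "br x 0 = 0"
  by (simp_all add: bracket_def fun_eq_iff)

lemma scale_simps [simp]: "scale 1 x = x" "scale 0 x = 0" "scale c 0 = 0"
  "scale c (scale d x) = scale (c * d) x" for x :: "label \<Rightarrow> 'a"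
  by (auto simp: scale_def fun_eq_iff)

lemma lie_space_0 [simp]: "0 \<in> L"
  by (simp add: lie_space_def)

lemma N_nonzero:
  assumes "\<alpha> \<in> Phi" "\<beta> \<in> Phi" "rinner \<alpha> \<beta> = - 1" shows "of_int (N \<alpha> \<beta>) \<noteq> (0::'a)"
  using N_cases[of \<alpha> \<beta>] assms by (auto simp: add_Phi_iff)

lemma N_squared:
  assumes "\<alpha> \<in> Phi" "\<beta> \<in> Phi" "rinner \<alpha> \<beta> = - 1" shows "of_int (N \<alpha> \<beta>) * of_int (N \<alpha> \<beta>) = (1::'a)"
  using N_cases[of \<alpha> \<beta>] assms by (auto simp: add_Phi_iff)

lemma X_evec_fixed:
  assumes "\<alpha> \<in> Phi" "\<beta> \<in> Phi" "0 \<le> rinner \<alpha> \<beta>" shows "X \<alpha> a (evec \<beta>) = evec \<beta>"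
proof -
  have "- \<alpha> \<noteq> \<beta>" using assms by (auto simp: rinner_minus Phi_self)
  then show ?thesis using assms by (simp add: X_eq bracket_evec_evec_0)
qed

lemma X_evec_moved:
  assumes "\<alpha> \<in> Phi" "\<beta> \<in> Phi" "rinner \<alpha> \<beta> = - 1"
  shows "X \<alpha> a (evec \<beta>) = evec \<beta> + scale (a * of_int (N \<alpha> \<beta>)) (evec (\<alpha> + \<beta>))"
proof -
  have "- \<alpha> \<noteq> \<beta>" using assms by (auto simp: rinner_minus Phi_self)
  then show ?thesis using assms by (simp add: X_eq bracket_evec_evec)
qed

text \<open>\<open>X \<alpha> a\<close> is an automorphism that fixes e_\<beta> and leaves the
  coordinate at -\<beta> alone, and these are the only data in the formula for
  \<open>X \<beta> b\<close>.\<close>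

lemma X_commute:
  assumes \<alpha>: "\<alpha> \<in> Phi" and \<beta>: "\<beta> \<in> Phi" and r: "rinner \<alpha> \<beta> = 0" and v: "v \<in> L"
  shows "X \<alpha> a (X \<beta> b v) = X \<beta> b (X \<alpha> a v)"
proof -
  have "- \<beta> \<noteq> \<alpha>" "- \<beta> - \<alpha> \<notin> Phi" using assms
    by (auto simp: rinner_minus Phi_self diff_Phi_iff rinner_commute[of \<beta> \<alpha>])
  then have f: "X \<alpha> a v (E (- \<beta>)) = v (E (- \<beta>))"
    using \<alpha> \<beta> v by (simp add: X_eq bracket_evec_E scale_def)
  have e: "X \<alpha> a (evec \<beta>) = evec \<beta>" using assms by (simp add: X_evec_fixed)
  have "X \<alpha> a (X \<beta> b v) = X \<alpha> a (v + (scale b (br (evec \<beta>) v) + scale (- b\<^sup>2 * v (E (- \<beta>))) (evec \<beta>)))"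
    using \<beta> v by (simp add: X_eq add.assoc)
  also have "\<dots> = X \<alpha> a v + (scale b (br (evec \<beta>) (X \<alpha> a v)) + scale (- b\<^sup>2 * v (E (- \<beta>))) (evec \<beta>))"
    using \<alpha> \<beta> v e by (simp add: X_add X_scale X_bracket lie_space_add lie_space_scale)
  also have "\<dots> = X \<beta> b (X \<alpha> a v)"
    using \<alpha> \<beta> v f by (simp add: X_eq[OF \<beta>] add.assoc)
  finally show ?thesis .
qed

text \<open>The plane spanned by e_\<beta> and e_{\<beta> - \<gamma>} is the natural module of the
  SL_2 of \<gamma>. After a nontrivial lowering, raising with c = -1 / a cancels e_\<beta>, since
  the two structure constants have product 1 by \<open>N_opposite\<close>.\<close>

lemma X_flip:
  assumes "\<gamma> \<in> Phi" "\<beta> \<in> Phi" "rinner \<gamma> \<beta> = 1"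
  obtains c d where "d \<noteq> 0" "X \<gamma> c (X (- \<gamma>) a (evec \<beta>)) = scale d (evec (if a = 0 then \<beta> else \<beta> - \<gamma>))"
proof (cases "a = 0")
  case True
  then have "X \<gamma> 0 (X (- \<gamma>) a (evec \<beta>)) = scale 1 (evec (if a = 0 then \<beta> else \<beta> - \<gamma>))"
    using assms by (simp add: X_0)
  then show ?thesis using that by (metis zero_neq_one)
next
  case False
  define n where "n = (of_int (N (- \<gamma>) \<beta>) :: 'a)"
  define m where "m = (of_int (N \<gamma> (\<beta> - \<gamma>)) :: 'a)"
  have r: "rinner (- \<gamma>) \<beta> = - 1" using assms by (simp add: rinner_minus)
  have \<beta>\<gamma>: "\<beta> - \<gamma> \<in> Phi" and r': "rinner \<gamma> (\<beta> - \<gamma>) = - 1"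
    using assms by (simp_all add: diff_Phi_iff rinner_commute[of \<beta> \<gamma>] rinner_diff Phi_self)
  have "N (- (- \<gamma>)) (- \<gamma> + \<beta>) * N (- \<gamma>) \<beta> = 1"
    using assms r by (intro N_opposite) auto
  then have "N \<gamma> (\<beta> - \<gamma>) * N (- \<gamma>) \<beta> = 1" by simp
  then have mn: "m * n = 1" unfolding m_def n_def by (metis of_int_1 of_int_mult)
  then have n0: "n \<noteq> 0" by auto
  have "X \<gamma> (- 1 / a) (X (- \<gamma>) a (evec \<beta>))
      = evec \<beta> + scale (a * n) (evec (\<beta> - \<gamma>) + scale (- 1 / a * m) (evec \<beta>))"
    using assms r r' \<beta>\<gamma> by (simp add: X_evec_moved X_add X_scale X_evec_fixed lie_space_scale n_def m_def)
  also have "\<dots> = scale (a * n) (evec (\<beta> - \<gamma>))"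
    using False mn by (simp add: scale_def fun_eq_iff algebra_simps)
  finally show ?thesis using that[of "a * n" "- 1 / a"] False n0 by simp
qed

end

section \<open>Uniqueness of lifts\<close>

context chevalley_D4_field
begin

lemma chev_closed: "g \<in> carrier (grp Phi) \<Longrightarrow> v \<in> L \<Longrightarrow> g v \<in> L"
  by (rule grp_closed[OF subset_refl])

lemmas chev_automorphism = grp_automorphism[OF subset_refl]

lemma root_elements_eq: "(root_elements N :: (label \<Rightarrow> 'a) set) = {g (evec \<alpha>) | g \<alpha>. g \<in> carrier (grp Phi) \<and> \<alpha> \<in> Phi}"
  by (simp add: root_elements_def chev_group_eq)

lemma root_elements_in: "y \<in> root_elements N \<Longrightarrow> y \<in> L"
  unfolding root_elements_eq using chev_closed lie_space_evec by blast

lemma root_element_extremal: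
  fixes y :: "label \<Rightarrow> 'a"
  assumes y: "y \<in> root_elements N" and z: "z \<in> L"
  obtains c where "br y (br y z) = scale c y"
proof -
  obtain g \<alpha> where g: "g \<in> carrier (grp Phi)" and \<alpha>: "\<alpha> \<in> Phi" and y: "y = g (evec \<alpha>)"
    using y unfolding root_elements_eq by blast
  obtain h where h: "h \<in> carrier (grp Phi)" "g (h z) = z"
    using grp_inverse[OF subset_refl g] z by metis
  have hz: "h z \<in> L" using h(1) z by (rule chev_closed)
  have e: "evec \<alpha> \<in> L" using \<alpha> by simp
  have "br y (br y z) = g (br (evec \<alpha>) (br (evec \<alpha>) (h z)))"
    by (simp only: chev_automorphism(3)[OF g] e hz bracket_in_lie_space h(2) y)
  also have "\<dots> = scale (- 2 * h z (E (- \<alpha>))) y"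
    by (simp only: bracket_evec_twice[OF \<alpha>] chev_automorphism(2)[OF g e e] y)
  finally show ?thesis using that by blast
qed

text \<open>In the grading by \<open>rinner _ \<delta>\<close> the degrees run from -2 to 2 and
  e_\<delta> spans degree 2; a root vector of negative degree cannot raise anything that
  far.\<close>

lemma bracket_lowering_degree_two:
  assumes "\<alpha> \<in> Phi" "rinner \<alpha> \<delta> < 0" shows "br (evec \<alpha>) v (E \<delta>) = 0"
  using assms by (auto simp: bracket_evec_E diff_Phi_iff rinner_commute[of \<delta> \<alpha>] Phi_self)

lemma root_degree_2: "\<gamma> \<in> Phi \<Longrightarrow> rinner \<gamma> \<delta> = 2 \<Longrightarrow> \<gamma> = \<delta>"
  by (simp add: rinner_eq_2_iff)

text \<open>The difference u has no part of degree 1 or 2. The element w = [y, e_{-\<delta>}] is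
  h_\<delta> plus terms of degree -1 and is the same for both lifts, and extremality gives [w, y] =
  2 y and [w, y'] = 2 y'. Hence [w, u] = 2 u, and comparison with the weights of h_\<delta> kills u
  from degree 0 downwards, except that degree -1 needs an argument of its own.\<close>

lemma lift_unique:
  fixes y y' :: "label \<Rightarrow> 'a"
  assumes y: "y \<in> root_elements N" and y': "y' \<in> root_elements N"
    and eq1: "\<And>\<alpha>. \<alpha> \<in> Phi1 \<Longrightarrow> y (E \<alpha>) = y' (E \<alpha>)"
    and y\<delta>: "y (E \<delta>) = 1" "y' (E \<delta>) = 1" and y3: "y (H 3) = 0" "y' (H 3) = 0"
  shows "y = y'"
proof -
  define u where "u = y - y'"
  define w where "w = br y (evec (- \<delta>))"
  have yL: "y \<in> L" "y' \<in> L" using y y' root_elements_in by auto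
  have uL: "u \<in> L" using yL by (simp add: u_def lie_space_diff)
  have u\<delta>: "u (E \<delta>) = 0" using y\<delta> by (simp add: u_def)
  have u1: "u (E \<alpha>) = 0" if "\<alpha> \<in> Phi" "rinner \<alpha> \<delta> = 1" for \<alpha>
    using that eq1 by (simp add: u_def Phi1_iff)
  have u3: "u (H 3) = 0" using y3 by (simp add: u_def)
  have m\<delta>: "- \<delta> \<in> Phi" by simp
  \<comment> \<open>\<alpha>_3 is the only simple root not orthogonal to \<delta>, so
    \<open>H 3\<close> is the only Cartan coordinate that ad e_{-\<delta>} sees.\<close>
  have sum3: "(\<Sum>i\<in>{1..4}. of_int (rinner (simple_root i) (- \<delta>)) * v (H i)) = - v (H 3)" for v :: "label \<Rightarrow> 'a"
    unfolding sum_1_4 by (simp add: rinner_minus rinner_simple_delta del: One_nat_def)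
  have eu: "br (evec (- \<delta>)) u = 0"
  proof (rule lie_space_eqI)
    fix \<gamma> assume \<gamma>: "\<gamma> \<in> Phi"
    have "rinner (\<gamma> + \<delta>) \<delta> = 1" if "\<gamma> + \<delta> \<in> Phi"
      using that \<gamma> by (simp add: add_Phi_iff rinner_add Phi_self)
    then show "br (evec (- \<delta>)) u (E \<gamma>) = 0 (E \<gamma>)"
      unfolding bracket_evec_E[OF m\<delta> \<gamma>] sum3 by (auto simp: u3 u1)
  next
    fix i :: nat assume "i \<in> {1..4}"
    then show "br (evec (- \<delta>)) u (H i) = 0 (H i)"
      unfolding bracket_evec_H[OF m\<delta> \<open>i \<in> {1..4}\<close>] by (simp add: u\<delta>)
  qed simp_all
  have ue: "br u (evec (- \<delta>)) = 0"
    using eu bracket_antisym[of u "evec (- \<delta>)"] by simp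
  have w': "br y' (evec (- \<delta>)) = w"
    using ue by (simp add: u_def w_def bracket_linear)
  have w_antisym: "w = - br (evec (- \<delta>)) y" unfolding w_def by (rule bracket_antisym)
  have wH: "w (H i) = of_int (rcoeff \<delta> i)" if i: "i \<in> {1..4}" for i
  proof -
    have "w (H i) = - (of_int (rcoeff (- \<delta>) i) * y (E \<delta>))"
      unfolding w_antisym by (simp add: bracket_evec_H[OF m\<delta> i] del: One_nat_def)
    also have "rcoeff (- \<delta>) i = - rcoeff \<delta> i" by (simp add: \<delta>_def)
    finally show ?thesis by (simp add: y\<delta>)
  qed
  \<comment> \<open>The condition on \<open>y (H 3)\<close> enters here: up to sign it is the
    coordinate of w at -\<delta>.\<close>
  have wE: "w (E \<gamma>) = 0" if \<gamma>: "\<gamma> \<in> Phi" "rinner \<gamma> \<delta> \<noteq> - 1" for \<gamma>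
  proof -
    have "\<gamma> + \<delta> \<notin> Phi" using \<gamma> by (simp add: add_Phi_iff)
    then show ?thesis using y3
      unfolding w_antisym by (simp only: fun_Compl_def bracket_evec_E[OF m\<delta> \<gamma>(1)] sum3) simp
  qed
  have w_act: "br w v (E \<gamma>) = of_int (rinner \<gamma> \<delta>) * v (E \<gamma>)"
    if \<gamma>: "\<gamma> \<in> Phi" and *: "\<And>\<alpha>. \<alpha> \<in> Phi \<Longrightarrow> rinner \<alpha> \<delta> = - 1 \<Longrightarrow> br (evec \<alpha>) v (E \<gamma>) = 0" for v \<gamma>
  proof -
    have "(\<Sum>\<beta>\<in>Phi. w (E \<beta>) * br (evec \<beta>) v (E \<gamma>)) = 0"
    proof (intro sum.neutral ballI)
      fix \<beta> assume "\<beta> \<in> Phi"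
      then show "w (E \<beta>) * br (evec \<beta>) v (E \<gamma>) = 0" using wE *
        by (cases "rinner \<beta> \<delta> = - 1") simp_all
    qed
    then show ?thesis
      using bracket_coroot_E[OF \<gamma>, of w \<delta> N v] wH by (simp add: rinner_commute[of \<gamma> \<delta>])
  qed
  \<comment> \<open>Extremality makes [w, v] a multiple of v. The multiplier is read off at
    \<delta>, where v has coordinate 1 and w acts by \<open>rinner \<delta> \<delta>\<close>, which
    is 2.\<close>
  have wv: "br w v = scale 2 v" if v: "v \<in> root_elements N" "v (E \<delta>) = 1" "br v (evec (- \<delta>)) = w" for v
  proof -
    obtain c where c: "br v (br v (evec (- \<delta>))) = scale c v"
      using root_element_extremal[OF v(1), of "evec (- \<delta>)"] by auto
    then have 1: "br w v = scale (- c) v"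
      using v(3) bracket_antisym[of w v] by (simp add: scale_def fun_eq_iff)
    have "br w v (E \<delta>) = of_int (rinner \<delta> \<delta>) * v (E \<delta>)"
      by (rule w_act) (simp_all add: bracket_lowering_degree_two)
    then show ?thesis using 1 v(2) by (simp add: scale_def Phi_self)
  qed
  have wu: "br w u = scale 2 u"
    using wv[OF y y\<delta>(1) w_def[symmetric]] wv[OF y' y\<delta>(2) w']
    by (simp add: u_def bracket_linear scale_def fun_eq_iff algebra_simps)
  \<comment> \<open>In degree 0 the weight is 0, so [w, u] = 2 u leaves 2 u = 0.\<close>
  have u0: "u (E \<gamma>) = 0" if \<gamma>: "\<gamma> \<in> Phi" "rinner \<gamma> \<delta> = 0" for \<gamma>
  proof -
    have "br w u (E \<gamma>) = of_int (rinner \<gamma> \<delta>) * u (E \<gamma>)"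
    proof (rule w_act[OF \<gamma>(1)])
      fix \<alpha> assume \<alpha>: "\<alpha> \<in> Phi" "rinner \<alpha> \<delta> = - 1"
      have "u (E (\<gamma> - \<alpha>)) = 0" if "\<gamma> - \<alpha> \<in> Phi"
        using that \<gamma> \<alpha> by (intro u1) (simp_all add: rinner_diff)
      moreover have "\<gamma> \<noteq> \<alpha>" using \<gamma> \<alpha> by auto
      ultimately show "br (evec \<alpha>) u (E \<gamma>) = 0" using \<gamma> \<alpha> by (simp add: bracket_evec_E)
    qed
    then show ?thesis using wu \<gamma> two_nonzero by (simp add: scale_def)
  qed
  have uH: "u (H i) = 0" if i: "i \<in> {1..4}" for i
  proof -
    have "br w u (H i) = 0" unfolding bracket_H[OF i]
    proof (intro sum.neutral ballI)
      fix \<beta> assume \<beta>: "\<beta> \<in> Phi"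
      show "w (E \<beta>) * (of_int (rcoeff \<beta> i) * u (E (- \<beta>))) = 0"
        using \<beta> wE[OF \<beta>] u1[of "- \<beta>"] by (cases "rinner \<beta> \<delta> = - 1") (simp_all add: rinner_minus)
    qed
    then show ?thesis using wu two_nonzero by (simp add: scale_def)
  qed
  have u_lowering: "u (E \<alpha>) = 0 \<or> rinner \<alpha> \<delta> < 0" if "\<alpha> \<in> Phi" for \<alpha>
  proof -
    have "rinner \<alpha> \<delta> \<le> 2" using rinner_bounds[OF that delta_Phi] by simp
    then consider "rinner \<alpha> \<delta> = 2" | "rinner \<alpha> \<delta> = 1" | "rinner \<alpha> \<delta> = 0" | "rinner \<alpha> \<delta> < 0" by linarith
    then show ?thesis using u0[OF that] u1[OF that] u\<delta> root_degree_2[OF that] by cases auto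
  qed
  \<comment> \<open>\<open>br w u = 2 u\<close> gives only \<open>3 u = 0\<close> in degree \<open>-1\<close>, which is void in characteristic \<open>3\<close>; so the
    quadratic relation is tested on \<open>e\<close> at \<open>- \<beta>\<close> as well.\<close>
  have um1: "u (E (\<beta> - \<delta>)) = 0" if \<beta>: "\<beta> \<in> Phi" "rinner \<beta> \<delta> = 1" for \<beta>
  proof -
    define n1 where "n1 = N (- \<beta>) (\<beta> - \<delta>)"
    define n2 where "n2 = N (- \<beta>) \<delta>"
    define A where "A = br y (evec (- \<beta>))"
    define t where "t = u (E (\<beta> - \<delta>))"
    have mb: "- \<beta> \<in> Phi" using \<beta> by simp
    have \<beta>\<delta>: "\<beta> - \<delta> \<in> Phi" using \<beta> by (simp add: diff_Phi_iff)
    have A_antisym: "A = - br (evec (- \<beta>)) y" unfolding A_def by (rule bracket_antisym)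
    \<comment> \<open>u lives in degrees -1 and -2 and e_{-\<beta>} has degree -1, so only
      e_{-\<delta>} can occur.\<close>
    have uz: "br u (evec (- \<beta>)) = scale (- of_int n1 * t) (evec (- \<delta>))"
    proof (rule lie_space_eqI)
      show "scale (- of_int n1 * t) (evec (- \<delta>)) \<in> L" by (intro lie_space_scale) simp
    next
      fix \<gamma> assume \<gamma>: "\<gamma> \<in> Phi"
      have "u (E (\<gamma> + \<beta>)) = 0" if "\<gamma> + \<beta> \<in> Phi" "\<gamma> \<noteq> - \<delta>"
      proof -
        have "rinner \<gamma> \<delta> \<noteq> - 2" using that \<gamma> by (simp add: rinner_eq_minus_2_iff)
        moreover have "\<bar>rinner \<gamma> \<delta>\<bar> \<le> 2" using rinner_bounds[OF \<gamma> delta_Phi] .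
        ultimately have "\<not> rinner (\<gamma> + \<beta>) \<delta> < 0" using \<beta> by (simp add: rinner_add)
        then show ?thesis using u_lowering[OF that(1)] by blast
      qed
      then show "br u (evec (- \<beta>)) (E \<gamma>) = scale (- of_int n1 * t) (evec (- \<delta>)) (E \<gamma>)"
        using \<gamma> mb \<beta>\<delta> uH \<beta> Phi_self[OF delta_Phi] Phi_self[OF \<beta>(1)]
        by (subst bracket_antisym) (auto simp: bracket_evec_E scale_def n1_def t_def rinner_minus simp del: One_nat_def)
    next
      fix i :: nat assume i: "i \<in> {1..4}"
      show "br u (evec (- \<beta>)) (H i) = scale (- of_int n1 * t) (evec (- \<delta>)) (H i)"
        using i mb \<beta> u1 by (subst bracket_antisym) (simp add: bracket_evec_H scale_def del: One_nat_def)
    qed simp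
    \<comment> \<open>In positive degree only the coordinate 1 of y at \<delta> contributes, as
      there is nothing else in degree 2.\<close>
    have Amu: "A (E \<mu>) = (if \<mu> = \<delta> - \<beta> then - of_int n2 else 0)" if \<mu>: "\<mu> \<in> Phi" "rinner \<mu> \<delta> > 0" for \<mu>
    proof -
      have "\<mu> + \<beta> \<in> Phi \<longleftrightarrow> \<mu> = \<delta> - \<beta>"
      proof
        assume *: "\<mu> + \<beta> \<in> Phi"
        then have "\<bar>rinner (\<mu> + \<beta>) \<delta>\<bar> \<le> 2" by (rule rinner_bounds) simp
        then have "rinner (\<mu> + \<beta>) \<delta> = 2" using \<mu> \<beta> by (simp add: rinner_add)
        then show "\<mu> = \<delta> - \<beta>" using root_degree_2[OF *] by (simp add: algebra_simps)
      qed simp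
      moreover have "\<mu> \<noteq> - \<beta>" using \<mu> \<beta> by (auto simp: rinner_minus)
      ultimately show ?thesis
        using \<mu>(1) mb unfolding A_antisym by (auto simp: bracket_evec_E n2_def y\<delta>)
    qed
    obtain c where c: "br y A = scale c y"
      using root_element_extremal[OF y, of "evec (- \<beta>)"] mb unfolding A_def by auto
    obtain c' where c': "br y' (br y' (evec (- \<beta>))) = scale c' y'"
      using root_element_extremal[OF y', of "evec (- \<beta>)"] mb by auto
    have "br y' (evec (- \<beta>)) = A - scale (- of_int n1 * t) (evec (- \<delta>))"
      unfolding uz[symmetric] by (simp add: A_def u_def bracket_linear)
    then have "scale c' y' = br y' A - scale (- of_int n1 * t) w"
      using c' by (simp only: bracket_linear w')
    also have "br y' A = scale c y - br u A" using c by (simp add: u_def bracket_linear)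
    finally have key: "scale c' y' = scale c y - br u A + scale (of_int n1 * t) w"
      by (simp add: scale_def fun_eq_iff)
    have uA: "br u A (E \<delta>) = 0"
    proof -
      have "(\<Sum>\<alpha>\<in>Phi. u (E \<alpha>) * br (evec \<alpha>) A (E \<delta>)) = 0"
      proof (intro sum.neutral ballI)
        fix \<alpha> assume "\<alpha> \<in> Phi"
        then show "u (E \<alpha>) * br (evec \<alpha>) A (E \<delta>) = 0"
          using u_lowering[of \<alpha>] bracket_lowering_degree_two[of \<alpha>] by auto
      qed
      moreover have "(\<Sum>i\<in>{1..4}. u (H i) * br (bvec (H i)) A (E \<delta>)) = 0"
        by (intro sum.neutral ballI) (simp only: uH mult_zero_left)
      ultimately show ?thesis unfolding bracket_expand_left[of N u] by simp
    qed
    have "w (E \<delta>) = 0" by (rule wE) (simp_all add: Phi_self)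
    then have cc: "c' = c" using fun_cong[OF key, of "E \<delta>"] y\<delta> uA by (simp add: scale_def)
    \<comment> \<open>The lifts agree on the Cartan part and c' = c, so \<open>key\<close> at
      \<open>H i\<close> becomes a linear condition on t alone.\<close>
    have eq: "of_int (n1 * rcoeff \<delta> i + n2 * rcoeff (\<beta> - \<delta>) i) * t = 0" if i: "i \<in> {1..4}" for i
    proof -
      have "br u A (H i) = (\<Sum>\<alpha>\<in>Phi. if \<alpha> = \<beta> - \<delta> then t * (of_int (rcoeff (\<beta> - \<delta>) i) * (- of_int n2)) else 0)"
        unfolding bracket_H[OF i]
      proof (intro sum.cong refl)
        fix \<alpha> assume \<alpha>: "\<alpha> \<in> Phi"
        have "- \<alpha> = \<delta> - \<beta> \<longleftrightarrow> \<alpha> = \<beta> - \<delta>" by (metis minus_diff_eq minus_minus)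
        then show "u (E \<alpha>) * (of_int (rcoeff \<alpha> i) * A (E (- \<alpha>)))
          = (if \<alpha> = \<beta> - \<delta> then t * (of_int (rcoeff (\<beta> - \<delta>) i) * (- of_int n2)) else 0)"
          using u_lowering[OF \<alpha>] Amu[of "- \<alpha>"] \<alpha> by (auto simp: t_def rinner_minus)
      qed
      also have "\<dots> = - (of_int (n2 * rcoeff (\<beta> - \<delta>) i) * t)" using \<beta>\<delta> by simp
      finally have 1: "br u A (H i) = - (of_int (n2 * rcoeff (\<beta> - \<delta>) i) * t)" .
      have "y (H i) = y' (H i)" using uH[OF i] by (simp add: u_def)
      then show ?thesis using fun_cong[OF key, of "H i"] cc 1 wH[OF i]
        by (simp add: scale_def algebra_simps)
    qed
    have "\<beta> \<in> Phi1" using \<beta> by (simp add: Phi1_iff)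
    then have rc: "rcoeff (\<beta> - \<delta>) 3 = - 1" "rcoeff (\<beta> - \<delta>) 1 = 0 \<or> rcoeff (\<beta> - \<delta>) 1 = - 1"
      by (auto simp: Phi1_eq \<delta>_def)
    have e3: "of_int (n1 * 2 - n2) * t = 0" using eq[of 3] rc(1) by (simp add: \<delta>_def)
    have e1: "of_int (n1 + n2 * rcoeff (\<beta> - \<delta>) 1) * t = 0" using eq[of 1] by (simp add: \<delta>_def)
    have n: "n1 = 1 \<or> n1 = - 1" "n2 = 1 \<or> n2 = - 1"
      unfolding n1_def n2_def using mb \<beta>\<delta> \<beta> N_cases[of "- \<beta>" "\<beta> - \<delta>"] N_cases[of "- \<beta>" \<delta>]
        uminus_Phi[of "\<beta> - \<delta>"]
      by simp_all
    have "(2::'a) \<noteq> 1" by (metis add_cancel_left_right one_add_one zero_neq_one)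
    \<comment> \<open>If \<open>rcoeff (\<beta> - \<delta>) 1\<close> is 0, \<open>e1\<close> gives
      t = 0. Otherwise the factor in \<open>e1\<close> is n1 - n2, which is 0 or 2 up to sign; if it
      is 0, the factor in \<open>e3\<close> is n1.\<close>
    then show ?thesis
      using n rc(2) e1 e3 two_nonzero unfolding t_def by auto
  qed
  show ?thesis
  proof -
    have ulow: "u (E \<gamma>) = 0" if \<gamma>: "\<gamma> \<in> Phi" "\<gamma> \<noteq> - \<delta>" for \<gamma>
    proof -
      have "rinner \<gamma> \<delta> = - 1 \<or> \<not> rinner \<gamma> \<delta> < 0"
        using rinner_bounds[OF \<gamma>(1) delta_Phi] rinner_eq_minus_2_iff[OF \<gamma>(1) delta_Phi] \<gamma>(2) by auto
      then show ?thesis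
      proof
        assume "rinner \<gamma> \<delta> = - 1"
        then show ?thesis using um1[of "\<gamma> + \<delta>"] \<gamma> by (simp add: add_Phi_iff rinner_add Phi_self)
      qed (use u_lowering[OF \<gamma>(1)] in auto)
    qed
    \<comment> \<open>In degree -2 comparison with the weight gives 2 u = -2 u, that is 4 u =
      0.\<close>
    have "br w u (E (- \<delta>)) = of_int (rinner (- \<delta>) \<delta>) * u (E (- \<delta>))"
    proof (rule w_act)
      fix \<alpha> assume \<alpha>: "\<alpha> \<in> Phi" "rinner \<alpha> \<delta> = - 1"
      have "- \<delta> - \<alpha> \<noteq> - \<delta>" using Phi_nonzero \<alpha> by auto
      moreover have "- \<delta> \<noteq> \<alpha>" using \<alpha> by (auto simp: rinner_minus Phi_self)
      ultimately show "br (evec \<alpha>) u (E (- \<delta>)) = 0" using \<alpha> ulow by (simp add: bracket_evec_E)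
    qed simp
    then have "2 * (2 * u (E (- \<delta>))) = 0" using wu by (simp add: scale_def rinner_minus Phi_self algebra_simps)
    then have "u (E (- \<delta>)) = 0" using two_nonzero by (metis mult_eq_0_iff)
    then have "u (E \<gamma>) = 0" if "\<gamma> \<in> Phi" for \<gamma> using ulow that by (cases "\<gamma> = - \<delta>") auto
    then have "u = 0" using uL uH by (intro lie_space_eqI) auto
    then show ?thesis by (simp add: u_def)
  qed
qed

end

section \<open>Angles\<close>

context chevalley_D4_field
begin

lemma chev_0: "h \<in> carrier (grp Phi) \<Longrightarrow> h 0 = 0"
  using chev_automorphism(2)[of h 0 0 0] by simp

lemma scale_eq_0: "scale c x = 0 \<longleftrightarrow> c = 0 \<or> x = (0 :: label \<Rightarrow> 'a)"
  by (auto simp: scale_def fun_eq_iff)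

lemma evec_nonzero: "evec \<alpha> \<noteq> (0 :: label \<Rightarrow> 'a)"
  by (auto simp: fun_eq_iff intro!: exI[of _ "E \<alpha>"])

lemma bracket_evec_evec_eq_0_iff:
  assumes "\<alpha> \<in> Phi" "\<beta> \<in> Phi"
  shows "br (evec \<alpha>) (evec \<beta>) = 0 \<longleftrightarrow> 0 \<le> rinner \<alpha> \<beta>"
proof -
  have "br (evec \<alpha>) (evec \<beta>) \<noteq> 0" if neg: "rinner \<alpha> \<beta> < 0"
  proof -
    consider "rinner \<alpha> \<beta> = - 1" | "rinner \<alpha> \<beta> = - 2" using neg rinner_bounds[OF assms] by linarith
    then show ?thesis
    proof cases
      case 1
      then show ?thesis using assms N_nonzero by (simp add: bracket_evec_evec scale_eq_0 evec_nonzero)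
    next
      case 2
      then have "\<beta> = - \<alpha>" using assms by (metis rinner_eq_minus_2_iff minus_minus)
      moreover have "br (evec \<alpha>) (br (evec \<alpha>) (evec (- \<alpha>))) \<noteq> 0"
        using assms two_nonzero by (simp only: bracket_evec_twice) (simp add: scale_eq_0 evec_nonzero)
      ultimately show ?thesis by auto
    qed
  qed
  then show ?thesis using assms bracket_evec_evec_0 by (metis not_le)
qed

lemma bracket_twice_eq_0_iff:
  assumes "\<alpha> \<in> Phi" "\<beta> \<in> Phi"
  shows "br (evec \<alpha>) (br (evec \<alpha>) (evec \<beta>)) = 0 \<longleftrightarrow> rinner \<alpha> \<beta> \<noteq> - 2"
  using assms two_nonzero
  by (simp add: bracket_evec_twice scale_eq_0 evec_nonzero rinner_eq_minus_2_iff) (metis minus_minus)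

text \<open>Root vectors at angle pi / 2 and at angle pi / 3 both commute, so brackets of the pair
  alone do not separate them. This condition does: it is invariant under automorphisms and holds at
  pi / 3 but not at pi / 2.\<close>

definition span_pair :: "(label \<Rightarrow> 'a) \<Rightarrow> (label \<Rightarrow> 'a) \<Rightarrow> bool" where
  "span_pair y z \<longleftrightarrow> (\<forall>v\<in>L. \<exists>a b. br y (br z v) = scale a y + scale b z)"

text \<open>To arrive at a root \<gamma> other than \<alpha> and \<beta> one would have to start
  from the root \<gamma> - \<alpha> - \<beta>; but
  \<open>rinner (\<gamma> - \<alpha>) \<beta> = 1\<close> forces
  \<open>rinner \<gamma> \<beta> = 2\<close>, hence \<gamma> = \<beta>.\<close>

lemma span_pair_acute:
  assumes \<alpha>: "\<alpha> \<in> Phi" and \<beta>: "\<beta> \<in> Phi" and r: "rinner \<alpha> \<beta> = 1"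
  shows "span_pair (scale c (evec \<alpha>)) (scale d (evec \<beta>))"
  unfolding span_pair_def
proof
  fix v :: "label \<Rightarrow> 'a" assume v: "v \<in> L"
  define x where "x = br (evec \<beta>) v"
  define p where "p = br (evec \<alpha>) x (E \<alpha>)"
  define q where "q = br (evec \<alpha>) x (E \<beta>)"
  have ne: "\<alpha> \<noteq> \<beta>" "- \<alpha> \<noteq> \<beta>" using r \<alpha> by (auto simp: Phi_self rinner_minus)
  have "br (evec \<alpha>) x = scale p (evec \<alpha>) + scale q (evec \<beta>)"
  proof (rule lie_space_eqI)
    show "scale p (evec \<alpha>) + scale q (evec \<beta>) \<in> L"
      using \<alpha> \<beta> by (intro lie_space_add lie_space_scale) auto
  next
    fix \<gamma> assume \<gamma>: "\<gamma> \<in> Phi"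
    show "br (evec \<alpha>) x (E \<gamma>) = (scale p (evec \<alpha>) + scale q (evec \<beta>)) (E \<gamma>)"
    proof (cases "\<gamma> = \<alpha> \<or> \<gamma> = \<beta>")
      case True
      then show ?thesis using ne by (auto simp: p_def q_def scale_def)
    next
      case False
      have "x (E (\<gamma> - \<alpha>)) = 0" if *: "\<gamma> - \<alpha> \<in> Phi"
      proof -
        have "\<gamma> - \<alpha> \<noteq> \<beta>" using \<gamma> \<alpha> \<beta> r by (auto simp: diff_eq_eq add_Phi_iff rinner_commute[of \<beta> \<alpha>])
        moreover have "\<gamma> - \<alpha> - \<beta> \<notin> Phi"
          using * \<gamma> \<alpha> \<beta> r False rinner_eq_2_iff[OF \<gamma> \<beta>] by (auto simp: diff_Phi_iff rinner_diff)
        ultimately show ?thesis using * \<beta> by (simp add: x_def bracket_evec_E)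
      qed
      then show ?thesis using False \<gamma> \<alpha> by (simp add: bracket_evec_E scale_def)
    qed
  next
    fix i :: nat assume i: "i \<in> {1..4}"
    have "- \<alpha> - \<beta> \<notin> Phi" using \<alpha> \<beta> r by (simp add: diff_Phi_iff rinner_minus)
    then have "x (E (- \<alpha>)) = 0" using \<alpha> \<beta> ne by (simp add: x_def bracket_evec_E)
    then show "br (evec \<alpha>) x (H i) = (scale p (evec \<alpha>) + scale q (evec \<beta>)) (H i)"
      unfolding bracket_evec_H[OF \<alpha> i] by (simp add: scale_def)
  qed simp
  then have "br (scale c (evec \<alpha>)) (br (scale d (evec \<beta>)) v)
      = scale (d * p) (scale c (evec \<alpha>)) + scale (c * q) (scale d (evec \<beta>))"
    by (simp add: bracket_linear x_def) (simp add: scale_def fun_eq_iff algebra_simps)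
  then show "\<exists>a b. br (scale c (evec \<alpha>)) (br (scale d (evec \<beta>)) v)
      = scale a (scale c (evec \<alpha>)) + scale b (scale d (evec \<beta>))" by blast
qed

text \<open>For \<gamma> obtuse to both roots, the double bracket with e_\<gamma> is a nonzero
  multiple of e_{\<alpha> + \<beta> + \<gamma>}. This root has inner product 1 with \<alpha> and
  with \<beta>, so it is neither of them.\<close>

lemma not_span_pair_orthogonal:
  assumes \<alpha>: "\<alpha> \<in> Phi" and \<beta>: "\<beta> \<in> Phi" and r: "rinner \<alpha> \<beta> = 0" and cd: "c \<noteq> 0" "d \<noteq> 0"
  shows "\<not> span_pair (scale c (evec \<alpha>)) (scale d (evec \<beta>))"
proof
  assume s: "span_pair (scale c (evec \<alpha>)) (scale d (evec \<beta>))"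
  obtain \<gamma> where \<gamma>: "\<gamma> \<in> Phi" "rinner \<alpha> \<gamma> = - 1" "rinner \<beta> \<gamma> = - 1"
    using common_negative_root[OF \<alpha> \<beta> r] by blast
  have \<beta>\<gamma>: "\<beta> + \<gamma> \<in> Phi" "rinner \<alpha> (\<beta> + \<gamma>) = - 1"
    using \<beta> \<gamma> r by (simp_all add: add_Phi_iff rinner_add)
  define \<mu> where "\<mu> = \<alpha> + (\<beta> + \<gamma>)"
  have "\<mu> \<noteq> \<alpha>" "\<mu> \<noteq> \<beta>"
  proof -
    have "rinner \<alpha> \<mu> = 1" "rinner \<beta> \<mu> = 1"
      using \<alpha> \<beta> \<gamma> r by (simp_all add: \<mu>_def rinner_add Phi_self rinner_commute[of \<beta> \<alpha>])
    then show "\<mu> \<noteq> \<alpha>" "\<mu> \<noteq> \<beta>" using \<alpha> r by (auto simp: Phi_self)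
  qed
  moreover obtain a b where "br (scale c (evec \<alpha>)) (br (scale d (evec \<beta>)) (evec \<gamma>))
      = scale a (scale c (evec \<alpha>)) + scale b (scale d (evec \<beta>))"
    using s \<gamma>(1) unfolding span_pair_def by blast
  then have "scale (c * d * (of_int (N \<beta> \<gamma>) * of_int (N \<alpha> (\<beta> + \<gamma>)))) (evec \<mu>) (E \<mu>)
      = (scale (a * c) (evec \<alpha>) + scale (b * d) (evec \<beta>)) (E \<mu>)"
    using \<alpha> \<beta> \<gamma> \<beta>\<gamma> by (simp add: bracket_linear bracket_evec_evec \<mu>_def mult_ac)
  ultimately show False
    using cd N_nonzero[OF \<beta> \<gamma>(1,3)] N_nonzero[OF \<alpha> \<beta>\<gamma>] by (simp add: scale_def)
qed

text \<open>The four conditions on the right are invariant under automorphisms of the Lie algebra.\<close>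

lemma rinner_characterised:
  assumes \<alpha>: "\<alpha> \<in> Phi" and \<beta>: "\<beta> \<in> Phi" and cd: "c \<noteq> 0" "d \<noteq> 0"
    and y: "y = scale c (evec \<alpha>)" and z: "z = scale d (evec \<beta>)"
  shows "rinner \<alpha> \<beta> =
    (if br y (br y z) \<noteq> 0 then - 2 else if br y z \<noteq> 0 then - 1
     else if \<exists>k. z = scale k y then 2 else if span_pair y z then 1 else 0)"
proof -
  have 1: "br y (br y z) = 0 \<longleftrightarrow> rinner \<alpha> \<beta> \<noteq> - 2"
    using cd bracket_twice_eq_0_iff[OF \<alpha> \<beta>] by (simp add: y z bracket_linear scale_eq_0)
  have 2: "br y z = 0 \<longleftrightarrow> 0 \<le> rinner \<alpha> \<beta>"
    using cd bracket_evec_evec_eq_0_iff[OF \<alpha> \<beta>] by (simp add: y z bracket_linear scale_eq_0)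
  have 3: "(\<exists>k. z = scale k y) \<longleftrightarrow> rinner \<alpha> \<beta> = 2"
  proof
    assume "\<exists>k. z = scale k y"
    then obtain k where "z = scale k y" ..
    then have "z (E \<beta>) = scale k y (E \<beta>)" by simp
    then show "rinner \<alpha> \<beta> = 2"
      using cd \<alpha> \<beta> by (auto simp: y z scale_def rinner_eq_2_iff split: if_splits)
  next
    assume "rinner \<alpha> \<beta> = 2"
    then have "z = scale (d / c) y" using cd \<alpha> \<beta> by (simp add: y z rinner_eq_2_iff)
    then show "\<exists>k. z = scale k y" ..
  qed
  consider "rinner \<alpha> \<beta> = - 2" | "rinner \<alpha> \<beta> = - 1" | "rinner \<alpha> \<beta> = 0" | "rinner \<alpha> \<beta> = 1" | "rinner \<alpha> \<beta> = 2"
    using rinner_bounds[OF \<alpha> \<beta>] by linarith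
  then show ?thesis
    unfolding 1 2 3 using span_pair_acute[OF \<alpha> \<beta>, of c d] not_span_pair_orthogonal[OF \<alpha> \<beta> _ cd]
    by cases (simp_all add: y z)
qed

lemma span_pair_automorphism:
  assumes h: "h \<in> carrier (grp Phi)" and y: "y \<in> L" and z: "z \<in> L" and s: "span_pair y z"
  shows "span_pair (h y) (h z)"
  unfolding span_pair_def
proof
  fix v :: "label \<Rightarrow> 'a" assume v: "v \<in> L"
  obtain k where k: "k \<in> carrier (grp Phi)" "h (k v) = v"
    using grp_inverse[OF subset_refl h] v by metis
  have kv: "k v \<in> L" using k(1) v by (rule chev_closed)
  obtain a b where ab: "br y (br z (k v)) = scale a y + scale b z"
    using s kv unfolding span_pair_def by blast
  have "br (h y) (br (h z) (h (k v))) = h (br y (br z (k v)))"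
    by (simp only: chev_automorphism(3)[OF h] y z kv bracket_in_lie_space)
  also have "\<dots> = h (scale a y) + h (scale b z)"
    unfolding ab by (rule chev_automorphism(1)[OF h]) (use y z in \<open>auto intro: lie_space_scale\<close>)
  also have "\<dots> = scale a (h y) + scale b (h z)"
    by (simp only: chev_automorphism(2)[OF h y y] chev_automorphism(2)[OF h z z])
  finally show "\<exists>a b. br (h y) (br (h z) v) = scale a (h y) + scale b (h z)"
    using k(2) by auto
qed

lemma automorphism_invariants:
  assumes h: "h \<in> carrier (grp Phi)" and y: "y \<in> L" and z: "z \<in> L"
  shows "br (h y) (br (h y) (h z)) = 0 \<longleftrightarrow> br y (br y z) = 0"
    and "br (h y) (h z) = 0 \<longleftrightarrow> br y z = 0"
    and "(\<exists>k. h z = scale k (h y)) \<longleftrightarrow> (\<exists>k. z = scale k y)"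
    and "span_pair (h y) (h z) \<longleftrightarrow> span_pair y z"
proof -
  obtain k where k: "k \<in> carrier (grp Phi)" and kh: "\<And>v. v \<in> L \<Longrightarrow> k (h v) = v"
    using grp_inverse[OF subset_refl h] by metis
  have inj: "v = w" if "v \<in> L" "w \<in> L" "h v = h w" for v w using kh that by metis
  have e: "br (h y) (h v) = h (br y v)" if "v \<in> L" for v
    using chev_automorphism(3)[OF h y that] by simp
  have z0: "h v = 0 \<longleftrightarrow> v = 0" if "v \<in> L" for v
    using inj[OF that lie_space_0] chev_0[OF h] by auto
  show "br (h y) (br (h y) (h z)) = 0 \<longleftrightarrow> br y (br y z) = 0"
    by (simp only: e z bracket_in_lie_space z0)
  show "br (h y) (h z) = 0 \<longleftrightarrow> br y z = 0"
    by (simp only: e z bracket_in_lie_space z0)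
  have "h z = scale m (h y) \<longleftrightarrow> z = scale m y" for m
    using inj[OF z lie_space_scale[OF y]] unfolding chev_automorphism(2)[OF h y y, symmetric] by blast
  then show "(\<exists>k. h z = scale k (h y)) \<longleftrightarrow> (\<exists>k. z = scale k y)" by simp
  have hL: "h y \<in> L" "h z \<in> L" using h y z chev_closed by auto
  show "span_pair (h y) (h z) \<longleftrightarrow> span_pair y z"
    using span_pair_automorphism[OF h y z] span_pair_automorphism[OF k hL] by (auto simp: kh y z)
qed

text \<open>The case distinction of \<open>rinner_characterised\<close> speaks of y and z only and
  is unchanged by g, so every group element that exhibits an angle yields the same inner product
  R.\<close>

lemma has_angle_unique:
  fixes y z :: "label \<Rightarrow> 'a"
  assumes "has_angle N y z \<phi>" "has_angle N y z \<psi>" shows "\<phi> = \<psi>"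
proof -
  have L: "y \<in> L" "z \<in> L" using assms(1) root_elements_in unfolding has_angle_def by auto
  define R :: int where "R = (if br y (br y z) \<noteq> 0 then - 2 else if br y z \<noteq> 0 then - 1
     else if \<exists>k. z = scale k y then 2 else if span_pair y z then 1 else 0)"
  have "\<phi> = arccos (real_of_int R / 2)" if ang: "has_angle N y z \<phi>" for \<phi>
  proof -
    obtain g \<alpha> \<beta> c d where *: "g \<in> carrier (grp Phi)" "\<alpha> \<in> Phi" "\<beta> \<in> Phi" "c \<noteq> 0" "d \<noteq> 0"
      "g y = scale c (evec \<alpha>)" "g z = scale d (evec \<beta>)" "root_angle \<alpha> \<beta> = \<phi>"
      using ang unfolding has_angle_def chev_group_eq by blast
    have "rinner \<alpha> \<beta> = R"
      unfolding R_def rinner_characterised[OF *(2-7)] automorphism_invariants[OF *(1) L] ..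
    then show ?thesis using *(2,3,8) by (simp add: root_angle_eq)
  qed
  then show ?thesis using assms by blast
qed

section \<open>Construction of lifts and their angle to e_\<delta>\<close>

lemma X_lowering:
  assumes \<gamma>: "\<gamma> \<in> Phi1" and v: "v \<in> L" "v (E \<gamma>) = 0"
  shows "\<mu> \<in> Phi1 \<Longrightarrow> X (- \<gamma>) a v (E \<mu>)
      = v (E \<mu>) + (if \<mu> = \<delta> - \<gamma> then a * of_int (N (- \<gamma>) \<delta>) * v (E \<delta>) else 0)"
    and "X (- \<gamma>) a v (E \<delta>) = v (E \<delta>)"
    and "i \<in> {1..4} \<Longrightarrow> X (- \<gamma>) a v (H i) = v (H i)"
proof -
  have \<gamma>': "\<gamma> \<in> Phi" "- \<gamma> \<in> Phi" "rinner \<gamma> \<delta> = 1" using \<gamma> by (auto simp: Phi1_iff)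
  \<comment> \<open>The quadratic term is a multiple of the coordinate at \<gamma>, which vanishes
    by assumption.\<close>
  have X: "X (- \<gamma>) a v = v + scale a (br (evec (- \<gamma>)) v)"
    using \<gamma>' v by (simp add: X_eq)
  show "X (- \<gamma>) a v (E \<mu>) = v (E \<mu>) + (if \<mu> = \<delta> - \<gamma> then a * of_int (N (- \<gamma>) \<delta>) * v (E \<delta>) else 0)"
    if \<mu>: "\<mu> \<in> Phi1"
  proof -
    have \<mu>': "\<mu> \<in> Phi" "rinner \<mu> \<delta> = 1" using \<mu> by (auto simp: Phi1_iff)
    have "\<mu> + \<gamma> \<in> Phi \<longleftrightarrow> \<mu> = \<delta> - \<gamma>"
    proof
      assume "\<mu> + \<gamma> \<in> Phi"
      then show "\<mu> = \<delta> - \<gamma>" using root_degree_2[of "\<mu> + \<gamma>"] \<gamma>' \<mu>' by (simp add: rinner_add algebra_simps)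
    qed simp
    moreover have "\<mu> \<noteq> - \<gamma>" using \<gamma>' \<mu>' by (auto simp: rinner_minus)
    ultimately show ?thesis using \<mu>' \<gamma>' unfolding X by (auto simp: bracket_evec_E scale_def)
  qed
  have "\<delta> + \<gamma> \<notin> Phi" using \<gamma>' by (simp add: add_Phi_iff rinner_commute[of \<delta> \<gamma>])
  moreover have "\<delta> \<noteq> - \<gamma>"
    using rinner_minus(1)[of \<gamma> \<delta>] \<gamma>'(3) Phi_self[OF delta_Phi] by auto
  ultimately show "X (- \<gamma>) a v (E \<delta>) = v (E \<delta>)" using \<gamma>' unfolding X by (simp add: bracket_evec_E scale_def)
  show "X (- \<gamma>) a v (H i) = v (H i)" if "i \<in> {1..4}"
    unfolding X using \<gamma>' v by (simp add: scale_def bracket_evec_H[OF \<gamma>'(2) that] del: One_nat_def)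
qed

text \<open>The last condition is what allows commuting root elements to be undone one after another.\<close>

definition movable :: "rt \<Rightarrow> (label \<Rightarrow> 'a) \<Rightarrow> rt set \<Rightarrow> bool" where
  "movable \<beta> y C \<longleftrightarrow> (\<exists>g\<in>carrier (grp Phi). g (evec \<delta>) = evec \<delta> \<and> (\<exists>d. d \<noteq> 0 \<and> g y = scale d (evec \<beta>)) \<and>
     (\<forall>\<gamma>\<in>C. \<forall>a. \<forall>v\<in>L. g (X (- \<gamma>) a v) = X (- \<gamma>) a (g v)))"

lemma movable_delta: "C \<subseteq> Phi \<Longrightarrow> movable \<delta> (evec \<delta>) C"
  unfolding movable_def
  by (rule bexI[OF _ grp_one[OF subset_refl]]) (auto intro!: exI[of _ 1] simp: subset_iff)

text \<open>g is moved past the lowering by the commutation in \<open>movable\<close>, and the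
  lowering is then undone by the \<open>X \<gamma> c\<close> of \<open>X_flip\<close>. The latter
  fixes e_\<delta>, because \<gamma> has degree 1, and commutes with the remaining lowerings,
  because their roots are orthogonal to \<gamma>.\<close>

lemma movable_step:
  assumes m: "movable \<beta> y (insert \<gamma> C)" and y: "y \<in> L" and \<beta>: "\<beta> \<in> Phi" and \<gamma>: "\<gamma> \<in> Phi" "rinner \<gamma> \<delta> = 1"
    and r: "rinner \<gamma> \<beta> = 1" and C: "\<And>\<gamma>'. \<gamma>' \<in> C \<Longrightarrow> \<gamma>' \<in> Phi \<and> rinner \<gamma> \<gamma>' = 0"
  shows "movable (if a = 0 then \<beta> else \<beta> - \<gamma>) (X (- \<gamma>) a y) C"
proof -
  obtain g d where g: "g \<in> carrier (grp Phi)" "g (evec \<delta>) = evec \<delta>" "d \<noteq> 0" "g y = scale d (evec \<beta>)"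
    and gC: "\<And>\<gamma>' a v. \<gamma>' \<in> insert \<gamma> C \<Longrightarrow> v \<in> L \<Longrightarrow> g (X (- \<gamma>') a v) = X (- \<gamma>') a (g v)"
    using m unfolding movable_def by blast
  obtain c d' where d': "d' \<noteq> 0" and flip: "X \<gamma> c (X (- \<gamma>) a (evec \<beta>)) = scale d' (evec (if a = 0 then \<beta> else \<beta> - \<gamma>))"
    using X_flip[OF \<gamma>(1) \<beta> r] by blast
  define k where "k = compose L (X \<gamma> c) g"
  have k: "k \<in> carrier (grp Phi)" unfolding k_def using \<gamma> g by (intro grp_mult grp_X) auto
  have kv: "k v = X \<gamma> c (g v)" if "v \<in> L" for v using that by (simp add: k_def compose_def)
  have "k (evec \<delta>) = evec \<delta>" using \<gamma> g by (simp add: kv X_evec_fixed)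
  moreover have "k (X (- \<gamma>) a y) = scale (d * d') (evec (if a = 0 then \<beta> else \<beta> - \<gamma>))"
  proof -
    have "k (X (- \<gamma>) a y) = X \<gamma> c (X (- \<gamma>) a (scale d (evec \<beta>)))"
      using \<gamma> y gC g by (simp add: kv)
    also have "\<dots> = scale d (X \<gamma> c (X (- \<gamma>) a (evec \<beta>)))"
      using \<gamma> \<beta> by (simp add: X_scale)
    finally show ?thesis by (simp only: flip scale_simps)
  qed
  moreover have "k (X (- \<gamma>') b v) = X (- \<gamma>') b (k v)" if "\<gamma>' \<in> C" "v \<in> L" for \<gamma>' b v
  proof -
    have "g v \<in> L" using g(1) that(2) by (rule chev_closed)
    then show ?thesis using that \<gamma> C[OF that(1)] gC X_commute[of \<gamma> "- \<gamma>'" "g v" c b]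
      by (simp add: kv rinner_minus)
  qed
  ultimately show ?thesis unfolding movable_def using k g(3) d'
    by (intro bexI[OF _ k] conjI exI[of _ "d * d'"]) auto
qed

lemma roots_Phi1: "r_lambda \<in> Phi1" "r_rho \<in> Phi1" "r_sigma \<in> Phi1" "r_tau \<in> Phi1"
  by (simp_all add: Phi1_eq r_lambda_def r_rho_def r_sigma_def r_tau_def)

lemma X_root_element:
  assumes "\<alpha> \<in> Phi" "y \<in> root_elements N" shows "X \<alpha> a y \<in> root_elements N"
proof -
  obtain g \<beta> where g: "g \<in> carrier (grp Phi)" "\<beta> \<in> Phi" "y = g (evec \<beta>)"
    using assms(2) unfolding root_elements_eq by blast
  then have "X \<alpha> a y = compose L (X \<alpha> a) g (evec \<beta>)" by (simp add: compose_def)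
  moreover have "compose L (X \<alpha> a) g \<in> carrier (grp Phi)" using assms(1) g by (intro grp_mult grp_X) auto
  ultimately show ?thesis unfolding root_elements_eq using g(2) by blast
qed

lemma evec_root_element: "\<alpha> \<in> Phi \<Longrightarrow> (evec \<alpha> :: label \<Rightarrow> 'a) \<in> root_elements N"
  unfolding root_elements_eq
  by (rule CollectI, rule exI[of _ "\<lambda>v\<in>L. v"], rule exI[of _ \<alpha>]) (simp add: grp_one[OF subset_refl])

lemma lifts_iff:
  "lifts N x y \<longleftrightarrow> y \<in> root_elements N \<and> (\<forall>\<alpha>\<in>Phi1. y (E \<alpha>) = x (E \<alpha>)) \<and> y (E \<delta>) = 1 \<and> y (H 3) = 0"
proof -
  have "simple_root i \<notin> Phi0 \<longleftrightarrow> i = 3" if "i \<in> {1..4}" for i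
    using that rinner_simple_delta[OF that] by (auto simp: Phi0_def Phi_def simple_root_def)
  then have "(\<forall>i\<in>{1..4}. simple_root i \<notin> Phi0 \<longrightarrow> y (H i) = 0) \<longleftrightarrow> (\<forall>i\<in>{1..4}. i = 3 \<longrightarrow> y (H i) = 0)"
    by blast
  then show ?thesis unfolding lifts_def by simp
qed

lemma the_lift_eq:
  fixes x :: "label \<Rightarrow> 'a"
  assumes "lifts N x y" shows "the_lift N x = y"
  unfolding the_lift_def
proof (rule the_equality)
  show "lifts N x y" by (rule assms)
next
  fix y' assume "lifts N x y'"
  then show "y' = y" using assms lift_unique[of y' y] by (simp add: lifts_iff)
qed

lemma lift_normal_form:
  obtains y \<beta> where "lifts N (on_roots l r s t :: label \<Rightarrow> 'a) y" "movable \<beta> y {}" "\<beta> \<in> Phi"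
    "rinner \<beta> \<delta> = 2 - (of_bool (l \<noteq> 0) + of_bool (r \<noteq> 0) + of_bool (s \<noteq> 0) + of_bool (t \<noteq> 0))"
proof -
  \<comment> \<open>The complements of the four roots to \<delta>: lowering e_\<delta> by them
    produces the coordinates at \<open>r_lambda\<close>, \<open>r_rho\<close>,
    \<open>r_sigma\<close> and \<open>r_tau\<close>.\<close>
  define gl where "gl = ((1,1,1,1) :: rt)"
  define gr where "gr = ((1,0,1,0) :: rt)"
  define gs where "gs = ((0,1,1,0) :: rt)"
  define gt where "gt = ((0,0,1,1) :: rt)"
  note g_defs = gl_def gr_def gs_def gt_def
  note r_defs = r_lambda_def r_rho_def r_sigma_def r_tau_def
  have g1: "gl \<in> Phi1" "gr \<in> Phi1" "gs \<in> Phi1" "gt \<in> Phi1"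
    by (simp_all add: g_defs Phi1_eq)
  then have gP: "gl \<in> Phi" "gr \<in> Phi" "gs \<in> Phi" "gt \<in> Phi"
    and gd: "rinner gl \<delta> = 1" "rinner gr \<delta> = 1" "rinner gs \<delta> = 1" "rinner gt \<delta> = 1"
    by (simp_all add: Phi1_iff)
  have dg: "\<delta> - gl = r_lambda" "\<delta> - gr = r_rho" "\<delta> - gs = r_sigma" "\<delta> - gt = r_tau"
    by (simp_all add: g_defs r_defs \<delta>_def)
  \<comment> \<open>This sign squares to 1, so multiplying a parameter by it makes the new
    coordinate exactly that parameter.\<close>
  define n where "n \<gamma> = (of_int (N (- \<gamma>) \<delta>) :: 'a)" for \<gamma>
  have nn: "n \<gamma> * n \<gamma> = 1" if "\<gamma> \<in> Phi1" for \<gamma>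
    unfolding n_def using that by (intro N_squared) (auto simp: Phi1_iff rinner_minus)
  have n0: "n \<gamma> \<noteq> 0" if "\<gamma> \<in> Phi1" for \<gamma> using nn[OF that] by auto
  define y1 where "y1 = X (- gt) (t * n gt) (evec \<delta>)"
  define y2 where "y2 = X (- gs) (s * n gs) y1"
  define y3 where "y3 = X (- gr) (r * n gr) y2"
  define y4 where "y4 = X (- gl) (l * n gl) y3"
  have L: "y1 \<in> L" "y2 \<in> L" "y3 \<in> L" "y4 \<in> L"
    using gP by (auto simp: y1_def y2_def y3_def y4_def)
  have e1: "\<mu> \<noteq> \<delta>" if "\<mu> \<in> Phi1" for \<mu>
    using that by (auto simp: Phi1_iff Phi_self)
  have z0: "evec \<delta> (E gt) = (0::'a)" using e1[OF g1(4)] by simp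
  have c1: "y1 (E \<mu>) = (if \<mu> = r_tau then t else 0)" if "\<mu> \<in> Phi1" for \<mu>
    using e1[OF that] e1[OF roots_Phi1(4)] nn[OF g1(4)] unfolding y1_def
    by (simp add: X_lowering(1)[where v = "evec \<delta>", OF g1(4) lie_space_evec[OF delta_Phi] z0 that] dg n_def[symmetric] mult.assoc)
  have z1: "y1 (E gs) = 0" using c1[OF g1(3)] by (simp add: g_defs r_defs)
  have d1: "y1 (E \<delta>) = 1" unfolding y1_def by (simp add: X_lowering(2)[where v = "evec \<delta>", OF g1(4) lie_space_evec[OF delta_Phi] z0])
  have c2: "y2 (E \<mu>) = (if \<mu> = r_tau then t else 0) + (if \<mu> = r_sigma then s else 0)" if "\<mu> \<in> Phi1" for \<mu>
    using that nn[OF g1(3)] unfolding y2_def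
    by (simp add: X_lowering(1)[where v = y1, OF g1(3) L(1) z1 that] c1 d1 dg n_def[symmetric] mult.assoc)
  have z2: "y2 (E gr) = 0" using c2[OF g1(2)] by (simp add: g_defs r_defs)
  have d2: "y2 (E \<delta>) = 1" unfolding y2_def by (simp add: X_lowering(2)[where v = y1, OF g1(3) L(1) z1] d1)
  have c3: "y3 (E \<mu>) = (if \<mu> = r_tau then t else 0) + (if \<mu> = r_sigma then s else 0)
      + (if \<mu> = r_rho then r else 0)" if "\<mu> \<in> Phi1" for \<mu>
    using that nn[OF g1(2)] unfolding y3_def
    by (simp add: X_lowering(1)[where v = y2, OF g1(2) L(2) z2 that] c2 d2 dg n_def[symmetric] mult.assoc)
  have z3: "y3 (E gl) = 0" using c3[OF g1(1)] by (simp add: g_defs r_defs)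
  have d3: "y3 (E \<delta>) = 1" unfolding y3_def by (simp add: X_lowering(2)[where v = y2, OF g1(2) L(2) z2] d2)
  have c4: "y4 (E \<mu>) = (if \<mu> = r_tau then t else 0) + (if \<mu> = r_sigma then s else 0)
      + (if \<mu> = r_rho then r else 0) + (if \<mu> = r_lambda then l else 0)" if "\<mu> \<in> Phi1" for \<mu>
    using that nn[OF g1(1)] unfolding y4_def
    by (simp add: X_lowering(1)[where v = y3, OF g1(1) L(3) z3 that] c3 d3 dg n_def[symmetric] mult.assoc)
  have d4: "y4 (E \<delta>) = 1" unfolding y4_def by (simp add: X_lowering(2)[where v = y3, OF g1(1) L(3) z3] d3)
  have three: "3 \<in> {1..4::nat}" by simp
  have h4: "y4 (H 3) = 0"
    unfolding y4_def X_lowering(3)[where v = y3, OF g1(1) L(3) z3 three]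
    unfolding y3_def X_lowering(3)[where v = y2, OF g1(2) L(2) z2 three]
    unfolding y2_def X_lowering(3)[where v = y1, OF g1(3) L(1) z1 three]
    unfolding y1_def X_lowering(3)[where v = "evec \<delta>", OF g1(4) lie_space_evec[OF delta_Phi] z0 three] by simp
  have "y4 \<in> root_elements N"
    unfolding y4_def y3_def y2_def y1_def
    using gP by (intro X_root_element evec_root_element) auto
  then have lift: "lifts N (on_roots l r s t) y4"
    unfolding lifts_iff using d4 h4 by (auto simp: c4 on_roots_def)
  define b1 where "b1 = (if t * n gt = 0 then \<delta> else \<delta> - gt)"
  define b2 where "b2 = (if s * n gs = 0 then b1 else b1 - gs)"
  define b3 where "b3 = (if r * n gr = 0 then b2 else b2 - gr)"
  define b4 where "b4 = (if l * n gl = 0 then b3 else b3 - gl)"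
  note simps = b1_def b2_def b3_def b4_def g_defs \<delta>_def Phi_def zero_prod_def
  have bP: "b1 \<in> Phi" "b2 \<in> Phi" "b3 \<in> Phi" "b4 \<in> Phi" by (simp_all add: simps)
  have "movable \<delta> (evec \<delta>) {gt, gs, gr, gl}" using gP by (intro movable_delta) auto
  then have "movable b1 y1 {gs, gr, gl}"
    unfolding b1_def y1_def using gP gd by (intro movable_step) (auto simp: g_defs)
  then have "movable b2 y2 {gr, gl}"
    unfolding b2_def y2_def using gP gd bP L by (intro movable_step) (auto simp: simps)
  then have "movable b3 y3 {gl}"
    unfolding b3_def y3_def using gP gd bP L by (intro movable_step) (auto simp: simps)
  then have "movable b4 y4 {}"
    unfolding b4_def y4_def using gP gd bP L by (intro movable_step) (auto simp: simps)
  \<comment> \<open>Each nonzero coefficient subtracts one root of degree 1, starting from \<delta>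
    in degree 2.\<close>
  moreover have "rinner b4 \<delta> = 2 - (of_bool (l \<noteq> 0) + of_bool (r \<noteq> 0) + of_bool (s \<noteq> 0) + of_bool (t \<noteq> 0))"
    using n0 g1 by (simp add: b1_def b2_def b3_def b4_def rinner_diff gd Phi_self)
  ultimately show ?thesis using that[OF lift] bP(4) by blast
qed

lemma has_angle_normal_form:
  fixes l r s t :: 'a
  defines "m \<equiv> 2 - (of_bool (l \<noteq> 0) + of_bool (r \<noteq> 0) + of_bool (s \<noteq> 0) + of_bool (t \<noteq> 0)) :: int"
  shows "has_angle N (the_lift N (on_roots l r s t)) (evec \<delta>) \<phi> \<longleftrightarrow> \<phi> = arccos (real_of_int m / 2)"
proof -
  obtain y \<beta> where y: "lifts N (on_roots l r s t) y" "movable \<beta> y {}" "\<beta> \<in> Phi" "rinner \<beta> \<delta> = m"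
    using lift_normal_form unfolding m_def by blast
  obtain g d where g: "g \<in> carrier (grp Phi)" "g (evec \<delta>) = evec \<delta>" "d \<noteq> 0" "g y = scale d (evec \<beta>)"
    using y(2) unfolding movable_def by blast
  have "has_angle N y (evec \<delta>) (arccos (real_of_int m / 2))"
    unfolding has_angle_def chev_group_eq
  proof (intro conjI)
    show "y \<in> root_elements N" using y(1) by (simp add: lifts_iff)
    show "(evec \<delta> :: label \<Rightarrow> 'a) \<in> root_elements N" by (simp add: evec_root_element)
    show "\<exists>g\<in>carrier (grp Phi). \<exists>\<alpha>\<in>Phi. \<exists>\<beta>\<in>Phi. \<exists>c d. c \<noteq> 0 \<and> d \<noteq> 0 \<and> g y = scale c (evec \<alpha>) \<and>
        g (evec \<delta>) = scale d (evec \<beta>) \<and> root_angle \<alpha> \<beta> = arccos (real_of_int m / 2)"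
      by (rule bexI[OF _ g(1)], rule bexI[OF _ y(3)], rule bexI[OF _ delta_Phi], rule exI[of _ d], rule exI[of _ 1])
        (use g y in \<open>simp add: root_angle_eq\<close>)
  qed
  then show ?thesis using the_lift_eq[OF y(1)] has_angle_unique by blast
qed

end

section \<open>The action on cubes\<close>

locale chevalley_D4_positive = chevalley_D4_field N K
  for N :: "rt \<Rightarrow> rt \<Rightarrow> int" and K :: "'a::field itself" +
  assumes positive: "positive_constants N"
begin

section \<open>Signs of the structure constants under positivity\<close>

lemma set_1_4: "{1..4} = {1,2,3,4::nat}" by auto

lemma N_simple:
  assumes "i \<in> {1,2,3,4}" "\<beta> \<in> Phi_pos" "simple_root i + \<beta> \<in> Phi_pos"
    and "\<forall>j\<in>{1,2,3,4}. j < i \<longrightarrow> simple_root i + \<beta> - simple_root j \<notin> Phi"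
  shows "N (simple_root i) \<beta> = 1"
  using positive assms unfolding positive_constants_def set_1_4 by blast

lemma N_first:
  "N (1,0,0,0) (0,0,1,0) = 1" "N (1,0,0,0) (0,0,1,1) = 1" "N (1,0,0,0) (0,1,1,0) = 1" "N (1,0,0,0) (0,1,1,1) = 1"
  using N_simple[of 1 "(0,0,1,0)"] N_simple[of 1 "(0,0,1,1)"] N_simple[of 1 "(0,1,1,0)"] N_simple[of 1 "(0,1,1,1)"]
  by (simp_all add: Phi_pos_def Phi_def simple_root_def set_1_4 del: One_nat_def)

text \<open>For the last two, \<alpha>_1 is the smallest root that can be subtracted from the sum,
  so positivity speaks of \<open>N (1,0,0,0)\<close> instead; \<open>N_exchange\<close> carries the
  sign over.\<close>

lemma N_second:
  "N (0,1,0,0) (0,0,1,0) = 1" "N (0,1,0,0) (0,0,1,1) = 1" "N (0,1,0,0) (1,0,1,0) = 1" "N (0,1,0,0) (1,0,1,1) = 1"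
proof -
  show 1: "N (0,1,0,0) (0,0,1,0) = 1" "N (0,1,0,0) (0,0,1,1) = 1"
    using N_simple[of 2 "(0,0,1,0)"] N_simple[of 2 "(0,0,1,1)"]
    by (simp_all add: Phi_pos_def Phi_def simple_root_def set_1_4 del: One_nat_def)
  show "N (0,1,0,0) (1,0,1,0) = 1"
    using N_exchange[of "(1,0,0,0)" "(0,1,0,0)" "(0,0,1,0)"] 1 N_first by (simp add: Phi_def)
  show "N (0,1,0,0) (1,0,1,1) = 1"
    using N_exchange[of "(1,0,0,0)" "(0,1,0,0)" "(0,0,1,1)"] 1 N_first by (simp add: Phi_def)
qed

text \<open>Positivity makes the signs of the first two factors \<open>1\<close>, but \<open>\<alpha>\<^sub>3\<close> precedes \<open>\<alpha>\<^sub>4\<close> in the numbering, so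
  it says nothing here; that the sign is constant suffices.\<close>

definition sg :: int where "sg = N (0,0,0,1) (0,0,1,0)"

lemma sg_cases: "sg = 1 \<or> sg = - 1"
  unfolding sg_def by (rule N_cases) (simp_all add: Phi_def)

lemma N_fourth:
  "N (0,0,0,1) (0,0,1,0) = sg" "N (0,0,0,1) (0,1,1,0) = sg" "N (0,0,0,1) (1,0,1,0) = sg" "N (0,0,0,1) (1,1,1,0) = sg"
proof -
  show 1: "N (0,0,0,1) (0,0,1,0) = sg" by (simp add: sg_def)
  show "N (0,0,0,1) (1,0,1,0) = sg"
    using N_exchange[of "(1,0,0,0)" "(0,0,0,1)" "(0,0,1,0)"] 1 N_first by (simp add: Phi_def)
  show 2: "N (0,0,0,1) (0,1,1,0) = sg"
    using N_exchange[of "(0,1,0,0)" "(0,0,0,1)" "(0,0,1,0)"] 1 N_second by (simp add: Phi_def)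
  show "N (0,0,0,1) (1,1,1,0) = sg"
    using N_exchange[of "(1,0,0,0)" "(0,0,0,1)" "(0,1,1,0)"] 2 N_first by (simp add: Phi_def)
qed

lemma N_opposite':
  assumes "\<alpha> \<in> Phi" "\<beta> \<in> Phi" "rinner \<alpha> \<beta> = - 1" shows "N (- \<alpha>) (\<alpha> + \<beta>) = N \<alpha> \<beta>"
  using N_opposite[OF assms] N_cases[of \<alpha> \<beta>] assms by (auto simp: add_Phi_iff)

lemma N_first_opposite:
  "N (-1,0,0,0) (1,0,1,0) = 1" "N (-1,0,0,0) (1,0,1,1) = 1" "N (-1,0,0,0) (1,1,1,0) = 1" "N (-1,0,0,0) (1,1,1,1) = 1"
  using N_opposite'[of "(1,0,0,0)" "(0,0,1,0)"] N_opposite'[of "(1,0,0,0)" "(0,0,1,1)"]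
    N_opposite'[of "(1,0,0,0)" "(0,1,1,0)"] N_opposite'[of "(1,0,0,0)" "(0,1,1,1)"]
  by (simp_all add: Phi_def N_first)

lemma N_second_opposite:
  "N (0,-1,0,0) (0,1,1,0) = 1" "N (0,-1,0,0) (0,1,1,1) = 1" "N (0,-1,0,0) (1,1,1,0) = 1" "N (0,-1,0,0) (1,1,1,1) = 1"
  using N_opposite'[of "(0,1,0,0)" "(0,0,1,0)"] N_opposite'[of "(0,1,0,0)" "(0,0,1,1)"]
    N_opposite'[of "(0,1,0,0)" "(1,0,1,0)"] N_opposite'[of "(0,1,0,0)" "(1,0,1,1)"]
  by (simp_all add: Phi_def N_second)

lemma N_fourth_opposite:
  "N (0,0,0,-1) (0,0,1,1) = sg" "N (0,0,0,-1) (0,1,1,1) = sg" "N (0,0,0,-1) (1,0,1,1) = sg" "N (0,0,0,-1) (1,1,1,1) = sg"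
  using N_opposite'[of "(0,0,0,1)" "(0,0,1,0)"] N_opposite'[of "(0,0,0,1)" "(0,1,1,0)"]
    N_opposite'[of "(0,0,0,1)" "(1,0,1,0)"] N_opposite'[of "(0,0,0,1)" "(1,1,1,0)"]
  by (simp_all add: Phi_def N_fourth)

section \<open>The space V_1 in coordinates\<close>

abbreviation W :: "(label \<Rightarrow> 'a) set" where "W \<equiv> V1"

lemma W_subset: "W \<subseteq> L"
  unfolding V1_def lie_space_def basis_def using Phi1_iff by blast

lemma W_outside: "x \<in> W \<Longrightarrow> \<gamma> \<notin> Phi1 \<Longrightarrow> x (E \<gamma>) = 0" and W_H: "x \<in> W \<Longrightarrow> x (H i) = 0"
  by (auto simp: V1_def)

lemma W_eqI:
  assumes "x \<in> W" "y \<in> W" and eq: "\<And>\<gamma>. \<gamma> \<in> Phi1 \<Longrightarrow> x (E \<gamma>) = y (E \<gamma>)"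
  shows "x = y"
proof
  fix k show "x k = y k"
  proof (cases "k \<in> E ` Phi1")
    case True
    then obtain \<gamma> where "\<gamma> \<in> Phi1" "k = E \<gamma>" by (rule imageE)
    then show ?thesis using eq by simp
  next
    case False
    then show ?thesis using assms(1,2) by (simp add: V1_def)
  qed
qed

lemma Phi0_iff: "\<alpha> \<in> Phi0 \<longleftrightarrow> \<alpha> \<in> Phi \<and> rinner \<alpha> \<delta> = 0"
  by (simp add: Phi0_def)

lemma X_degree_zero:
  assumes \<alpha>: "\<alpha> \<in> Phi0" and v: "v \<in> L"
  shows "\<gamma> \<in> Phi1 \<Longrightarrow> X \<alpha> a v (E \<gamma>)
      = v (E \<gamma>) + (if \<gamma> - \<alpha> \<in> Phi1 then a * of_int (N \<alpha> (\<gamma> - \<alpha>)) * v (E (\<gamma> - \<alpha>)) else 0)"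
    and "X \<alpha> a v (E \<delta>) = v (E \<delta>)"
    and "X \<alpha> a v (H 3) = v (H 3)"
proof -
  have \<alpha>': "\<alpha> \<in> Phi" "rinner \<alpha> \<delta> = 0" using \<alpha> by (auto simp: Phi0_iff)
  show "X \<alpha> a v (E \<gamma>)
      = v (E \<gamma>) + (if \<gamma> - \<alpha> \<in> Phi1 then a * of_int (N \<alpha> (\<gamma> - \<alpha>)) * v (E (\<gamma> - \<alpha>)) else 0)"
    if \<gamma>: "\<gamma> \<in> Phi1"
  proof -
    have "\<gamma> \<in> Phi" "\<gamma> \<noteq> \<alpha>" "\<gamma> - \<alpha> \<in> Phi1 \<longleftrightarrow> \<gamma> - \<alpha> \<in> Phi"
      using \<gamma> \<alpha>' by (auto simp: Phi1_iff rinner_diff)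
    then show ?thesis using \<alpha>' v by (simp add: X_eq bracket_evec_E scale_def)
  qed
  have "\<delta> - \<alpha> \<notin> Phi" using \<alpha>' by (simp add: diff_Phi_iff rinner_commute[of \<delta> \<alpha>])
  moreover have "\<delta> \<noteq> \<alpha>" using \<alpha>' by (auto simp: Phi_self)
  ultimately show "X \<alpha> a v (E \<delta>) = v (E \<delta>)"
    using \<alpha>' v by (simp add: X_eq bracket_evec_E scale_def)
  have "rcoeff \<alpha> 3 = 0" using \<alpha> by (auto simp: Phi0_eq)
  then show "X \<alpha> a v (H 3) = v (H 3)"
    using \<alpha>' v bracket_evec_H[OF \<alpha>'(1), of 3 N v] by (simp add: X_eq scale_def)
qed

lemma X_in_W:
  assumes \<alpha>: "\<alpha> \<in> Phi0" and v: "v \<in> W" shows "X \<alpha> a v \<in> W"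
proof -
  have \<alpha>': "\<alpha> \<in> Phi" "rinner \<alpha> \<delta> = 0" using \<alpha> by (auto simp: Phi0_iff)
  have vL: "v \<in> L" using v W_subset by blast
  have no: "- \<alpha> \<notin> Phi1" using \<alpha>' by (simp add: Phi1_iff rinner_minus)
  have X: "X \<alpha> a v = v + scale a (br (evec \<alpha>) v)"
    using \<alpha>' vL W_outside[OF v no] by (simp add: X_eq)
  show ?thesis unfolding V1_def
  proof (intro CollectI allI impI)
    fix k assume k: "k \<notin> E ` Phi1"
    show "X \<alpha> a v k = 0"
    proof (cases "k \<in> basis")
      case False
      then show ?thesis using X_in[OF \<alpha>'(1) vL] by (simp add: lie_space_def)
    next
      case True
      then consider \<gamma> where "k = E \<gamma>" "\<gamma> \<in> Phi" "\<gamma> \<notin> Phi1" | i where "k = H i" "i \<in> {1..4}"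
        using k unfolding basis_def by blast
      then show ?thesis
      proof cases
        case (1 \<gamma>)
        then have "\<gamma> - \<alpha> \<notin> Phi1" using \<alpha>' by (auto simp: Phi1_iff rinner_diff)
        then show ?thesis using 1 \<alpha>' v W_outside[OF v] W_H[OF v]
          unfolding X by (simp add: bracket_evec_E scale_def)
      next
        case (2 i)
        then show ?thesis using \<alpha>' v W_outside[OF v no] W_H[OF v]
          unfolding X by (simp add: bracket_evec_H[OF \<alpha>'(1) 2(2)] scale_def del: One_nat_def)
      qed
    qed
  qed
qed

text \<open>\<open>cube\<close> lists the coordinates of a vector of \<open>V\<^sub>1\<close>; the coordinate at
  \<open>a \<alpha>\<^sub>1 + b \<alpha>\<^sub>2 + \<alpha>\<^sub>3 + d \<alpha>\<^sub>4\<close> has the binary index \<open>abd\<close>.\<close>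

definition cube :: "'a \<Rightarrow> 'a \<Rightarrow> 'a \<Rightarrow> 'a \<Rightarrow> 'a \<Rightarrow> 'a \<Rightarrow> 'a \<Rightarrow> 'a \<Rightarrow> label \<Rightarrow> 'a" where
  "cube x0 x1 x2 x3 x4 x5 x6 x7 = (\<lambda>k.
     if k = E (0,0,1,0) then x0 else if k = E (0,0,1,1) then x1
     else if k = E (0,1,1,0) then x2 else if k = E (0,1,1,1) then x3
     else if k = E (1,0,1,0) then x4 else if k = E (1,0,1,1) then x5
     else if k = E (1,1,1,0) then x6 else if k = E (1,1,1,1) then x7 else 0)"

lemma cube_in_W [simp]: "cube x0 x1 x2 x3 x4 x5 x6 x7 \<in> W"
  by (auto simp: V1_def cube_def Phi1_eq)

lemma cube_in_L [simp]: "cube x0 x1 x2 x3 x4 x5 x6 x7 \<in> L"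
  using cube_in_W W_subset by blast

lemma cube_apply [simp]:
  "cube x0 x1 x2 x3 x4 x5 x6 x7 (E (0,0,1,0)) = x0" "cube x0 x1 x2 x3 x4 x5 x6 x7 (E (0,0,1,1)) = x1"
  "cube x0 x1 x2 x3 x4 x5 x6 x7 (E (0,1,1,0)) = x2" "cube x0 x1 x2 x3 x4 x5 x6 x7 (E (0,1,1,1)) = x3"
  "cube x0 x1 x2 x3 x4 x5 x6 x7 (E (1,0,1,0)) = x4" "cube x0 x1 x2 x3 x4 x5 x6 x7 (E (1,0,1,1)) = x5"
  "cube x0 x1 x2 x3 x4 x5 x6 x7 (E (1,1,1,0)) = x6" "cube x0 x1 x2 x3 x4 x5 x6 x7 (E (1,1,1,1)) = x7"
  by (simp_all add: cube_def)

lemma cube_cases: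
  assumes "x \<in> W"
  obtains x0 x1 x2 x3 x4 x5 x6 x7 where "x = cube x0 x1 x2 x3 x4 x5 x6 x7"
proof
  show "x = cube (x (E (0,0,1,0))) (x (E (0,0,1,1))) (x (E (0,1,1,0))) (x (E (0,1,1,1)))
     (x (E (1,0,1,0))) (x (E (1,0,1,1))) (x (E (1,1,1,0))) (x (E (1,1,1,1)))"
    by (rule W_eqI[OF assms cube_in_W]) (auto simp: Phi1_eq)
qed

text \<open>Elementary row operations on one of the three indices of the cube. Only the third index
  carries the sign \<open>sg\<close>.\<close>

lemma X_cube:
  "X (1,0,0,0) a (cube x0 x1 x2 x3 x4 x5 x6 x7)
    = cube x0 x1 x2 x3 (x4 + a * x0) (x5 + a * x1) (x6 + a * x2) (x7 + a * x3)"
  "X (-1,0,0,0) a (cube x0 x1 x2 x3 x4 x5 x6 x7)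
    = cube (x0 + a * x4) (x1 + a * x5) (x2 + a * x6) (x3 + a * x7) x4 x5 x6 x7"
  "X (0,1,0,0) a (cube x0 x1 x2 x3 x4 x5 x6 x7)
    = cube x0 x1 (x2 + a * x0) (x3 + a * x1) x4 x5 (x6 + a * x4) (x7 + a * x5)"
  "X (0,-1,0,0) a (cube x0 x1 x2 x3 x4 x5 x6 x7)
    = cube (x0 + a * x2) (x1 + a * x3) x2 x3 (x4 + a * x6) (x5 + a * x7) x6 x7"
  "X (0,0,0,1) a (cube x0 x1 x2 x3 x4 x5 x6 x7)
    = cube x0 (x1 + a * of_int sg * x0) x2 (x3 + a * of_int sg * x2) x4 (x5 + a * of_int sg * x4) x6 (x7 + a * of_int sg * x6)"
  "X (0,0,0,-1) a (cube x0 x1 x2 x3 x4 x5 x6 x7)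
    = cube (x0 + a * of_int sg * x1) x1 (x2 + a * of_int sg * x3) x3 (x4 + a * of_int sg * x5) x5 (x6 + a * of_int sg * x7) x7"
proof -
  have p: "(1,0,0,0) \<in> Phi0" "(-1,0,0,0) \<in> Phi0" "(0,1,0,0) \<in> Phi0" "(0,-1,0,0) \<in> Phi0"
    "(0,0,0,1) \<in> Phi0" "(0,0,0,-1) \<in> Phi0" by (simp_all add: Phi0_eq)
  have eq: "X \<alpha> a (cube x0 x1 x2 x3 x4 x5 x6 x7) = y"
    if "\<alpha> \<in> Phi0" "y \<in> W" "\<And>\<gamma>. \<gamma> \<in> Phi1 \<Longrightarrow> X \<alpha> a (cube x0 x1 x2 x3 x4 x5 x6 x7) (E \<gamma>) = y (E \<gamma>)" for \<alpha> y
    using that by (intro W_eqI X_in_W) auto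
  have Phi1_cases: "\<gamma> = (0,0,1,0) \<or> \<gamma> = (1,0,1,0) \<or> \<gamma> = (0,1,1,0) \<or> \<gamma> = (0,0,1,1)
      \<or> \<gamma> = (1,1,1,0) \<or> \<gamma> = (1,0,1,1) \<or> \<gamma> = (0,1,1,1) \<or> \<gamma> = (1,1,1,1)" if "\<gamma> \<in> Phi1" for \<gamma>
    using that by (simp add: Phi1_eq)
  note s = X_degree_zero(1)[OF p(1) cube_in_L] X_degree_zero(1)[OF p(2) cube_in_L]
     X_degree_zero(1)[OF p(3) cube_in_L] X_degree_zero(1)[OF p(4) cube_in_L]
     X_degree_zero(1)[OF p(5) cube_in_L] X_degree_zero(1)[OF p(6) cube_in_L]
  show "X (1,0,0,0) a (cube x0 x1 x2 x3 x4 x5 x6 x7)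
    = cube x0 x1 x2 x3 (x4 + a * x0) (x5 + a * x1) (x6 + a * x2) (x7 + a * x3)"
    by (rule eq[OF p(1) cube_in_W], drule Phi1_cases, elim disjE; simp add: s(1) Phi1_eq N_first)
  show "X (-1,0,0,0) a (cube x0 x1 x2 x3 x4 x5 x6 x7)
    = cube (x0 + a * x4) (x1 + a * x5) (x2 + a * x6) (x3 + a * x7) x4 x5 x6 x7"
    by (rule eq[OF p(2) cube_in_W], drule Phi1_cases, elim disjE; simp add: s(2) Phi1_eq N_first_opposite)
  show "X (0,1,0,0) a (cube x0 x1 x2 x3 x4 x5 x6 x7)
    = cube x0 x1 (x2 + a * x0) (x3 + a * x1) x4 x5 (x6 + a * x4) (x7 + a * x5)"
    by (rule eq[OF p(3) cube_in_W], drule Phi1_cases, elim disjE; simp add: s(3) Phi1_eq N_second)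
  show "X (0,-1,0,0) a (cube x0 x1 x2 x3 x4 x5 x6 x7)
    = cube (x0 + a * x2) (x1 + a * x3) x2 x3 (x4 + a * x6) (x5 + a * x7) x6 x7"
    by (rule eq[OF p(4) cube_in_W], drule Phi1_cases, elim disjE; simp add: s(4) Phi1_eq N_second_opposite)
  show "X (0,0,0,1) a (cube x0 x1 x2 x3 x4 x5 x6 x7)
    = cube x0 (x1 + a * of_int sg * x0) x2 (x3 + a * of_int sg * x2) x4 (x5 + a * of_int sg * x4) x6 (x7 + a * of_int sg * x6)"
    by (rule eq[OF p(5) cube_in_W], drule Phi1_cases, elim disjE; simp add: s(5) Phi1_eq N_fourth)
  show "X (0,0,0,-1) a (cube x0 x1 x2 x3 x4 x5 x6 x7)
    = cube (x0 + a * of_int sg * x1) x1 (x2 + a * of_int sg * x3) x3 (x4 + a * of_int sg * x5) x5 (x6 + a * of_int sg * x7) x7"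
    by (rule eq[OF p(6) cube_in_W], drule Phi1_cases, elim disjE; simp add: s(6) Phi1_eq N_fourth_opposite)
qed

text \<open>The determinants of the pencils of slices of a cube in the three directions.\<close>

definition Q1 :: "(label \<Rightarrow> 'a) \<Rightarrow> 'a \<Rightarrow> 'a \<Rightarrow> 'a" where
  "Q1 x u v = (u * x (E (0,0,1,0)) + v * x (E (1,0,1,0))) * (u * x (E (0,1,1,1)) + v * x (E (1,1,1,1)))
            - (u * x (E (0,0,1,1)) + v * x (E (1,0,1,1))) * (u * x (E (0,1,1,0)) + v * x (E (1,1,1,0)))"

definition Q2 :: "(label \<Rightarrow> 'a) \<Rightarrow> 'a \<Rightarrow> 'a \<Rightarrow> 'a" where
  "Q2 x u v = (u * x (E (0,0,1,0)) + v * x (E (0,1,1,0))) * (u * x (E (1,0,1,1)) + v * x (E (1,1,1,1)))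
            - (u * x (E (0,0,1,1)) + v * x (E (0,1,1,1))) * (u * x (E (1,0,1,0)) + v * x (E (1,1,1,0)))"

definition Q3 :: "(label \<Rightarrow> 'a) \<Rightarrow> 'a \<Rightarrow> 'a \<Rightarrow> 'a" where
  "Q3 x u v = (u * x (E (0,0,1,0)) + v * x (E (0,0,1,1))) * (u * x (E (1,1,1,0)) + v * x (E (1,1,1,1)))
            - (u * x (E (0,1,1,0)) + v * x (E (0,1,1,1))) * (u * x (E (1,0,1,0)) + v * x (E (1,0,1,1)))"

text \<open>Cayley's hyperdeterminant, the common discriminant of the three forms.\<close>

definition hyperdet :: "(label \<Rightarrow> 'a) \<Rightarrow> 'a" where
  "hyperdet x = (x (E (0,0,1,0)) * x (E (1,1,1,1)) + x (E (1,0,1,0)) * x (E (0,1,1,1))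
       - x (E (0,0,1,1)) * x (E (1,1,1,0)) - x (E (1,0,1,1)) * x (E (0,1,1,0)))\<^sup>2
     - 4 * (x (E (0,0,1,0)) * x (E (0,1,1,1)) - x (E (0,0,1,1)) * x (E (0,1,1,0)))
         * (x (E (1,0,1,0)) * x (E (1,1,1,1)) - x (E (1,0,1,1)) * x (E (1,1,1,0)))"

definition vals :: "('a \<Rightarrow> 'a \<Rightarrow> 'a) \<Rightarrow> 'a set" where
  "vals q = {q u v | u v. True}"

text \<open>A generator of the factor belonging to a form acts on it by a linear substitution in (u,
  v); the other generators preserve the determinant of every member of the pencil. Inclusions
  suffice here, since the inverse group element supplies the reverse ones.\<close>

lemma X_invariants:
  assumes \<alpha>: "\<alpha> \<in> Phi0" and x: "x \<in> W"
  shows "hyperdet (X \<alpha> a x) = hyperdet x"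
    and "vals (Q1 (X \<alpha> a x)) \<subseteq> vals (Q1 x)" "vals (Q2 (X \<alpha> a x)) \<subseteq> vals (Q2 x)" "vals (Q3 (X \<alpha> a x)) \<subseteq> vals (Q3 x)"
proof -
  obtain x0 x1 x2 x3 x4 x5 x6 x7 where c: "x = cube x0 x1 x2 x3 x4 x5 x6 x7" using cube_cases[OF x] .
  have \<alpha>s: "\<alpha> = (1,0,0,0) \<or> \<alpha> = (-1,0,0,0) \<or> \<alpha> = (0,1,0,0) \<or> \<alpha> = (0,-1,0,0) \<or> \<alpha> = (0,0,0,1) \<or> \<alpha> = (0,0,0,-1)"
    using \<alpha> by (auto simp: Phi0_eq)
  let ?c = "cube x0 x1 x2 x3 x4 x5 x6 x7"
  define b where "b = a * of_int sg"
  note X = X_cube[of a, folded b_def]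
  show "hyperdet (X \<alpha> a x) = hyperdet x"
    using \<alpha>s unfolding c
  proof (elim disjE)
  qed (erule ssubst, simp only: X hyperdet_def cube_apply, algebra)+
  have "\<exists>u' v'. Q1 (X \<alpha> a ?c) u v = Q1 ?c u' v'" for u v
    using \<alpha>s
  proof (elim disjE)
    assume \<alpha>_eq: "\<alpha> = (1,0,0,0)"
    show ?thesis unfolding \<alpha>_eq by (intro exI[of _ "u + a * v"] exI[of _ v]) (simp only: X Q1_def cube_apply, algebra)
  next
    assume \<alpha>_eq: "\<alpha> = (-1,0,0,0)"
    show ?thesis unfolding \<alpha>_eq by (intro exI[of _ u] exI[of _ "v + a * u"]) (simp only: X Q1_def cube_apply, algebra)
  qed (erule ssubst, intro exI[of _ u] exI[of _ v], simp only: X Q1_def cube_apply, algebra)+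
  then show "vals (Q1 (X \<alpha> a x)) \<subseteq> vals (Q1 x)" unfolding vals_def c by auto
  have "\<exists>u' v'. Q2 (X \<alpha> a ?c) u v = Q2 ?c u' v'" for u v
    using \<alpha>s
  proof (elim disjE)
    assume \<alpha>_eq: "\<alpha> = (0,1,0,0)"
    show ?thesis unfolding \<alpha>_eq by (intro exI[of _ "u + a * v"] exI[of _ v]) (simp only: X Q2_def cube_apply, algebra)
  next
    assume \<alpha>_eq: "\<alpha> = (0,-1,0,0)"
    show ?thesis unfolding \<alpha>_eq by (intro exI[of _ u] exI[of _ "v + a * u"]) (simp only: X Q2_def cube_apply, algebra)
  qed (erule ssubst, intro exI[of _ u] exI[of _ v], simp only: X Q2_def cube_apply, algebra)+
  then show "vals (Q2 (X \<alpha> a x)) \<subseteq> vals (Q2 x)" unfolding vals_def c by auto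
  have "\<exists>u' v'. Q3 (X \<alpha> a ?c) u v = Q3 ?c u' v'" for u v
    using \<alpha>s
  proof (elim disjE)
    assume \<alpha>_eq: "\<alpha> = (0,0,0,1)"
    show ?thesis unfolding \<alpha>_eq by (intro exI[of _ "u + b * v"] exI[of _ v]) (simp only: X Q3_def cube_apply, algebra)
  next
    assume \<alpha>_eq: "\<alpha> = (0,0,0,-1)"
    show ?thesis unfolding \<alpha>_eq by (intro exI[of _ u] exI[of _ "v + b * u"]) (simp only: X Q3_def cube_apply, algebra)
  qed (erule ssubst, intro exI[of _ u] exI[of _ v], simp only: X Q3_def cube_apply, algebra)+
  then show "vals (Q3 (X \<alpha> a x)) \<subseteq> vals (Q3 x)" unfolding vals_def c by auto
qed

end

section \<open>Reduction of cubes\<close>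

text \<open>Generation of SL_2 by elementary matrices, as an induction principle for row operations.
  If u is nonzero, an upper, a lower and an upper elementary matrix suffice.\<close>

lemma SL2_generated:
  fixes R :: "'a::field \<Rightarrow> 'a \<Rightarrow> 'a \<Rightarrow> 'a \<Rightarrow> bool"
  assumes id: "R 1 0 0 1"
    and up: "\<And>p q u w c. R p q u w \<Longrightarrow> R (p + c * u) (q + c * w) u w"
    and low: "\<And>p q u w c. R p q u w \<Longrightarrow> R p q (u + c * p) (w + c * q)"
    and det: "p * w - q * u = 1"
  shows "R p q u w"
proof -
  have nz: "R p q u w" if u: "u \<noteq> 0" and det: "p * w - q * u = 1" for p q u w
  proof -
    have 1: "R 1 ((w - 1) / u) 0 1" using up[OF id, of "(w - 1) / u"] by simp
    have 2: "R 1 ((w - 1) / u) u w" using low[OF 1, of u] u by simp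
    have "(w - 1) / u + (p - 1) / u * w = q" using u det by (simp add: field_simps)
    then show ?thesis using up[OF 2, of "(p - 1) / u"] u by simp
  qed
  show ?thesis
  proof (cases "u = 0")
    case True
    \<comment> \<open>Adding the first row to the second makes the lower left entry p, which is
      nonzero because p w = 1.\<close>
    then have "p \<noteq> 0" "p * (q + w) - q * p = 1" using det by (auto simp: algebra_simps)
    then have "R p q p (q + w)" by (rule nz)
    then show ?thesis using low[of p q p "q + w" "- 1"] True by simp
  qed (rule nz[OF _ det])
qed

context chevalley_D4_positive
begin

abbreviation R0 :: "(label \<Rightarrow> 'a) \<Rightarrow> (label \<Rightarrow> 'a) \<Rightarrow> bool" where "R0 \<equiv> reach Phi0"

lemmas R0_sym = reach_sym[OF Phi0_subset] and R0_X = reach_X[OF Phi0_subset]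

lemma R0_trans: "x \<in> W \<Longrightarrow> R0 x y \<Longrightarrow> R0 y z \<Longrightarrow> R0 x z"
  using reach_trans[OF Phi0_subset] W_subset by blast

lemma R0_refl: "x \<in> W \<Longrightarrow> R0 x x"
  using reach_refl[OF Phi0_subset] W_subset by blast

lemma sg_sg: "of_int sg * of_int sg = (1::'a)"
  using sg_cases by auto

text \<open>The sign of the third factor is absorbed in the parameter: a is replaced by
  \<open>a * of_int sg\<close>, and the sign squares to 1.\<close>

lemma R0_elementary:
  "R0 (cube x0 x1 x2 x3 x4 x5 x6 x7) (cube x0 x1 x2 x3 (x4 + a * x0) (x5 + a * x1) (x6 + a * x2) (x7 + a * x3))"
  "R0 (cube x0 x1 x2 x3 x4 x5 x6 x7) (cube (x0 + a * x4) (x1 + a * x5) (x2 + a * x6) (x3 + a * x7) x4 x5 x6 x7)"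
  "R0 (cube x0 x1 x2 x3 x4 x5 x6 x7) (cube x0 x1 (x2 + a * x0) (x3 + a * x1) x4 x5 (x6 + a * x4) (x7 + a * x5))"
  "R0 (cube x0 x1 x2 x3 x4 x5 x6 x7) (cube (x0 + a * x2) (x1 + a * x3) x2 x3 (x4 + a * x6) (x5 + a * x7) x6 x7)"
  "R0 (cube x0 x1 x2 x3 x4 x5 x6 x7) (cube x0 (x1 + a * x0) x2 (x3 + a * x2) x4 (x5 + a * x4) x6 (x7 + a * x6))"
  "R0 (cube x0 x1 x2 x3 x4 x5 x6 x7) (cube (x0 + a * x1) x1 (x2 + a * x3) x3 (x4 + a * x5) x5 (x6 + a * x7) x7)"
proof -
  have p: "(1,0,0,0) \<in> Phi0" "(-1,0,0,0) \<in> Phi0" "(0,1,0,0) \<in> Phi0" "(0,-1,0,0) \<in> Phi0"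
    "(0,0,0,1) \<in> Phi0" "(0,0,0,-1) \<in> Phi0" by (simp_all add: Phi0_eq)
  let ?c = "cube x0 x1 x2 x3 x4 x5 x6 x7"
  have a: "a * of_int sg * of_int sg = a" by (simp add: mult.assoc sg_sg)
  note X_sg = X_cube(5,6)[of "a * of_int sg", unfolded a]
  show "R0 ?c (cube x0 x1 x2 x3 (x4 + a * x0) (x5 + a * x1) (x6 + a * x2) (x7 + a * x3))"
    using R0_X[OF p(1), of ?c a] by (simp only: X_cube)
  show "R0 ?c (cube (x0 + a * x4) (x1 + a * x5) (x2 + a * x6) (x3 + a * x7) x4 x5 x6 x7)"
    using R0_X[OF p(2), of ?c a] by (simp only: X_cube)
  show "R0 ?c (cube x0 x1 (x2 + a * x0) (x3 + a * x1) x4 x5 (x6 + a * x4) (x7 + a * x5))"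
    using R0_X[OF p(3), of ?c a] by (simp only: X_cube)
  show "R0 ?c (cube (x0 + a * x2) (x1 + a * x3) x2 x3 (x4 + a * x6) (x5 + a * x7) x6 x7)"
    using R0_X[OF p(4), of ?c a] by (simp only: X_cube)
  show "R0 ?c (cube x0 (x1 + a * x0) x2 (x3 + a * x2) x4 (x5 + a * x4) x6 (x7 + a * x6))"
    using R0_X[OF p(5), of ?c "a * of_int sg"] by (simp only: X_sg)
  show "R0 ?c (cube (x0 + a * x1) x1 (x2 + a * x3) x3 (x4 + a * x5) x5 (x6 + a * x7) x7)"
    using R0_X[OF p(6), of ?c "a * of_int sg"] by (simp only: X_sg)
qed

lemma R0_SL2_first:
  assumes "p * w - q * u = 1"
  shows "R0 (cube x0 x1 x2 x3 x4 x5 x6 x7)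
    (cube (p * x0 + q * x4) (p * x1 + q * x5) (p * x2 + q * x6) (p * x3 + q * x7)
          (u * x0 + w * x4) (u * x1 + w * x5) (u * x2 + w * x6) (u * x3 + w * x7))"
  apply (rule SL2_generated[OF _ _ _ assms])
    apply (simp add: R0_refl)
  subgoal for p q u w c
    by (drule R0_trans[OF cube_in_W _ R0_elementary(2)[where a = c]]) (simp add: algebra_simps)
  subgoal for p q u w c
    by (drule R0_trans[OF cube_in_W _ R0_elementary(1)[where a = c]]) (simp add: algebra_simps)
  done

lemma R0_SL2_second:
  assumes "p * w - q * u = 1"
  shows "R0 (cube x0 x1 x2 x3 x4 x5 x6 x7)
    (cube (p * x0 + q * x2) (p * x1 + q * x3) (u * x0 + w * x2) (u * x1 + w * x3)
          (p * x4 + q * x6) (p * x5 + q * x7) (u * x4 + w * x6) (u * x5 + w * x7))"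
  apply (rule SL2_generated[OF _ _ _ assms])
    apply (simp add: R0_refl)
  subgoal for p q u w c
    by (drule R0_trans[OF cube_in_W _ R0_elementary(4)[where a = c]]) (simp add: algebra_simps)
  subgoal for p q u w c
    by (drule R0_trans[OF cube_in_W _ R0_elementary(3)[where a = c]]) (simp add: algebra_simps)
  done

lemma R0_SL2_third:
  assumes "p * w - q * u = 1"
  shows "R0 (cube x0 x1 x2 x3 x4 x5 x6 x7)
    (cube (p * x0 + q * x1) (u * x0 + w * x1) (p * x2 + q * x3) (u * x2 + w * x3)
          (p * x4 + q * x5) (u * x4 + w * x5) (p * x6 + q * x7) (u * x6 + w * x7))"
  apply (rule SL2_generated[OF _ _ _ assms])
    apply (simp add: R0_refl)
  subgoal for p q u w c
    by (drule R0_trans[OF cube_in_W _ R0_elementary(6)[where a = c]]) (simp add: algebra_simps)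
  subgoal for p q u w c
    by (drule R0_trans[OF cube_in_W _ R0_elementary(5)[where a = c]]) (simp add: algebra_simps)
  done

lemma R0_invariants:
  assumes x: "x \<in> W" and xy: "R0 x y"
  shows "y \<in> W" "hyperdet y = hyperdet x"
    "vals (Q1 y) = vals (Q1 x)" "vals (Q2 y) = vals (Q2 x)" "vals (Q3 y) = vals (Q3 x)"
proof -
  have *: "y \<in> W \<and> hyperdet y = hyperdet x \<and> vals (Q1 y) \<subseteq> vals (Q1 x) \<and> vals (Q2 y) \<subseteq> vals (Q2 x)
      \<and> vals (Q3 y) \<subseteq> vals (Q3 x)" if x: "x \<in> W" and xy: "R0 x y" for x y
  proof -
    obtain g where g: "g \<in> carrier (grp Phi0)" "g x = y" using xy unfolding reach_def by blast
    have "\<forall>x\<in>W. g x \<in> W \<and> hyperdet (g x) = hyperdet x \<and> vals (Q1 (g x)) \<subseteq> vals (Q1 x)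
        \<and> vals (Q2 (g x)) \<subseteq> vals (Q2 x) \<and> vals (Q3 (g x)) \<subseteq> vals (Q3 x)"
      using Phi0_subset g(1)
    proof (induction rule: grp_induct)
      case one
      have "(\<lambda>v\<in>L. v) x = x" if "x \<in> W" for x using that W_subset by (simp add: subset_iff)
      then show ?case by simp
    next
      case (gen \<alpha> a)
      then show ?case using X_in_W X_invariants by blast
    next
      case (mult g h)
      have comp: "compose L g h x = g (h x)" if "x \<in> W" for x
        using that W_subset by (simp add: compose_def subset_iff)
      show ?case
      proof
        fix x :: "label \<Rightarrow> 'a" assume x: "x \<in> W"
        then have "h x \<in> W" using mult(4) by blast
        with x mult(3,4) show "compose L g h x \<in> W \<and> hyperdet (compose L g h x) = hyperdet x
          \<and> vals (Q1 (compose L g h x)) \<subseteq> vals (Q1 x) \<and> vals (Q2 (compose L g h x)) \<subseteq> vals (Q2 x)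
          \<and> vals (Q3 (compose L g h x)) \<subseteq> vals (Q3 x)"
          unfolding comp[OF x] by (metis subset_trans)
      qed
    qed
    then show ?thesis using x g(2) by blast
  qed
  have y: "y \<in> W" using *[OF x xy] by blast
  have yx: "R0 y x" using R0_sym x xy W_subset by blast
  show "y \<in> W" "hyperdet y = hyperdet x"
    "vals (Q1 y) = vals (Q1 x)" "vals (Q2 y) = vals (Q2 x)" "vals (Q3 y) = vals (Q3 x)"
    using *[OF x xy] *[OF y yx] by auto
qed

lemma vals_iff: "c \<in> vals q \<longleftrightarrow> (\<exists>u v. c = q u v)"
  by (auto simp: vals_def)

text \<open>The slices of the resulting cube are \<open>D\<close> and \<open>M D\<close> with \<open>D = diag(1, r)\<close> and \<open>M\<close> of trace \<open>0\<close>.\<close>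

lemma R0_first_slice_diagonal:
  assumes x: "x \<in> W" and r: "r \<in> vals (Q1 x)" "r \<noteq> 0"
  obtains a s t where "R0 x (cube 1 0 0 r a s t (- (a * r)))"
proof -
  obtain x0 x1 x2 x3 x4 x5 x6 x7 where c: "x = cube x0 x1 x2 x3 x4 x5 x6 x7" using cube_cases[OF x] .
  obtain u v where uv: "r = Q1 x u v" using r(1) by (auto simp: vals_iff)
  \<comment> \<open>Completes (u, v) to a matrix of determinant 1; acting with it on the first index
    makes the member of the pencil with determinant r the first slice.\<close>
  have "\<exists>u' v'. u * v' - v * u' = 1"
  proof (cases "u = 0")
    case True
    then have "v \<noteq> 0" using r uv by (auto simp: Q1_def)
    then show ?thesis by (intro exI[of _ "- 1 / v"] exI[of _ 0]) simp
  next
    case False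
    then show ?thesis by (intro exI[of _ 0] exI[of _ "1 / u"]) simp
  qed
  then obtain u' v' where "u * v' - v * u' = 1" by blast
  from R0_SL2_first[OF this, of x0 x1 x2 x3 x4 x5 x6 x7]
  obtain y0 y1 y2 y3 y4 y5 y6 y7 where y: "R0 x (cube y0 y1 y2 y3 y4 y5 y6 y7)"
    and det: "y0 * y3 - y1 * y2 = r"
    unfolding c[symmetric] using uv by (auto simp: c Q1_def)
  \<comment> \<open>Adding b times the first slice to the second makes the two orthogonal for the
    polar form of the determinant. This is the trace condition on M, and solving it for b divides by
    2.\<close>
  define b where "b = - (y0 * y7 + y4 * y3 - y1 * y6 - y5 * y2) / (2 * r)"
  define z4 where "z4 = y4 + b * y0"
  define z5 where "z5 = y5 + b * y1"
  define z6 where "z6 = y6 + b * y2"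
  define z7 where "z7 = y7 + b * y3"
  have br: "2 * r * b = - (y0 * y7 + y4 * y3 - y1 * y6 - y5 * y2)"
    using r(2) two_nonzero by (simp add: b_def)
  have polar: "y0 * z7 + z4 * y3 - y1 * z6 - z5 * y2 = 0"
  proof -
    have "y0 * z7 + z4 * y3 - y1 * z6 - z5 * y2
        = (y0 * y7 + y4 * y3 - y1 * y6 - y5 * y2) + 2 * (y0 * y3 - y1 * y2) * b"
      unfolding z4_def z5_def z6_def z7_def by algebra
    then show ?thesis using br det by simp
  qed
  have 2: "R0 x (cube y0 y1 y2 y3 z4 z5 z6 z7)"
    by (rule R0_trans[OF x y]) (unfold z4_def z5_def z6_def z7_def, rule R0_elementary(1))
  define a where "a = y3 / r * z4 + - y1 / r * z6"
  define s where "s = y3 / r * z5 + - y1 / r * z7"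
  define t where "t = - y2 * z4 + y0 * z6"
  \<comment> \<open>With Y the first slice, this is the determinant of D Y^-1, which acts on the
    rows of both slices and sends Y to D.\<close>
  have "y3 / r * y0 - - y1 / r * - y2 = 1" using det r(2) by (simp add: field_simps)
  from R0_trans[OF x 2 R0_SL2_second[OF this]]
  have "R0 x (cube (y3 / r * y0 + - y1 / r * y2) (y3 / r * y1 + - y1 / r * y3) (- y2 * y0 + y0 * y2) (- y2 * y1 + y0 * y3)
      a s t (- y2 * z5 + y0 * z7))"
    unfolding a_def s_def t_def .
  moreover have "y3 / r * y0 + - y1 / r * y2 = 1" using det r(2) by (simp add: field_simps)
  moreover have "y3 / r * y1 + - y1 / r * y3 = 0" by (simp add: mult.commute)
  moreover have "- y2 * y0 + y0 * y2 = 0" by simp_all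
  moreover have "- y2 * y1 + y0 * y3 = r" using det by (simp add: algebra_simps)
  moreover have "- y2 * z5 + y0 * z7 = - (a * r)"
  proof -
    have "a * r = y3 * z4 - y1 * z6" using r(2) by (simp add: a_def field_simps)
    then show ?thesis using polar by algebra
  qed
  ultimately have "R0 x (cube 1 0 0 r a s t (- (a * r)))" by (simp only:)
  then show ?thesis by (rule that)
qed

text \<open>In a basis \<open>M v, v\<close> a matrix \<open>M\<close> of trace \<open>0\<close> has zero diagonal, since \<open>M\<^sup>2\<close> is a scalar.\<close>

lemma R0_second_slice_antidiagonal:
  assumes r: "r \<noteq> 0" and s: "s' \<noteq> 0" "s' = s * z\<^sup>2 + 2 * a * r * y * z - r * t * y\<^sup>2"
  obtains t' where "R0 (cube 1 0 0 r a s t (- (a * r))) (cube 1 0 0 r 0 s' t' 0)"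
proof -
  \<comment> \<open>F and G stand for the inverses of s' and r, so that the identities below become
    polynomial and within reach of \<open>algebra\<close>.\<close>
  define F where "F = 1 / s'"
  define G where "G = 1 / r"
  have F: "F * s' = 1" and G: "G * r = 1" using r s(1) by (simp_all add: F_def G_def)
  \<comment> \<open>Put v = (y, z). Then s' is the determinant of the pair r M v, v, and (f1, f2) is
    r M v / s'. So (f1, f2) and v are the columns of a matrix of determinant 1, whose inverse acts
    on the second index.\<close>
  define f1 where "f1 = (a * r * y + s * z) * F"
  define f2 where "f2 = r * (t * y - a * z) * F"
  have f: "f1 * z - y * f2 = 1"
    using F s(2) unfolding f1_def f2_def by algebra
  have 1: "R0 (cube 1 0 0 r a s t (- (a * r)))
     (cube (z * 1 + - y * 0) (z * 0 + - y * r) (- f2 * 1 + f1 * 0) (- f2 * 0 + f1 * r)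
       (z * a + - y * t) (z * s + - y * (- (a * r))) (- f2 * a + f1 * t) (- f2 * s + f1 * (- (a * r))))"
    by (rule R0_SL2_second) (use f in algebra)
  \<comment> \<open>The matrix on the third index is chosen so that it restores the first slice
    D.\<close>
  have det: "f1 * z - f2 * G * (y * r) = 1" using f G by algebra
  define t' where "t' = f1 * (- f2 * a + f1 * t) + f2 * G * (- f2 * s + f1 * (- (a * r)))"
  have "R0 (cube 1 0 0 r a s t (- (a * r)))
     (cube (f1 * (z * 1 + - y * 0) + f2 * G * (z * 0 + - y * r)) (y * r * (z * 1 + - y * 0) + z * (z * 0 + - y * r))
       (f1 * (- f2 * 1 + f1 * 0) + f2 * G * (- f2 * 0 + f1 * r)) (y * r * (- f2 * 1 + f1 * 0) + z * (- f2 * 0 + f1 * r))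
       (f1 * (z * a + - y * t) + f2 * G * (z * s + - y * (- (a * r)))) (y * r * (z * a + - y * t) + z * (z * s + - y * (- (a * r))))
       t' (y * r * (- f2 * a + f1 * t) + z * (- f2 * s + f1 * (- (a * r)))))"
    unfolding t'_def by (rule R0_trans[OF cube_in_W 1 R0_SL2_third[OF det]])
  moreover have "f1 * (z * 1 + - y * 0) + f2 * G * (z * 0 + - y * r) = 1" using f G by algebra
  moreover have "y * r * (z * 1 + - y * 0) + z * (z * 0 + - y * r) = 0" by algebra
  moreover have "f1 * (- f2 * 1 + f1 * 0) + f2 * G * (- f2 * 0 + f1 * r) = 0" using G by algebra
  moreover have "y * r * (- f2 * 1 + f1 * 0) + z * (- f2 * 0 + f1 * r) = r" using f by algebra
  moreover have "f1 * (z * a + - y * t) + f2 * G * (z * s + - y * (- (a * r))) = 0"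
    using G unfolding f1_def f2_def by algebra
  moreover have "y * r * (z * a + - y * t) + z * (z * s + - y * (- (a * r))) = s'"
    using s(2) by algebra
  moreover have "y * r * (- f2 * a + f1 * t) + z * (- f2 * s + f1 * (- (a * r))) = 0"
    unfolding f1_def f2_def by algebra
  ultimately have "R0 (cube 1 0 0 r a s t (- (a * r))) (cube 1 0 0 r 0 s' t' 0)" by (simp only:)
  then show ?thesis by (rule that)
qed

lemma on_roots_eq_cube: "on_roots l r s t = cube l 0 0 r 0 s t 0"
  by (rule ext) (auto simp: on_roots_def cube_def evec_def r_lambda_def r_rho_def r_sigma_def r_tau_def)

lemma on_roots_in_W: "on_roots l r s t \<in> W"
  by (simp add: on_roots_eq_cube)

lemma on_roots_invariants:
  "hyperdet (on_roots l r s t) = 4 * (l * r * s * t)"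
  "Q1 (on_roots l r s t) u v = l * r * u\<^sup>2 - s * t * v\<^sup>2"
  "Q2 (on_roots l r s t) u v = l * s * u\<^sup>2 - r * t * v\<^sup>2"
  "Q3 (on_roots l r s t) u v = l * t * u\<^sup>2 - r * s * v\<^sup>2"
  by (simp_all add: on_roots_eq_cube hyperdet_def Q1_def Q2_def Q3_def power2_eq_square)

text \<open>Covers the cubes whose first form vanishes. Swaps in the three directions move a nonzero
  entry to the corner, a torus element scales it to 1, and elementary operations clear its three
  neighbours.\<close>

lemma R0_corner:
  assumes x: "x \<in> W" and nz: "x \<noteq> 0"
  obtains r s t q where "R0 x (cube 1 0 0 r 0 s t q)"
proof -
  obtain x0 x1 x2 x3 x4 x5 x6 x7 where c: "x = cube x0 x1 x2 x3 x4 x5 x6 x7" using cube_cases[OF x] .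
  have swap: "0 * 0 - 1 * (- 1) = (1::'a)" by simp
  have "x0 \<noteq> 0 \<or> x1 \<noteq> 0 \<or> x2 \<noteq> 0 \<or> x3 \<noteq> 0 \<or> x4 \<noteq> 0 \<or> x5 \<noteq> 0 \<or> x6 \<noteq> 0 \<or> x7 \<noteq> 0"
  proof (rule ccontr)
    assume "\<not> ?thesis"
    then have "x = 0" by (simp add: c cube_def fun_eq_iff)
    then show False using nz by simp
  qed
  then obtain y0 y1 y2 y3 y4 y5 y6 y7 where y: "R0 x (cube y0 y1 y2 y3 y4 y5 y6 y7)"
    and ynz: "y0 \<noteq> 0 \<or> y1 \<noteq> 0 \<or> y2 \<noteq> 0 \<or> y3 \<noteq> 0"
    using R0_SL2_first[OF swap, of x0 x1 x2 x3 x4 x5 x6 x7] R0_refl[OF x] unfolding c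
    by (simp del: One_nat_def) metis
  from ynz obtain z0 z1 z2 z3 z4 z5 z6 z7 where z: "R0 x (cube z0 z1 z2 z3 z4 z5 z6 z7)"
    and znz: "z0 \<noteq> 0 \<or> z1 \<noteq> 0"
    using R0_trans[OF x y R0_SL2_second[OF swap]] y by simp metis
  from znz obtain w0 w1 w2 w3 w4 w5 w6 w7 where w: "R0 x (cube w0 w1 w2 w3 w4 w5 w6 w7)"
    and wnz: "w0 \<noteq> 0"
    using R0_trans[OF x z R0_SL2_third[OF swap]] z by simp metis
  have "1 / w0 * w0 - 0 * 0 = 1" using wnz by simp
  from R0_trans[OF x w R0_SL2_first[OF this]] wnz
  obtain v1 v2 v3 v4 v5 v6 v7 where v: "R0 x (cube 1 v1 v2 v3 v4 v5 v6 v7)" by auto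
  from R0_trans[OF x v R0_elementary(1)[where a = "- v4"]]
  obtain v5 v6 v7 where v: "R0 x (cube 1 v1 v2 v3 0 v5 v6 v7)" by auto
  from R0_trans[OF x v R0_elementary(3)[where a = "- v2"]]
  obtain v3 v6 v7 where v: "R0 x (cube 1 v1 0 v3 0 v5 v6 v7)" by auto
  from R0_trans[OF x v R0_elementary(5)[where a = "- v1"]]
  show ?thesis using that by auto
qed

text \<open>Torus elements of the first and of one further factor are combined so that the corner
  returns to 1, while the other coefficient is multiplied by c twice.\<close>

lemma R0_torus:
  assumes "c \<noteq> 0"
  shows "R0 (on_roots 1 0 s 0) (on_roots 1 0 (s * c\<^sup>2) 0)" "R0 (on_roots 1 0 0 t) (on_roots 1 0 0 (t * c\<^sup>2))"
proof -
  have d: "1 / c * c - 0 * 0 = 1" "c * (1 / c) - 0 * 0 = 1" using assms by simp_all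
  have 1: "R0 (cube 1 0 0 0 0 s 0 0) (cube (1 / c) 0 0 0 0 (c * s) 0 0)"
    using R0_SL2_first[OF d(1), of 1 0 0 0 0 s 0 0] by simp
  have 2: "R0 (cube (1 / c) 0 0 0 0 (c * s) 0 0) (cube 1 0 0 0 0 (s * c\<^sup>2) 0 0)"
    using R0_SL2_second[OF d(2), of "1 / c" 0 0 0 0 "c * s" 0 0] assms by (simp add: power2_eq_square mult_ac)
  show "R0 (on_roots 1 0 s 0) (on_roots 1 0 (s * c\<^sup>2) 0)"
    unfolding on_roots_eq_cube by (rule R0_trans[OF cube_in_W 1 2])
  have 3: "R0 (cube 1 0 0 0 0 0 t 0) (cube (1 / c) 0 0 0 0 0 (c * t) 0)"
    using R0_SL2_first[OF d(1), of 1 0 0 0 0 0 t 0] by simp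
  have 4: "R0 (cube (1 / c) 0 0 0 0 0 (c * t) 0) (cube 1 0 0 0 0 0 (t * c\<^sup>2) 0)"
    using R0_SL2_third[OF d(2), of "1 / c" 0 0 0 0 0 "c * t" 0] assms by (simp add: power2_eq_square mult_ac)
  show "R0 (on_roots 1 0 0 t) (on_roots 1 0 0 (t * c\<^sup>2))"
    unfolding on_roots_eq_cube by (rule R0_trans[OF cube_in_W 3 4])
qed

end

section \<open>Orbits\<close>

lemma representatives_ex:
  assumes R: "representatives R r" and a: "a \<noteq> 0"
  obtains b where "b \<in> R" "b \<noteq> 0" "(a, b) \<in> r"
proof -
  have "r `` {a} \<in> units // r" using a by (auto intro: quotientI)
  then obtain b where "b \<in> R \<inter> r `` {a}" using R unfolding representatives_def by blast
  then show ?thesis using that R unfolding representatives_def by blast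
qed

lemma representatives_unique:
  assumes R: "representatives R r" and eq: "equiv units r" and ab: "a \<in> R" "b \<in> R" "(a, b) \<in> r"
  shows "a = b"
proof -
  have "a \<in> units" using R ab(1) unfolding representatives_def by blast
  then have "r `` {a} \<in> units // r" "a \<in> r `` {a}" "b \<in> r `` {a}"
    using equiv_class_self[OF eq] ab(3) by (blast intro: quotientI)+
  then show ?thesis using R ab unfolding representatives_def by blast
qed

lemma representatives_nonzero: "representatives R r \<Longrightarrow> a \<in> R \<Longrightarrow> a \<noteq> 0"
  unfolding representatives_def by blast

text \<open>The coefficients at the four roots, so that the invariants of all types can be compared
  at once.\<close>

fun params :: "'a::field orbit_type \<Rightarrow> 'a \<times> 'a \<times> 'a \<times> 'a" where
  "params Zero = (0, 0, 0, 0)"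
| "params Singular = (1, 0, 0, 0)"
| "params (Brilliant_rho r) = (1, r, 0, 0)"
| "params (Brilliant_sigma s) = (1, 0, s, 0)"
| "params (Brilliant_tau t) = (1, 0, 0, t)"
| "params (Luminous r s) = (1, r, s, 0)"
| "params (Dark k r s) = (1, r, s, k / (r * s))"

text \<open>The angle between the lift and e_\<delta>. The zero vector has e_\<delta> itself as its
  lift, hence angle 0.\<close>

fun type_angle :: "'a orbit_type \<Rightarrow> real" where
  "type_angle Zero = 0"
| "type_angle Singular = pi / 3"
| "type_angle (Brilliant_rho r) = pi / 2"
| "type_angle (Brilliant_sigma s) = pi / 2"
| "type_angle (Brilliant_tau t) = pi / 2"
| "type_angle (Luminous r s) = 2 * pi / 3"
| "type_angle (Dark k r s) = pi"

text \<open>A quarter of the hyperdeterminant of the normal form, for the admissible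
  parameters.\<close>

fun type_det :: "'a::field orbit_type \<Rightarrow> 'a" where
  "type_det (Dark k r s) = k"
| "type_det _ = 0"

lemma orbit_types_cases:
  assumes "p \<in> orbit_types R RK"
  obtains "p = Zero" | "p = Singular" | r where "p = Brilliant_rho r" "r \<in> R"
  | r where "p = Brilliant_sigma r" "r \<in> R" | r where "p = Brilliant_tau r" "r \<in> R"
  | r s where "p = Luminous r s" "r \<in> R" "s \<in> R"
  | k r s where "p = Dark k r s" "k \<noteq> 0" "r \<in> RK k" "s \<in> RK k"
  using assms unfolding orbit_types_def brilliant_types_def luminous_types_def dark_types_def by blast

section \<open>Angles are constant on orbits\<close>

context chevalley_D4_positive
begin

text \<open>Root elements of degree 0 fix e_\<delta>, preserve the coordinates at \<delta> and
  \<open>H 3\<close>, and act on the coordinates of degree 1 in the same way on a vector and on its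
  lift. So the angle of a normal form passes to its whole orbit.\<close>

lemma lifts_group:
  assumes g: "g \<in> carrier (grp Phi0)"
  shows "g (evec \<delta>) = evec \<delta>" "x \<in> W \<Longrightarrow> lifts N x y \<Longrightarrow> lifts N (g x) (g y)"
proof -
  have yL: "y \<in> L" if "lifts N x y" for x y :: "label \<Rightarrow> 'a"
    using that root_elements_in by (simp add: lifts_iff)
  have "g (evec \<delta>) = evec \<delta> \<and> (\<forall>x\<in>W. g x \<in> W \<and> (\<forall>y. lifts N x y \<longrightarrow> lifts N (g x) (g y)))"
    using Phi0_subset g
  proof (induction rule: grp_induct)
    case one
    have id: "(\<lambda>v\<in>L. v) x = x" if "x \<in> L" for x using that by simp
    show ?case
    proof (intro conjI ballI allI impI)
      show "(\<lambda>v\<in>L. v) (evec \<delta>) = evec \<delta>" by (rule id) simp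
      fix x assume x: "x \<in> W"
      then have xL: "x \<in> L" using W_subset by blast
      show "(\<lambda>v\<in>L. v) x \<in> W" unfolding id[OF xL] by (rule x)
      fix y assume y: "lifts N x y"
      show "lifts N ((\<lambda>v\<in>L. v) x) ((\<lambda>v\<in>L. v) y)" unfolding id[OF xL] id[OF yL[OF y]] by (rule y)
    qed
  next
    case (gen \<alpha> a)
    then have \<alpha>: "\<alpha> \<in> Phi" "rinner \<alpha> \<delta> = 0" by (auto simp: Phi0_iff)
    show ?case
    proof (intro conjI ballI allI impI)
      show "X \<alpha> a (evec \<delta>) = evec \<delta>" using \<alpha> by (simp add: X_evec_fixed)
      fix x assume x: "x \<in> W"
      then have xL: "x \<in> L" using W_subset by blast
      show "X \<alpha> a x \<in> W" using gen x by (rule X_in_W)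
      fix y assume y: "lifts N x y"
      note X_y = X_degree_zero[OF gen yL[OF y]]
      show "lifts N (X \<alpha> a x) (X \<alpha> a y)"
        unfolding lifts_iff
        using y X_y(2,3) X_root_element[OF \<alpha>(1), of y a]
        by (auto simp: lifts_iff X_y(1) X_degree_zero(1)[OF gen xL])
    qed
  next
    case (mult g h)
    have comp: "compose L g h x = g (h x)" if "x \<in> L" for x using that by (simp add: compose_def)
    show ?case
    proof (intro conjI ballI allI impI)
      show "compose L g h (evec \<delta>) = evec \<delta>" using mult by (simp add: comp)
      fix x assume x: "x \<in> W"
      then have xL: "x \<in> L" using W_subset by blast
      show "compose L g h x \<in> W" unfolding comp[OF xL] using mult x by blast
      fix y assume y: "lifts N x y"
      show "lifts N (compose L g h x) (compose L g h y)"
        unfolding comp[OF xL] comp[OF yL[OF y]] using mult x y by blast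
    qed
  qed
  then show "g (evec \<delta>) = evec \<delta>" "x \<in> W \<Longrightarrow> lifts N x y \<Longrightarrow> lifts N (g x) (g y)" by blast+
qed

lemma has_angle_transport:
  fixes y z :: "label \<Rightarrow> 'a"
  assumes k: "k \<in> carrier (grp Phi)" and a: "has_angle N y z \<phi>"
  shows "has_angle N (k y) (k z) \<phi>"
proof -
  have root: "k y \<in> root_elements N" if y: "y \<in> root_elements N" for y
  proof -
    obtain g \<beta> where g: "g \<in> carrier (grp Phi)" "\<beta> \<in> Phi" "y = g (evec \<beta>)"
      using y unfolding root_elements_eq by blast
    then have "k y = compose L k g (evec \<beta>)" by (simp add: compose_def)
    moreover have "compose L k g \<in> carrier (grp Phi)" using k g by (intro grp_mult) auto
    ultimately show ?thesis unfolding root_elements_eq using g(2) by blast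
  qed
  have yz: "y \<in> root_elements N" "z \<in> root_elements N" using a by (auto simp: has_angle_def)
  then have L: "y \<in> L" "z \<in> L" "k y \<in> L" "k z \<in> L" using root_elements_in root by auto
  obtain h where h: "h \<in> carrier (grp Phi)" "\<And>v. v \<in> L \<Longrightarrow> h (k v) = v"
    using grp_inverse[OF subset_refl k] by metis
  obtain g \<alpha> \<beta> c d where *: "g \<in> carrier (grp Phi)" "\<alpha> \<in> Phi" "\<beta> \<in> Phi" "c \<noteq> 0" "d \<noteq> 0"
      "g y = scale c (evec \<alpha>)" "g z = scale d (evec \<beta>)" "root_angle \<alpha> \<beta> = \<phi>"
    using a unfolding has_angle_def chev_group_eq by blast
  have gh: "compose L g h \<in> carrier (grp Phi)" using * h by (intro grp_mult) auto
  have "compose L g h (k y) = scale c (evec \<alpha>)" "compose L g h (k z) = scale d (evec \<beta>)"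
    using L h(2) * by (simp_all add: compose_def)
  then show ?thesis unfolding has_angle_def chev_group_eq using gh * root yz by blast
qed

lemma has_angle_orbit:
  fixes l r s t :: 'a
  defines "m \<equiv> 2 - (of_bool (l \<noteq> 0) + of_bool (r \<noteq> 0) + of_bool (s \<noteq> 0) + of_bool (t \<noteq> 0)) :: int"
  assumes x: "R0 (on_roots l r s t) x"
  shows "has_angle N (the_lift N x) (evec \<delta>) \<phi> \<longleftrightarrow> \<phi> = arccos (real_of_int m / 2)"
proof -
  obtain g where g: "g \<in> carrier (grp Phi0)" "g (on_roots l r s t) = x"
    using x unfolding reach_def by blast
  have gP: "g \<in> carrier (grp Phi)" using grp_subset[OF Phi0_subset _ g(1)] by simp
  obtain y where y: "lifts N (on_roots l r s t) y" using lift_normal_form by metis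
  have "lifts N x (g y)" using lifts_group(2)[OF g(1) on_roots_in_W y] g(2) by simp
  then have lx: "the_lift N x = g y" by (rule the_lift_eq)
  have "has_angle N y (evec \<delta>) (arccos (real_of_int m / 2))"
    using has_angle_normal_form[of l r s t] the_lift_eq[OF y] unfolding m_def by simp
  from has_angle_transport[OF gP this]
  have "has_angle N (the_lift N x) (evec \<delta>) (arccos (real_of_int m / 2))"
    unfolding lx lifts_group(1)[OF g(1)] .
  then show ?thesis using has_angle_unique by blast
qed

section \<open>Every cube reaches a normal form\<close>

lemma normal_form_params:
  "params p = (l, r, s, t) \<Longrightarrow> normal_form p = on_roots l r s (t::'a)"
  by (cases p) auto

lemma normal_form_in_W: "normal_form p \<in> W"
  by (cases p) (simp_all add: on_roots_in_W)

lemma G0_orbit_iff: "y \<in> G0_orbit N x \<longleftrightarrow> R0 x y"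
  by (auto simp: orbit_def reach_def chev_group0_eq)

text \<open>The hyperdeterminant of the cube reached is 4 r s t, which leaves no choice for
  t.\<close>

lemma R0_dark:
  assumes r: "r \<noteq> 0" "s \<noteq> 0" and k: "k \<noteq> 0" "hyperdet x = 4 * k" and x: "x \<in> W" and R: "R0 x (on_roots 1 r s t)"
  shows "R0 x (normal_form (Dark k r s))"
proof -
  have "2 * (2 * (r * s * t)) = 2 * (2 * k)" using R0_invariants(2)[OF x R] k by (simp add: on_roots_invariants)
  then have "r * s * t = k" unfolding two_mult_cancel .
  then have "t = k / (r * s)" using r by (simp add: field_simps)
  then show ?thesis using R by simp
qed

text \<open>The excluded case is M = 0. A nonzero M of trace 0 gives a nonzero second form, and any
  nonzero value of it can serve as s.\<close>

lemma R0_represent: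
  assumes x: "x \<in> W" and r: "r \<in> vals (Q1 x)" "r \<noteq> 0"
    and not_scalar: "\<not> R0 x (on_roots 1 r 0 0)"
  obtains s t where "s \<noteq> 0" "R0 x (on_roots 1 r s t)"
proof -
  obtain a s t where 1: "R0 x (cube 1 0 0 r a s t (- (a * r)))"
    using R0_first_slice_diagonal[OF x r] .
  have "a \<noteq> 0 \<or> s \<noteq> 0 \<or> t \<noteq> 0"
    using not_scalar 1 by (auto simp: on_roots_eq_cube)
  then have "\<exists>z y. s * z\<^sup>2 + 2 * a * r * y * z - r * t * y\<^sup>2 \<noteq> 0"
  proof -
    \<comment> \<open>A binary quadratic form that vanishes at (1, 0), (0, 1) and (1, 1) is zero; as
      2 and r are invertible, this would force a = s = t = 0.\<close>
    have "s * 1\<^sup>2 + 2 * a * r * 0 * 1 - r * t * 0\<^sup>2 = s" "s * 0\<^sup>2 + 2 * a * r * 1 * 0 - r * t * 1\<^sup>2 = - (r * t)"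
      "s * 1\<^sup>2 + 2 * a * r * 1 * 1 - r * t * 1\<^sup>2 = s + 2 * a * r - r * t" by simp_all
    moreover have "s \<noteq> 0 \<or> - (r * t) \<noteq> 0 \<or> s + 2 * a * r - r * t \<noteq> 0"
      using \<open>a \<noteq> 0 \<or> s \<noteq> 0 \<or> t \<noteq> 0\<close> r(2) two_nonzero by auto
    ultimately show ?thesis by metis
  qed
  then obtain z y where s': "s * z\<^sup>2 + 2 * a * r * y * z - r * t * y\<^sup>2 \<noteq> 0" by blast
  obtain t' where "R0 (cube 1 0 0 r a s t (- (a * r))) (cube 1 0 0 r 0 (s * z\<^sup>2 + 2 * a * r * y * z - r * t * y\<^sup>2) t' 0)"
    using R0_second_slice_antidiagonal[OF r(2) s' refl] .
  from R0_trans[OF x 1 this] show ?thesis using that[OF s'] by (simp add: on_roots_eq_cube)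
qed

text \<open>The case a = 0 of the passage to an antidiagonal slice. t' is left open, since the
  hyperdeterminant determines it afterwards.\<close>

lemma R0_change_second:
  assumes x: "x \<in> W" and R: "R0 x (on_roots 1 r s t)" and r: "r \<noteq> 0" and s': "s' \<noteq> 0" "s' = s * z\<^sup>2 - r * t * y\<^sup>2"
  obtains t' where "R0 x (on_roots 1 r s' t')"
proof -
  have "s' = s * z\<^sup>2 + 2 * 0 * r * y * z - r * t * y\<^sup>2" using s'(2) by simp
  from R0_second_slice_antidiagonal[OF r s'(1) this]
  obtain t' where "R0 (cube 1 0 0 r 0 s t (- (0 * r))) (cube 1 0 0 r 0 s' t' 0)" .
  then have "R0 (on_roots 1 r s t) (on_roots 1 r s' t')" by (simp add: on_roots_eq_cube)
  from R0_trans[OF x R this] show ?thesis using that by blast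
qed

lemma exhaustion:
  assumes R: "representatives R square_rel"
    and RK: "\<forall>k. k \<noteq> 0 \<longrightarrow> representatives (RK k) (norm_rel k)"
    and x: "x \<in> W"
  obtains p where "p \<in> orbit_types R RK" "R0 x (normal_form p)"
proof (cases "x = 0")
  case True
  then have "x = normal_form Zero" by (simp add: on_roots_def fun_eq_iff)
  then show ?thesis using that[of Zero] R0_refl[OF x] by (simp add: orbit_types_def)
next
  case x0: False
  define k where "k = hyperdet x / 4"
  have four: "(4::'a) \<noteq> 0" using two_nonzero by (metis mult_eq_0_iff mult_2 numeral_Bit0)
  have k: "hyperdet x = 4 * k" using four by (simp add: k_def)
  show ?thesis
  proof (cases "\<exists>r\<in>vals (Q1 x). r \<noteq> 0")
    case True
    then obtain r0 where r0: "r0 \<in> vals (Q1 x)" "r0 \<noteq> 0" by blast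
    obtain a s0 t0 where 1: "R0 x (cube 1 0 0 r0 a s0 t0 (- (a * r0)))"
      using R0_first_slice_diagonal[OF x r0] .
    have "hyperdet (cube 1 0 0 r0 a s0 t0 (- (a * r0))) = 4 * k" using R0_invariants(2)[OF x 1] k by simp
    then have "4 * (r0 * (a\<^sup>2 * r0 + s0 * t0)) = 4 * k"
      by (simp add: hyperdet_def power2_eq_square algebra_simps)
    then have k0: "r0 * (a\<^sup>2 * r0 + s0 * t0) = k" using four mult_left_cancel by blast
    have Q1_0: "Q1 (cube 1 0 0 r0 a s0 t0 (- (a * r0))) u v = r0 * u\<^sup>2 - (a\<^sup>2 * r0 + s0 * t0) * v\<^sup>2" for u v
      by (simp add: Q1_def power2_eq_square algebra_simps)
    \<comment> \<open>By \<open>k0\<close> the first form has become r0 u^2 - (k / r0) v^2.\<close>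
    have represented: "r0 * u\<^sup>2 - k / r0 * v\<^sup>2 \<in> vals (Q1 x)" for u v
    proof -
      have "k / r0 = a\<^sup>2 * r0 + s0 * t0" using k0 r0(2) by (simp add: field_simps)
      then show ?thesis unfolding R0_invariants(3)[OF x 1, symmetric] vals_iff Q1_0 by metis
    qed
    show ?thesis
    proof (cases "k = 0")
      case False
      obtain r where r: "r \<in> RK k" "r \<noteq> 0" "(r0, r) \<in> norm_rel k"
        using representatives_ex[OF RK[rule_format, OF False] r0(2)] .
      then obtain u v where uv: "u\<^sup>2 - k * v\<^sup>2 = r0 * r" by (auto simp: norm_rel_def)
      \<comment> \<open>Dividing the norm equation by r0 exhibits r as a value of the form.\<close>
      have "r = r0 * (u / r0)\<^sup>2 - k / r0 * v\<^sup>2"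
        using uv r0(2) by (simp add: power_divide power2_eq_square field_simps)
      then have rv: "r \<in> vals (Q1 x)" using represented by metis
      have ns: "\<not> R0 x (on_roots 1 r 0 0)"
      proof
        assume "R0 x (on_roots 1 r 0 0)"
        from R0_invariants(2)[OF x this] show False using k False four by (simp add: on_roots_invariants)
      qed
      obtain s1 t1 where s1: "s1 \<noteq> 0" "R0 x (on_roots 1 r s1 t1)"
        using R0_represent[OF x rv r(2) ns] .
      have "4 * (r * s1 * t1) = 4 * k" using R0_invariants(2)[OF x s1(2)] k by (simp add: on_roots_invariants)
      then have rst: "r * s1 * t1 = k" using four mult_left_cancel by blast
      obtain s where s: "s \<in> RK k" "s \<noteq> 0" "(s1, s) \<in> norm_rel k"
        using representatives_ex[OF RK[rule_format, OF False] s1(1)] .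
      then obtain z y where zy: "z\<^sup>2 - k * y\<^sup>2 = s1 * s" by (auto simp: norm_rel_def)
      \<comment> \<open>The second form is s1 z^2 - (k / s1) y^2, so the same division exhibits s as
        one of its values.\<close>
      have "s1 * s = s1 * (s1 * (z / s1)\<^sup>2 - r * t1 * y\<^sup>2)"
        unfolding zy[symmetric] rst[symmetric] using s1(1) by (simp add: power_divide power2_eq_square field_simps)
      then have "s = s1 * (z / s1)\<^sup>2 - r * t1 * y\<^sup>2" using s1(1) mult_left_cancel by blast
      from R0_change_second[OF x s1(2) r(2) s(2) this]
      obtain t where "R0 x (on_roots 1 r s t)" .
      then have "R0 x (normal_form (Dark k r s))" by (rule R0_dark[OF r(2) s(2) False k x])
      moreover have "Dark k r s \<in> orbit_types R RK"
        using False r s by (auto simp: orbit_types_def dark_types_def)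
      ultimately show ?thesis using that by blast
    next
      case True
      obtain r where r: "r \<in> R" "r \<noteq> 0" "(r0, r) \<in> square_rel"
        using representatives_ex[OF R r0(2)] .
      then obtain c where c: "c \<noteq> 0" "r0 = r * c\<^sup>2" by (auto simp: square_rel_def)
      have "r = r0 * (1 / c)\<^sup>2 - k / r0 * 0\<^sup>2" using c by (simp add: power_divide)
      then have rv: "r \<in> vals (Q1 x)" using represented by metis
      show ?thesis
      proof (cases "R0 x (on_roots 1 r 0 0)")
        case br: True
        show ?thesis using that[of "Brilliant_rho r"] br r(1)
          by (simp add: orbit_types_def brilliant_types_def)
      next
        case False
        obtain s1 t1 where s1: "s1 \<noteq> 0" "R0 x (on_roots 1 r s1 t1)"
          using R0_represent[OF x rv r(2) False] .
        obtain s where s: "s \<in> R" "s \<noteq> 0" "(s1, s) \<in> square_rel"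
          using representatives_ex[OF R s1(1)] .
        then obtain d where d: "d \<noteq> 0" "s1 = s * d\<^sup>2" by (auto simp: square_rel_def)
        have "s = s1 * (1 / d)\<^sup>2 - r * t1 * 0\<^sup>2" using d by (simp add: power_divide)
        from R0_change_second[OF x s1(2) r(2) s(2) this]
        obtain t where t: "R0 x (on_roots 1 r s t)" .
        have "4 * (r * s * t) = 0" using R0_invariants(2)[OF x t] k True by (simp add: on_roots_invariants)
        then have "t = 0" using four r(2) s(2) by simp
        then have "R0 x (normal_form (Luminous r s))" using t by simp
        moreover have "Luminous r s \<in> orbit_types R RK"
          using r s by (auto simp: orbit_types_def luminous_types_def)
        ultimately show ?thesis using that by blast
      qed
    qed
  next
    case False
    obtain r s t q where 1: "R0 x (cube 1 0 0 r 0 s t q)" using R0_corner[OF x x0] .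
    have Q: "Q1 (cube 1 0 0 r 0 s t q) u v = u * (u * r + v * q) - v * s * (v * t)" for u v
      by (simp add: Q1_def)
    have z: "u * (u * r + v * q) - v * s * (v * t) = 0" for u v
    proof -
      have "Q1 (cube 1 0 0 r 0 s t q) u v \<in> vals (Q1 x)"
        unfolding R0_invariants(3)[OF x 1, symmetric] vals_iff by blast
      then show ?thesis using False unfolding Q by blast
    qed
    \<comment> \<open>The vanishing form is r u^2 + q u v - s t v^2, and its coefficients are read
      off at three points; at most one of s and t survives.\<close>
    have "r = 0" using z[of 1 0] by simp
    moreover have st: "s * t = 0" using z[of 0 1] by simp
    ultimately have "q = 0" using z[of 1 1] by simp
    then have 2: "R0 x (on_roots 1 0 s t)" using 1 \<open>r = 0\<close> by (simp add: on_roots_eq_cube)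
    have scaled: "\<exists>b\<in>R. \<exists>c. c \<noteq> 0 \<and> b = a * c\<^sup>2" if a: "a \<noteq> 0" for a
    proof -
      obtain b where b: "b \<in> R" "(a, b) \<in> square_rel"
        using representatives_ex[OF R a] by metis
      then obtain c where "c \<noteq> 0" "a = b * c\<^sup>2" by (auto simp: square_rel_def)
      then have "1 / c \<noteq> 0 \<and> b = a * (1 / c)\<^sup>2" by (simp add: power_divide)
      then show ?thesis using b(1) by blast
    qed
    consider "s = 0" "t = 0" | "s \<noteq> 0" "t = 0" | "s = 0" "t \<noteq> 0" using st by auto
    then show ?thesis
    proof cases
      case 1
      then show ?thesis using that[of Singular] 2 by (simp add: orbit_types_def)
    next
      case 2
      then obtain b c where "b \<in> R" "c \<noteq> 0" "b = s * c\<^sup>2" using scaled by blast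
      then show ?thesis using that[of "Brilliant_sigma b"] R0_trans[OF x \<open>R0 x (on_roots 1 0 s t)\<close>] R0_torus(1)[of c s] 2
        by (simp add: orbit_types_def brilliant_types_def)
    next
      case 3
      then obtain b c where "b \<in> R" "c \<noteq> 0" "b = t * c\<^sup>2" using scaled by blast
      then show ?thesis using that[of "Brilliant_tau b"] R0_trans[OF x \<open>R0 x (on_roots 1 0 s t)\<close>] R0_torus(2)[of c t] 3
        by (simp add: orbit_types_def brilliant_types_def)
    qed
  qed
qed

section \<open>Different normal forms lie in different orbits\<close>

lemma Q_on_roots:
  "Q1 (on_roots l r s t) = (\<lambda>u v. l * r * u\<^sup>2 - s * t * v\<^sup>2)"
  "Q2 (on_roots l r s t) = (\<lambda>u v. l * s * u\<^sup>2 - r * t * v\<^sup>2)"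
  "Q3 (on_roots l r s t) = (\<lambda>u v. l * t * u\<^sup>2 - r * s * v\<^sup>2)"
  by (intro ext on_roots_invariants)+

lemma vals_trivial_iff: "vals (\<lambda>u v. a * u\<^sup>2 - b * v\<^sup>2) \<subseteq> {0} \<longleftrightarrow> a = 0 \<and> b = (0::'a)"
proof
  assume *: "vals (\<lambda>u v. a * u\<^sup>2 - b * v\<^sup>2) \<subseteq> {0}"
  have "a * 1\<^sup>2 - b * 0\<^sup>2 \<in> vals (\<lambda>u v. a * u\<^sup>2 - b * v\<^sup>2)" "a * 0\<^sup>2 - b * 1\<^sup>2 \<in> vals (\<lambda>u v. a * u\<^sup>2 - b * v\<^sup>2)"
    unfolding vals_def by blast+
  then have "a * 1\<^sup>2 - b * 0\<^sup>2 = 0" "a * 0\<^sup>2 - b * 1\<^sup>2 = 0" using * by blast+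
  then show "a = 0 \<and> b = 0" by simp
qed (auto simp: vals_def)

lemma first_coefficient_in_vals: "a \<in> vals (\<lambda>u v. a * u\<^sup>2 - b * v\<^sup>2)" for a b :: 'a
proof -
  have "a = a * 1\<^sup>2 - b * 0\<^sup>2" by simp
  then show ?thesis unfolding vals_iff by blast
qed

lemma vals_square_rel:
  assumes "vals (\<lambda>u v. a * u\<^sup>2 - 0 * v\<^sup>2) = vals (\<lambda>u v. b * u\<^sup>2 - 0 * v\<^sup>2)" "a \<noteq> 0" "b \<noteq> (0::'a)"
  shows "(a, b) \<in> square_rel"
proof -
  have "a \<in> vals (\<lambda>u v. b * u\<^sup>2 - 0 * v\<^sup>2)" using first_coefficient_in_vals[of a 0] assms(1) by simp
  then obtain c where "a = b * c\<^sup>2" by (auto simp: vals_def)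
  then show ?thesis using assms(2,3) by (auto simp: square_rel_def)
qed

text \<open>The first set contains a, as the value at (1, 0). Multiplying a = b u^2 - (k / b) v^2 by
  b gives the norm equation.\<close>

lemma vals_norm_rel:
  assumes "vals (\<lambda>u v. a * u\<^sup>2 - k / a * v\<^sup>2) = vals (\<lambda>u v. b * u\<^sup>2 - k / b * v\<^sup>2)" "a \<noteq> 0" "b \<noteq> (0::'a)"
  shows "(a, b) \<in> norm_rel k"
proof -
  have "a \<in> vals (\<lambda>u v. b * u\<^sup>2 - k / b * v\<^sup>2)" using first_coefficient_in_vals[of a "k / a"] assms(1) by simp
  then obtain u v where "a = b * u\<^sup>2 - k / b * v\<^sup>2" by (auto simp: vals_def)
  then have "(b * u)\<^sup>2 - k * v\<^sup>2 = a * b" using assms(3) by (simp add: field_simps power2_eq_square)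
  then show ?thesis using assms(2,3) unfolding norm_rel_def by blast
qed

text \<open>The type is recognised by what vanishes. For a singular vector all three forms do, in
  each brilliant series exactly one of \<open>Q1\<close>, \<open>Q2\<close>, \<open>Q3\<close>
  survives, and for luminous and dark vectors none vanishes. Within a type the value sets determine
  the classes of the parameters.\<close>

lemma orbit_type_unique:
  assumes R: "representatives R square_rel"
    and RK: "\<forall>k. k \<noteq> 0 \<longrightarrow> representatives (RK k) (norm_rel k)"
    and p: "p \<in> orbit_types R RK" and p': "p' \<in> orbit_types R RK"
    and pp': "R0 (normal_form p) (normal_form p')"
  shows "p = p'"
proof -
  have four: "(4::'a) \<noteq> 0" using two_nonzero by (metis mult_eq_0_iff mult_2 numeral_Bit0)
  note inv = R0_invariants(2-5)[OF normal_form_in_W pp']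
  have zero: "normal_form p = 0 \<longleftrightarrow> normal_form p' = 0"
  proof -
    have z: "y = 0" if "R0 0 y" for y
      using that Phi0_subset grp_automorphism(2)[of Phi0 _ 0 0 0] unfolding reach_def by auto
    have "R0 (normal_form p') (normal_form p)"
      using R0_sym pp' normal_form_in_W W_subset by blast
    then show ?thesis using z pp' by metis
  qed
  have on_roots_0: "on_roots l r s t = 0 \<longleftrightarrow> l = 0 \<and> r = 0 \<and> s = 0 \<and> t = (0::'a)" for l r s t
  proof
    assume "on_roots l r s t = 0"
    then have "cube l 0 0 r 0 s t 0 (E \<gamma>) = 0" for \<gamma> by (simp add: on_roots_eq_cube)
    from this[of "(0,0,1,0)"] this[of "(0,1,1,1)"] this[of "(1,0,1,1)"] this[of "(1,1,1,0)"]
    show "l = 0 \<and> r = 0 \<and> s = 0 \<and> t = 0" by simp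
  qed (simp add: on_roots_def fun_eq_iff)
  obtain l r s t l' r' s' t' where P: "params p = (l, r, s, t)" "params p' = (l', r', s', t')"
    by (cases "params p", cases "params p'")
  note forms = normal_form_params[OF P(1)] normal_form_params[OF P(2)]
  have "l = 0 \<and> r = 0 \<and> s = 0 \<and> t = 0 \<longleftrightarrow> l' = 0 \<and> r' = 0 \<and> s' = 0 \<and> t' = 0"
    using zero unfolding forms on_roots_0 .
  moreover have "l * r = 0 \<and> s * t = 0 \<longleftrightarrow> l' * r' = 0 \<and> s' * t' = 0"
    using inv(2) unfolding forms Q_on_roots vals_trivial_iff[symmetric] by simp
  moreover have "l * s = 0 \<and> r * t = 0 \<longleftrightarrow> l' * s' = 0 \<and> r' * t' = 0"
    using inv(3) unfolding forms Q_on_roots vals_trivial_iff[symmetric] by simp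
  moreover have "l * t = 0 \<and> r * s = 0 \<longleftrightarrow> l' * t' = 0 \<and> r' * s' = 0"
    using inv(4) unfolding forms Q_on_roots vals_trivial_iff[symmetric] by simp
  ultimately have differ: "l = 0 \<and> r = 0 \<and> s = 0 \<and> t = 0 \<longleftrightarrow> l' = 0 \<and> r' = 0 \<and> s' = 0 \<and> t' = 0"
    "l * r = 0 \<and> s * t = 0 \<longleftrightarrow> l' * r' = 0 \<and> s' * t' = 0"
    "l * s = 0 \<and> r * t = 0 \<longleftrightarrow> l' * s' = 0 \<and> r' * t' = 0"
    "l * t = 0 \<and> r * s = 0 \<longleftrightarrow> l' * t' = 0 \<and> r' * s' = 0" by blast+
  have nz: "a \<noteq> 0" if "a \<in> R" for a using representatives_nonzero[OF R that] .
  have nzK: "a \<noteq> 0" if "k \<noteq> 0" "a \<in> RK k" for a k using representatives_nonzero[OF RK[rule_format, OF that(1)] that(2)] .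
  note eqR = representatives_unique[OF R equiv_square_rel]
  have det: "hyperdet (normal_form q) = 4 * type_det q" if "q \<in> orbit_types R RK" for q
    using that
  proof (cases rule: orbit_types_cases)
    case (7 k r s)
    then show ?thesis using nzK[OF 7(2,3)] nzK[OF 7(2,4)] by (simp add: on_roots_invariants)
  qed (simp_all add: on_roots_invariants)
  \<comment> \<open>Luminous and dark vectors show the same pattern of forms; the hyperdeterminant
    tells them apart and fixes k among the dark ones.\<close>
  have "type_det p = type_det p'" using det[OF p] det[OF p'] inv(1) four by simp
  note differ = differ P this
  show ?thesis using p
  proof (cases rule: orbit_types_cases)
    case 1
    show ?thesis using p' by (cases rule: orbit_types_cases) (use 1 differ nz in \<open>auto\<close>)
  next
    case 2
    show ?thesis using p' by (cases rule: orbit_types_cases) (use 2 differ nz in \<open>auto\<close>)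
  next
    case (3 r)
    show ?thesis using p'
    proof (cases rule: orbit_types_cases)
      case (3 r')
      have "vals (Q1 (on_roots 1 r 0 0)) = vals (Q1 (on_roots 1 r' 0 0))" using inv(2) 3 \<open>p = Brilliant_rho r\<close> by simp
      then have "(r, r') \<in> square_rel" using nz \<open>r \<in> R\<close> 3 by (intro vals_square_rel) (simp_all add: Q_on_roots)
      then show ?thesis using eqR 3 \<open>r \<in> R\<close> \<open>p = Brilliant_rho r\<close> by blast
    qed (use 3 differ nz in \<open>auto\<close>)
  next
    case (4 r)
    show ?thesis using p'
    proof (cases rule: orbit_types_cases)
      case (4 r')
      have "vals (Q2 (on_roots 1 0 r 0)) = vals (Q2 (on_roots 1 0 r' 0))" using inv(3) 4 \<open>p = Brilliant_sigma r\<close> by simp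
      then have "(r, r') \<in> square_rel" using nz \<open>r \<in> R\<close> 4 by (intro vals_square_rel) (simp_all add: Q_on_roots)
      then show ?thesis using eqR 4 \<open>r \<in> R\<close> \<open>p = Brilliant_sigma r\<close> by blast
    qed (use 4 differ nz in \<open>auto\<close>)
  next
    case (5 r)
    show ?thesis using p'
    proof (cases rule: orbit_types_cases)
      case (5 r')
      have "vals (Q3 (on_roots 1 0 0 r)) = vals (Q3 (on_roots 1 0 0 r'))" using inv(4) 5 \<open>p = Brilliant_tau r\<close> by simp
      then have "(r, r') \<in> square_rel" using nz \<open>r \<in> R\<close> 5 by (intro vals_square_rel) (simp_all add: Q_on_roots)
      then show ?thesis using eqR 5 \<open>r \<in> R\<close> \<open>p = Brilliant_tau r\<close> by blast
    qed (use 5 differ nz in \<open>auto\<close>)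
  next
    case (6 r s)
    show ?thesis using p'
    proof (cases rule: orbit_types_cases)
      case (6 r' s')
      note p_eq = \<open>p = Luminous r s\<close> \<open>r \<in> R\<close> \<open>s \<in> R\<close>
      have "vals (Q1 (on_roots 1 r s 0)) = vals (Q1 (on_roots 1 r' s' 0))"
        "vals (Q2 (on_roots 1 r s 0)) = vals (Q2 (on_roots 1 r' s' 0))" using inv(2,3) 6 p_eq by simp_all
      then have "(r, r') \<in> square_rel" "(s, s') \<in> square_rel"
        using nz p_eq 6 by (auto intro!: vals_square_rel simp: Q_on_roots)
      then show ?thesis using eqR 6 p_eq by blast
    qed (use 6 differ nz in \<open>auto\<close>)
  next
    case (7 k r s)
    then have rs: "r \<noteq> 0" "s \<noteq> 0" using nzK by blast+
    show ?thesis using p'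
    proof (cases rule: orbit_types_cases)
      case (7 k' r' s')
      note p_eq = \<open>p = Dark k r s\<close> \<open>k \<noteq> 0\<close> \<open>r \<in> RK k\<close> \<open>s \<in> RK k\<close>
      have rs': "r' \<noteq> 0" "s' \<noteq> 0" using nzK 7 by blast+
      have kk': "k' = k" using \<open>type_det p = type_det p'\<close> 7 p_eq by simp
      \<comment> \<open>With the third coefficient k / (r s), the first two forms take the shape
        required by \<open>vals_norm_rel\<close>.\<close>
      have coeff: "s * (k / (r * s)) = k / r" "r * (k / (r * s)) = k / s"
        "s' * (k / (r' * s')) = k / r'" "r' * (k / (r' * s')) = k / s'" using rs rs' by simp_all
      have "vals (Q1 (on_roots 1 r s (k / (r * s)))) = vals (Q1 (on_roots 1 r' s' (k / (r' * s'))))"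
        "vals (Q2 (on_roots 1 r s (k / (r * s)))) = vals (Q2 (on_roots 1 r' s' (k / (r' * s'))))"
        using inv(2,3) 7 p_eq kk' by simp_all
      then have "(r, r') \<in> norm_rel k" "(s, s') \<in> norm_rel k"
        using rs rs' by (auto intro!: vals_norm_rel simp only: Q_on_roots coeff mult_1)
      then show ?thesis using representatives_unique[OF RK[rule_format, OF p_eq(2)] equiv_norm_rel] 7 p_eq kk' by blast
    qed (use differ 7 in \<open>auto\<close>)
  qed
qed

lemma type_angle_orbit:
  assumes R: "representatives R square_rel"
    and RK: "\<forall>k. k \<noteq> 0 \<longrightarrow> representatives (RK k) (norm_rel k)"
    and p: "p \<in> orbit_types R RK" and x: "R0 (normal_form p) x"
  shows "has_angle N (the_lift N x) (evec \<delta>) \<phi> \<longleftrightarrow> \<phi> = type_angle p"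
proof -
  have nz: "a \<noteq> 0" if "a \<in> R" for a using representatives_nonzero[OF R that] .
  have nzK: "a \<noteq> 0" if "k \<noteq> 0" "a \<in> RK k" for a k using representatives_nonzero[OF RK[rule_format, OF that(1)] that(2)] .
  obtain l r s t where lrst: "params p = (l, r, s, t)" by (cases "params p")
  have "has_angle N (the_lift N x) (evec \<delta>) \<phi> \<longleftrightarrow> \<phi> = arccos (real_of_int
     (2 - (of_bool (l \<noteq> 0) + of_bool (r \<noteq> 0) + of_bool (s \<noteq> 0) + of_bool (t \<noteq> 0))) / 2)"
    using x unfolding normal_form_params[OF lrst] by (rule has_angle_orbit)
  moreover have "arccos (real_of_int
     (2 - (of_bool (l \<noteq> 0) + of_bool (r \<noteq> 0) + of_bool (s \<noteq> 0) + of_bool (t \<noteq> 0))) / 2) = type_angle p"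
    using p
  proof (cases rule: orbit_types_cases)
    case (7 k r s)
    then show ?thesis using lrst nzK[OF 7(2,3)] nzK[OF 7(2,4)] by (auto simp: arccos_half_cases)
  qed (use lrst nz in \<open>auto simp: arccos_half_cases\<close>)
  ultimately show ?thesis by simp
qed

end

theorem mainTheorem3:
  fixes N :: "rt \<Rightarrow> rt \<Rightarrow> int"
    and R :: "'a::field set" and RK :: "'a \<Rightarrow> 'a set"
  assumes "CHAR('a) \<noteq> 2"
    and "chevalley_constants N" and "positive_constants N"
    and "representatives R square_rel"
    and "\<And>k. k \<noteq> 0 \<Longrightarrow> representatives (RK k) (norm_rel k)"
  shows "bij_betw (\<lambda>p. G0_orbit N (normal_form p)) (orbit_types R RK)
           (V1_orbits N :: (label \<Rightarrow> 'a) set set) \<and>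
         G0_orbit N (normal_form (Zero :: 'a orbit_type)) = {\<lambda>k. 0} \<and>
         {x :: label \<Rightarrow> 'a. singular N x} = G0_orbit N (normal_form Singular) \<and>
         {x :: label \<Rightarrow> 'a. brilliant N x}
           = (\<Union>p\<in>brilliant_types R. G0_orbit N (normal_form p)) \<and>
         {x :: label \<Rightarrow> 'a. luminous N x}
           = (\<Union>p\<in>luminous_types R. G0_orbit N (normal_form p)) \<and>
         {x :: label \<Rightarrow> 'a. dark N x}
           = (\<Union>p\<in>dark_types RK. G0_orbit N (normal_form p))"
proof -
  \<comment> \<open>2 vanishes only if the characteristic divides 2, and in a field it is not
    1.\<close>
  have "(2::'a) \<noteq> 0"
  proof
    assume "(2::'a) = 0"
    then have "CHAR('a) dvd 2" using of_nat_eq_0_iff_char_dvd[of 2, where 'a = 'a] by simp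
    then have "CHAR('a) = 1 \<or> CHAR('a) = 2" using two_is_prime_nat prime_nat_iff by blast
    then show False using assms(1) CHAR_not_1 by auto
  qed
  then interpret chevalley_D4_positive N "TYPE('a)"
    using assms by unfold_locales auto
  let ?O = "\<lambda>p. G0_orbit N (normal_form p) :: (label \<Rightarrow> 'a) set"
  let ?T = "orbit_types R RK"
  have RK: "\<forall>k. k \<noteq> 0 \<longrightarrow> representatives (RK k) (norm_rel k)" using assms(5) by blast
  note exh = exhaustion[OF assms(4) RK] and uniq = orbit_type_unique[OF assms(4) RK]
    and angle = type_angle_orbit[OF assms(4) RK]
  have orbit_eq: "G0_orbit N x = G0_orbit N y" if "x \<in> W" "R0 x y" for x y
  proof -
    have "y \<in> W" "R0 y x" using that R0_invariants(1) R0_sym W_subset by blast+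
    then show ?thesis using that R0_trans unfolding set_eq_iff G0_orbit_iff by blast
  qed
  have inj: "inj_on ?O ?T"
  proof (rule inj_onI)
    fix p p' assume p: "p \<in> ?T" "p' \<in> ?T" and eq: "?O p = ?O p'"
    have "normal_form p' \<in> ?O p'" using R0_refl[OF normal_form_in_W] by (simp add: G0_orbit_iff)
    then have "R0 (normal_form p) (normal_form p')" unfolding eq[symmetric] by (simp add: G0_orbit_iff)
    then show "p = p'" by (rule uniq[OF p])
  qed
  have img: "?O ` ?T = V1_orbits N"
  proof
    show "?O ` ?T \<subseteq> V1_orbits N" unfolding orbits_def using normal_form_in_W by blast
    show "V1_orbits N \<subseteq> ?O ` ?T"
    proof
      fix A :: "(label \<Rightarrow> 'a) set" assume "A \<in> V1_orbits N"
      then obtain x where x: "x \<in> W" "A = G0_orbit N x" unfolding orbits_def by blast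
      obtain p where p: "p \<in> ?T" "R0 x (normal_form p)" using exh[OF x(1)] .
      then have "A = ?O p" using orbit_eq x by simp
      then show "A \<in> ?O ` ?T" using p(1) by blast
    qed
  qed
  \<comment> \<open>Every vector of V_1 reaches a normal form, whose angle is known and unique; so
    having angle \<phi> means lying in the orbit of a normal form with that angle.\<close>
  have types: "x \<in> W \<and> has_angle N (the_lift N x) (evec \<delta>) \<phi> \<longleftrightarrow>
      (\<exists>p. (p \<in> ?T \<and> type_angle p = \<phi>) \<and> R0 (normal_form p) x)" for x \<phi>
  proof
    assume *: "x \<in> W \<and> has_angle N (the_lift N x) (evec \<delta>) \<phi>"
    then obtain p where p: "p \<in> ?T" "R0 x (normal_form p)" using exh by blast
    then have px: "R0 (normal_form p) x" using R0_sym * W_subset by blast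
    then have "type_angle p = \<phi>" using angle[OF p(1) px, of \<phi>] * by simp
    then show "\<exists>p. (p \<in> ?T \<and> type_angle p = \<phi>) \<and> R0 (normal_form p) x" using p(1) px by blast
  next
    assume "\<exists>p. (p \<in> ?T \<and> type_angle p = \<phi>) \<and> R0 (normal_form p) x"
    then obtain p where p: "p \<in> ?T" "type_angle p = \<phi>" "R0 (normal_form p) x" by blast
    then show "x \<in> W \<and> has_angle N (the_lift N x) (evec \<delta>) \<phi>"
      using angle[OF p(1,3), of \<phi>] R0_invariants(1)[OF normal_form_in_W p(3)] by simp
  qed
  \<comment> \<open>The angles of the types are distinct, so each of them selects a single kind of
    orbit; the angle 0 of the zero vector is kept apart as well.\<close>
  have pi: "pi / 3 \<noteq> 0" "pi / 2 \<noteq> 0" "2 * pi / 3 \<noteq> 0" "pi / 3 \<noteq> pi / 2" "pi / 3 \<noteq> 2 * pi / 3" "pi / 3 \<noteq> pi"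
    "pi / 2 \<noteq> 2 * pi / 3" "pi / 2 \<noteq> pi" "2 * pi / 3 \<noteq> pi"
    using pi_gt_zero by linarith+
  have sub: "brilliant_types R \<subseteq> ?T" "luminous_types R \<subseteq> ?T" "dark_types RK \<subseteq> ?T"
    by (auto simp: orbit_types_def)
  have brilliant_iff: "p \<in> ?T \<and> type_angle p = pi / 2 \<longleftrightarrow> p \<in> brilliant_types R" for p
    using pi by (auto simp: orbit_types_def brilliant_types_def luminous_types_def dark_types_def)
  have luminous_iff: "p \<in> ?T \<and> type_angle p = 2 * pi / 3 \<longleftrightarrow> p \<in> luminous_types R" for p
    using pi by (auto simp: orbit_types_def brilliant_types_def luminous_types_def dark_types_def)
  have dark_iff: "p \<in> ?T \<and> type_angle p = pi \<longleftrightarrow> p \<in> dark_types RK" for p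
    using pi by (auto simp: orbit_types_def brilliant_types_def luminous_types_def dark_types_def)
  have singular_iff: "p \<in> ?T \<and> type_angle p = pi / 3 \<longleftrightarrow> p = Singular" for p
    using pi by (auto simp: orbit_types_def brilliant_types_def luminous_types_def dark_types_def)
  show ?thesis
  proof (intro conjI)
    show "bij_betw ?O ?T (V1_orbits N)" using inj img by (simp add: bij_betw_def)
    show "?O Zero = {\<lambda>k. 0}"
    proof -
      have zero: "normal_form Zero = (0 :: label \<Rightarrow> 'a)" "(\<lambda>k. 0) = (0 :: label \<Rightarrow> 'a)"
        by (simp_all add: on_roots_def fun_eq_iff)
      have "R0 0 y \<longleftrightarrow> y = 0" for y
        using Phi0_subset grp_automorphism(2)[of Phi0 _ 0 0 0] reach_refl[of Phi0 0] unfolding reach_def by auto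
      then show ?thesis unfolding zero set_eq_iff G0_orbit_iff by blast
    qed
    show "{x. singular N x} = ?O Singular"
      unfolding singular_def types singular_iff set_eq_iff mem_Collect_eq G0_orbit_iff by (simp only: simp_thms)
    show "{x. brilliant N x} = (\<Union>p\<in>brilliant_types R. ?O p)"
      unfolding brilliant_def types brilliant_iff set_eq_iff mem_Collect_eq UN_iff G0_orbit_iff by blast
    show "{x. luminous N x} = (\<Union>p\<in>luminous_types R. ?O p)"
      unfolding luminous_def types luminous_iff set_eq_iff mem_Collect_eq UN_iff G0_orbit_iff by blast
    show "{x. dark N x} = (\<Union>p\<in>dark_types RK. ?O p)"
      unfolding dark_def types dark_iff set_eq_iff mem_Collect_eq UN_iff G0_orbit_iff by blast
  qed
qed

end
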